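(* Let $M$ be a ($C^\infty$, analytic, or formal) supermanifold over a field of characteristic zero, and let $\circ$ be a supercommutative, associative, $\mathcal{O}_M$-bilinear multiplication on its tangent sheaf $\mathcal{T}_M$, with identity an even vector field $e$. Let $J(M,\circ)$ be the kernel of the canonical surjective morphism of sheaves of $\mathcal{O}_M$-algebras $$\mathrm{Symm}_{\mathcal{O}_M}(\mathcal{T}_M)\to(\mathcal{T}_M,\circ),\qquad X\cdot Y\mapsto X\circ Y,$$ i.e. the ideal defining the spectral cover $\widetilde{M}$ of $(M,\circ)$ as a closed subspace of the cotangent supermanifold $T^*M$. Then $\circ$ satisfies the identity $$P_{X\circ Y}(Z,U)-X\circ P_Y(Z,U)-(-1)^{XY}\,Y\circ P_X(Z,U)=0$$ for all local vector fields $X,Y,Z,U$ on $M$ (the structure identity of $F$-manifolds) if and only if the ideal $J(M,\circ)$ is stable with respect to the Poisson brackets, i.e. $\{J(M,\circ),J(M,\circ)\}\subset J(M,\circ)$.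
   Context: $M$ is a supermanifold (possibly purely even) with structure sheaf $\mathcal{O}_M$ of supercommutative $K$-algebras, $K$ a field of characteristic zero (usually $\mathbb{R}$ or $\mathbb{C}$). $\mathcal{T}_M$ is its tangent sheaf, locally free over $\mathcal{O}_M$ of (super)rank equal to the (super)dimension of $M$; it acts on $\mathcal{O}_M$ by derivations and carries the usual Lie superbracket $[\,,]$ of vector fields. Sign convention: $(-1)^{XY}$ means $(-1)^{|X||Y|}$, where $|X|,|Y|$ are the parities of the homogeneous elements $X,Y$; identities are for homogeneous elements. Poisson tensor: for local vector fields $X,Z,U$, $$P_X(Z,U):=[X,Z\circ U]-[X,Z]\circ U-(-1)^{XZ}\,Z\circ[X,U].$$ $\mathrm{Symm}_{\mathcal{O}_M}(\mathcal{T}_M)$ is the (super)symmetric algebra of $\mathcal{T}_M$ over $\mathcal{O}_M$, regarded as the sheaf of functions on the cotangent supermanifold $T^*M$ that are polynomial along the fibres of $T^*M\to M$; its multiplication is denoted $\cdot$. The algebra $(\mathcal{T}_M,\circ)$ is an $\mathcal{O}_M$-algebra via $f\mapsto fe$. The canonical morphism $\mathrm{Symm}_{\mathcal{O}_M}(\mathcal{T}_M)\to(\mathcal{T}_M,\circ)$ is the $\mathcal{O}_M$-algebra homomorphism that is the identity on $\mathcal{T}_M$ (so $f\mapsto fe$ for $f\in\mathcal{O}_M$). The spectral cover $\widetilde{M}$ is the relative affine spectrum of $(\mathcal{T}_M,\circ)$ over $M$. The Poisson bracket $\{\,,\}$ on $\mathrm{Symm}_{\mathcal{O}_M}(\mathcal{T}_M)$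 is the one induced by the canonical (super)symplectic structure of $T^*M$: it is the $K$-bilinear Lie superbracket that is a superderivation of $\cdot$ in each argument and satisfies $\{f,h\}=0$, $\{X,f\}=X(f)$, $\{X,Y\}=[X,Y]$ for local functions $f,h\in\mathcal{O}_M$ and local vector fields $X,Y\in\mathcal{T}_M$. *)

theory Defs
  imports "HOL-Analysis.Analysis" "HOL-Algebra.Module" "HOL-Library.Z2"
begin

section \<open>Supercommutative algebras\<close>

text \<open>
  Parities are elements of the two-element field \<^typ>\<open>bit\<close>. The component \<open>homog A i\<close> of a
  superalgebra is the set of its elements that are homogeneous of parity \<open>i\<close>; the scalar
  multiplication is inherited from the library record for modules.
\<close>

record ('k, 'a) superalgebra = "('k, 'a) module" +
  homog :: "bit \<Rightarrow> 'a set"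

text \<open>\<open>signed A s x\<close> is \<open>(-1)^s x\<close>.\<close>

definition signed :: "('a, 'b) ring_scheme \<Rightarrow> bit \<Rightarrow> 'a \<Rightarrow> 'a" where
  "signed A s x = (if s = 1 then \<ominus>\<^bsub>A\<^esub> x else x)"

locale supercommutative_algebra = ring A for A :: "('k::field, 'a) superalgebra" (structure) +
  assumes smult_closed: "x \<in> carrier A \<Longrightarrow> k \<odot> x \<in> carrier A"
    and smult_add_right: "x \<in> carrier A \<Longrightarrow> y \<in> carrier A \<Longrightarrow> k \<odot> (x \<oplus> y) = k \<odot> x \<oplus> k \<odot> y"
    and smult_add_left: "x \<in> carrier A \<Longrightarrow> (k + l) \<odot> x = k \<odot> x \<oplus> l \<odot> x"
    and smult_assoc: "x \<in> carrier A \<Longrightarrow> (k * l) \<odot> x = k \<odot> (l \<odot> x)"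
    and smult_one: "x \<in> carrier A \<Longrightarrow> 1 \<odot> x = x"
    and smult_mult_left: "x \<in> carrier A \<Longrightarrow> y \<in> carrier A \<Longrightarrow> (k \<odot> x) \<otimes> y = k \<odot> (x \<otimes> y)"
    and smult_mult_right: "x \<in> carrier A \<Longrightarrow> y \<in> carrier A \<Longrightarrow> x \<otimes> (k \<odot> y) = k \<odot> (x \<otimes> y)"
    and homog_subgroup: "subgroup (homog A i) (add_monoid A)"
    and homog_smult: "x \<in> homog A i \<Longrightarrow> k \<odot> x \<in> homog A i"
    and homog_sum: "x \<in> carrier A \<Longrightarrow> \<exists>y\<in>homog A 0. \<exists>z\<in>homog A 1. x = y \<oplus> z"
    and homog_direct: "homog A 0 \<inter> homog A 1 = {\<zero>}"
    and homog_mult: "x \<in> homog A i \<Longrightarrow> y \<in> homog A j \<Longrightarrow> x \<otimes> y \<in> homog A (i + j)"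
    and supercommute: "x \<in> homog A i \<Longrightarrow> y \<in> homog A j \<Longrightarrow> x \<otimes> y = signed A (i * j) (y \<otimes> x)"

definition superalgebra_hom ::
    "('k, 'a) superalgebra \<Rightarrow> ('k, 'b) superalgebra \<Rightarrow> ('a \<Rightarrow> 'b) set" where
  "superalgebra_hom A B = {h \<in> ring_hom A B.
     (\<forall>k. \<forall>x\<in>carrier A. h (k \<odot>\<^bsub>A\<^esub> x) = k \<odot>\<^bsub>B\<^esub> h x) \<and>
     (\<forall>i. h ` homog A i \<subseteq> homog B i)}"

definition superalgebra_iso ::
    "('k, 'a) superalgebra \<Rightarrow> ('k, 'b) superalgebra \<Rightarrow> ('a \<Rightarrow> 'b) set" where
  "superalgebra_iso A B = {h \<in> superalgebra_hom A B. bij_betw h (carrier A) (carrier B)}"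


section \<open>Spaces with a structure sheaf of supercommutative algebras\<close>

record ('x, 'k, 'a) superspace =
  base :: "'x topology"
  sheaf :: "'x set \<Rightarrow> ('k, 'a) superalgebra"
  restr :: "'x set \<Rightarrow> 'x set \<Rightarrow> 'a \<Rightarrow> 'a"

locale superringed_space =
  fixes M :: "('x, 'k::field, 'a) superspace"
  assumes sheaf_algebra: "openin (base M) U \<Longrightarrow> supercommutative_algebra (sheaf M U)"
    and restr_hom: "openin (base M) U \<Longrightarrow> openin (base M) V \<Longrightarrow> V \<subseteq> U
      \<Longrightarrow> restr M U V \<in> superalgebra_hom (sheaf M U) (sheaf M V)"
    and restr_id: "openin (base M) U \<Longrightarrow> f \<in> carrier (sheaf M U) \<Longrightarrow> restr M U U f = f"
    and restr_restr: "openin (base M) U \<Longrightarrow> openin (base M) V \<Longrightarrow> openin (base M) W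
      \<Longrightarrow> W \<subseteq> V \<Longrightarrow> V \<subseteq> U \<Longrightarrow> f \<in> carrier (sheaf M U)
      \<Longrightarrow> restr M V W (restr M U V f) = restr M U W f"
    and gluing: "(\<And>V. V \<in> \<U> \<Longrightarrow> openin (base M) V)
      \<Longrightarrow> (\<And>V. V \<in> \<U> \<Longrightarrow> s V \<in> carrier (sheaf M V))
      \<Longrightarrow> (\<And>V W. V \<in> \<U> \<Longrightarrow> W \<in> \<U> \<Longrightarrow> restr M V (V \<inter> W) (s V) = restr M W (V \<inter> W) (s W))
      \<Longrightarrow> \<exists>!f. f \<in> carrier (sheaf M (\<Union>\<U>)) \<and> (\<forall>V\<in>\<U>. restr M (\<Union>\<U>) V f = s V)"


section \<open>Supermanifolds\<close>

subsection \<open>Grassmann algebras\<close>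

text \<open>
  For a commutative algebra \<open>R\<close>, an element \<open>f\<close> of \<open>R[\<xi>_0, \<dots>, \<xi>_(n-1)]\<close> is given by its
  coefficients \<open>f I\<close> at the increasing monomials \<open>\<xi>_I\<close>, \<open>I \<subseteq> {..<n}\<close>. One has
  \<open>\<xi>_J \<xi>_L = (-1)^s \<xi>_(J \<union> L)\<close> for disjoint \<open>J\<close>, \<open>L\<close>, where \<open>s\<close> counts the inversions.
\<close>

definition inversions :: "nat set \<Rightarrow> nat set \<Rightarrow> bit" where
  "inversions J L = of_nat (card {(j, l). j \<in> J \<and> l \<in> L \<and> l < j})"

definition grassmann :: "nat \<Rightarrow> ('k, 'a) module \<Rightarrow> ('k, nat set \<Rightarrow> 'a) superalgebra" where
  "grassmann n R =
    (let C = {f. (\<forall>I. I \<subseteq> {..<n} \<longrightarrow> f I \<in> carrier R) \<and> (\<forall>I. \<not> I \<subseteq> {..<n} \<longrightarrow> f I = \<zero>\<^bsub>R\<^esub>)}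
     in \<lparr> carrier = C,
          mult = (\<lambda>f g I. if I \<subseteq> {..<n}
            then \<Oplus>\<^bsub>R\<^esub> J \<in> Pow I. signed R (inversions J (I - J)) (f J \<otimes>\<^bsub>R\<^esub> g (I - J))
            else \<zero>\<^bsub>R\<^esub>),
          one = (\<lambda>I. if I = {} then \<one>\<^bsub>R\<^esub> else \<zero>\<^bsub>R\<^esub>),
          zero = (\<lambda>I. \<zero>\<^bsub>R\<^esub>),
          add = (\<lambda>f g I. f I \<oplus>\<^bsub>R\<^esub> g I),
          smult = (\<lambda>k f I. k \<odot>\<^bsub>R\<^esub> f I),
          homog = (\<lambda>i. {f \<in> C. \<forall>I. of_nat (card I) \<noteq> i \<longrightarrow> f I = \<zero>\<^bsub>R\<^esub>}) \<rparr>)"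


subsection \<open>Smooth and analytic functions of several variables\<close>

text \<open>
  The coordinate space of dimension \<open>m\<close> over \<open>'r\<close> (real or complex numbers) consists of the
  sequences that vanish from index \<open>m\<close> on; for real numbers it is the library's
  \<^const>\<open>Euclidean_space\<close>. A natural number as dimension (rather than a finite index type)
  makes purely odd supermanifolds possible.
\<close>

definition coord_space :: "nat \<Rightarrow> (nat \<Rightarrow> 'r::real_normed_field) topology" where
  "coord_space m = top_of_set {x. \<forall>i\<ge>m. x i = 0}"

primrec Ck_on :: "nat \<Rightarrow> nat \<Rightarrow> (nat \<Rightarrow> real) set
    \<Rightarrow> ((nat \<Rightarrow> real) \<Rightarrow> 'c::real_normed_vector) \<Rightarrow> bool" where
  "Ck_on 0 m D f \<longleftrightarrow> continuous_on D f"
| "Ck_on (Suc k) m D f \<longleftrightarrow> continuous_on D f \<and>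
     (\<exists>g. \<forall>i<m. (\<forall>x\<in>D. ((\<lambda>t. f (x(i := t))) has_vector_derivative g i x) (at (x i)))
               \<and> Ck_on k m D (g i))"

definition smooth_fun :: "nat \<Rightarrow> (nat \<Rightarrow> real) set
    \<Rightarrow> ((nat \<Rightarrow> real) \<Rightarrow> 'c::real_normed_vector) \<Rightarrow> bool" where
  "smooth_fun m D f \<longleftrightarrow> (\<forall>k. Ck_on k m D f)"

definition analytic_fun :: "nat \<Rightarrow> (nat \<Rightarrow> 'c) set \<Rightarrow> ((nat \<Rightarrow> 'c) \<Rightarrow> 'c::real_normed_field) \<Rightarrow> bool" where
  "analytic_fun m D f \<longleftrightarrow> (\<forall>a\<in>D. \<exists>r>0. \<exists>c. \<forall>x\<in>D. (\<forall>i<m. norm (x i - a i) < r) \<longrightarrow>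
     ((\<lambda>\<alpha>. c \<alpha> * (\<Prod>i<m. (x i - a i) ^ \<alpha> i)) has_sum f x) {\<alpha>::nat \<Rightarrow> nat. \<forall>i\<ge>m. \<alpha> i = 0})"

text \<open>
  \<open>function_algebra \<phi> P D\<close> is the algebra of the functions on \<open>D\<close> with property \<open>P D\<close>, the
  ground field \<open>'k\<close> being identified with the field of values \<open>'c\<close> by means of \<open>\<phi>\<close>.
\<close>

definition function_algebra :: "('k \<Rightarrow> 'c)
    \<Rightarrow> ((nat \<Rightarrow> 'r) set \<Rightarrow> ((nat \<Rightarrow> 'r) \<Rightarrow> 'c) \<Rightarrow> bool)
    \<Rightarrow> (nat \<Rightarrow> 'r) set \<Rightarrow> ('k, (nat \<Rightarrow> 'r) \<Rightarrow> 'c::field) module" where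
  "function_algebra \<phi> P D =
     \<lparr> carrier = {f \<in> extensional D. P D f},
       mult = (\<lambda>f g. \<lambda>x\<in>D. f x * g x),
       one = (\<lambda>x\<in>D. 1),
       zero = (\<lambda>x\<in>D. 0),
       add = (\<lambda>f g. \<lambda>x\<in>D. f x + g x),
       smult = (\<lambda>k f. \<lambda>x\<in>D. \<phi> k * f x) \<rparr>"

text \<open>The formal power series in \<open>m\<close> variables, given by their coefficients.\<close>

definition power_series_algebra :: "nat \<Rightarrow> ('k::field, (nat \<Rightarrow> nat) \<Rightarrow> 'k) module" where
  "power_series_algebra m =
     \<lparr> carrier = {f. \<forall>\<alpha>. (\<exists>i\<ge>m. \<alpha> i \<noteq> 0) \<longrightarrow> f \<alpha> = 0},
       mult = (\<lambda>f g \<alpha>. if \<forall>i\<ge>m. \<alpha> i = 0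
                       then \<Sum>\<beta> | \<forall>i. \<beta> i \<le> \<alpha> i. f \<beta> * g (\<lambda>i. \<alpha> i - \<beta> i) else 0),
       one = (\<lambda>\<alpha>. if \<alpha> = (\<lambda>i. 0) then 1 else 0),
       zero = (\<lambda>\<alpha>. 0),
       add = (\<lambda>f g \<alpha>. f \<alpha> + g \<alpha>),
       smult = (\<lambda>k f \<alpha>. k * f \<alpha>) \<rparr>"


subsection \<open>Smooth, analytic and formal supermanifolds\<close>

definition field_iso :: "('k::field \<Rightarrow> 'c::field) \<Rightarrow> bool" where
  "field_iso \<phi> \<longleftrightarrow> bij \<phi> \<and> \<phi> 1 = 1 \<and>
     (\<forall>x y. \<phi> (x + y) = \<phi> x + \<phi> y) \<and> (\<forall>x y. \<phi> (x * y) = \<phi> x * \<phi> y)"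

definition locally_superdomain :: "('k::field \<Rightarrow> 'c::field)
    \<Rightarrow> ((nat \<Rightarrow> 'r::real_normed_field) set \<Rightarrow> ((nat \<Rightarrow> 'r) \<Rightarrow> 'c) \<Rightarrow> bool)
    \<Rightarrow> nat \<Rightarrow> nat \<Rightarrow> ('x, 'k, 'a) superspace \<Rightarrow> bool" where
  "locally_superdomain \<phi> P m n M \<longleftrightarrow>
     (\<forall>p \<in> topspace (base M). \<exists>U D h \<psi>.
        openin (base M) U \<and> p \<in> U \<and> openin (coord_space m) D \<and>
        homeomorphic_map (subtopology (base M) U) (subtopology (coord_space m) D) h \<and>
        (\<forall>V. openin (base M) V \<and> V \<subseteq> U \<longrightarrow>
           \<psi> V \<in> superalgebra_iso (sheaf M V) (grassmann n (function_algebra \<phi> P (h ` V)))) \<and>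
        (\<forall>V W f. openin (base M) V \<and> V \<subseteq> U \<and> openin (base M) W \<and> W \<subseteq> V \<and> f \<in> carrier (sheaf M V) \<longrightarrow>
           \<psi> W (restr M V W f) = (\<lambda>I. restrict (\<psi> V f I) (h ` W))))"

text \<open>
  Smooth supermanifolds are modelled on open subsets of real coordinate spaces; over the field
  of complex numbers their functions are complex-valued.
\<close>

definition smooth_supermanifold :: "nat \<Rightarrow> nat \<Rightarrow> ('x, 'k::field, 'a) superspace \<Rightarrow> bool" where
  "smooth_supermanifold m n M \<longleftrightarrow>
     (\<exists>\<phi> :: 'k \<Rightarrow> real. field_iso \<phi> \<and> locally_superdomain \<phi> (smooth_fun m) m n M) \<or>
     (\<exists>\<phi> :: 'k \<Rightarrow> complex. field_iso \<phi> \<and> locally_superdomain \<phi> (smooth_fun m) m n M)"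

definition analytic_supermanifold :: "nat \<Rightarrow> nat \<Rightarrow> ('x, 'k::field, 'a) superspace \<Rightarrow> bool" where
  "analytic_supermanifold m n M \<longleftrightarrow>
     (\<exists>\<phi> :: 'k \<Rightarrow> real. field_iso \<phi> \<and> locally_superdomain \<phi> (analytic_fun m) m n M) \<or>
     (\<exists>\<phi> :: 'k \<Rightarrow> complex. field_iso \<phi> \<and> locally_superdomain \<phi> (analytic_fun m) m n M)"

text \<open>A formal supermanifold is a formal superspectrum, whose underlying space is a point.\<close>

definition formal_supermanifold :: "nat \<Rightarrow> nat \<Rightarrow> ('x, 'k::field, 'a) superspace \<Rightarrow> bool" where
  "formal_supermanifold m n M \<longleftrightarrow>
     (\<exists>p. topspace (base M) = {p}) \<and>
     superalgebra_iso (sheaf M (topspace (base M))) (grassmann n (power_series_algebra m)) \<noteq> {}"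

definition supermanifold :: "nat \<Rightarrow> nat \<Rightarrow> ('x, 'k::field, 'a) superspace \<Rightarrow> bool" where
  "supermanifold m n M \<longleftrightarrow> superringed_space M \<and>
     (smooth_supermanifold m n M \<or> analytic_supermanifold m n M \<or> formal_supermanifold m n M)"


section \<open>The tangent sheaf\<close>

text \<open>
  A vector field \<open>X\<close> on the open set \<open>U\<close> is a \<open>'k\<close>-linear superderivation of the structure sheaf
  restricted to \<open>U\<close>, that is, a family of superderivations \<open>X V\<close> of \<open>sheaf M V\<close>, for \<open>V \<subseteq> U\<close> open,
  that commutes with restriction. Outside the domain \<open>vf_domain M U\<close> its value is fixed.
\<close>

type_synonym ('x, 'a) vfield = "'x set \<Rightarrow> 'a \<Rightarrow> 'a"

definition vf_domain :: "('x, 'k, 'a) superspace \<Rightarrow> 'x set \<Rightarrow> ('x set \<times> 'a) set" where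
  "vf_domain M U = {(V, f). openin (base M) V \<and> V \<subseteq> U \<and> f \<in> carrier (sheaf M V)}"

definition mk_vf :: "('x, 'k, 'a) superspace \<Rightarrow> 'x set \<Rightarrow> ('x, 'a) vfield \<Rightarrow> ('x, 'a) vfield" where
  "mk_vf M U X = (\<lambda>V f. if (V, f) \<in> vf_domain M U then X V f else undefined)"

definition superderivations ::
    "('x, 'k, 'a) superspace \<Rightarrow> 'x set \<Rightarrow> bit \<Rightarrow> ('x, 'a) vfield set" where
  "superderivations M U a = {X. X = mk_vf M U X \<and>
     (\<forall>V. openin (base M) V \<and> V \<subseteq> U \<longrightarrow>
        X V \<in> carrier (sheaf M V) \<rightarrow> carrier (sheaf M V) \<and>
        (\<forall>b. X V \<in> homog (sheaf M V) b \<rightarrow> homog (sheaf M V) (a + b)) \<and>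
        (\<forall>f\<in>carrier (sheaf M V). \<forall>g\<in>carrier (sheaf M V).
           X V (f \<oplus>\<^bsub>sheaf M V\<^esub> g) = X V f \<oplus>\<^bsub>sheaf M V\<^esub> X V g) \<and>
        (\<forall>k. \<forall>f\<in>carrier (sheaf M V). X V (k \<odot>\<^bsub>sheaf M V\<^esub> f) = k \<odot>\<^bsub>sheaf M V\<^esub> X V f) \<and>
        (\<forall>b. \<forall>f\<in>homog (sheaf M V) b. \<forall>g\<in>carrier (sheaf M V).
           X V (f \<otimes>\<^bsub>sheaf M V\<^esub> g) =
             X V f \<otimes>\<^bsub>sheaf M V\<^esub> g \<oplus>\<^bsub>sheaf M V\<^esub> signed (sheaf M V) (a * b) (f \<otimes>\<^bsub>sheaf M V\<^esub> X V g)) \<and>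
        (\<forall>W. openin (base M) W \<and> W \<subseteq> V \<longrightarrow>
           (\<forall>f\<in>carrier (sheaf M V). restr M V W (X V f) = X W (restr M V W f))))}"

text \<open>
  The module of vector fields on \<open>U\<close> over \<open>sheaf M U\<close>. The library record for modules contains
  ring multiplication and unit; they remain unspecified here.
\<close>

definition tangent :: "('x, 'k, 'a) superspace \<Rightarrow> 'x set \<Rightarrow> ('a, ('x, 'a) vfield) superalgebra" where
  "tangent M U =
    (let plus = (\<lambda>X Y. mk_vf M U (\<lambda>V f. X V f \<oplus>\<^bsub>sheaf M V\<^esub> Y V f))
     in \<lparr> carrier = {plus X Y | X Y. X \<in> superderivations M U 0 \<and> Y \<in> superderivations M U 1},
          mult = undefined,
          one = undefined,
          zero = mk_vf M U (\<lambda>V f. \<zero>\<^bsub>sheaf M V\<^esub>),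
          add = plus,
          smult = (\<lambda>g X. mk_vf M U (\<lambda>V f. restr M U V g \<otimes>\<^bsub>sheaf M V\<^esub> X V f)),
          homog = superderivations M U \<rparr>)"

text \<open>
  Restriction of vector fields to \<open>W\<close> is \<open>mk_vf M W\<close>. The superbracket below is that of vector
  fields \<open>X\<close>, \<open>Y\<close> of parities \<open>a\<close>, \<open>b\<close>.
\<close>

definition lie_bracket :: "('x, 'k, 'a) superspace \<Rightarrow> 'x set \<Rightarrow> bit \<Rightarrow> bit
    \<Rightarrow> ('x, 'a) vfield \<Rightarrow> ('x, 'a) vfield \<Rightarrow> ('x, 'a) vfield" where
  "lie_bracket M U a b X Y =
     mk_vf M U (\<lambda>V f. X V (Y V f) \<ominus>\<^bsub>sheaf M V\<^esub> signed (sheaf M V) (a * b) (Y V (X V f)))"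


section \<open>Multiplications on the tangent sheaf\<close>

type_synonym ('x, 'a) vf_mult = "'x set \<Rightarrow> ('x, 'a) vfield \<Rightarrow> ('x, 'a) vfield \<Rightarrow> ('x, 'a) vfield"

text \<open>
  \<open>tangent_mult M circ e\<close>: \<open>circ\<close> is a supercommutative, associative, bilinear multiplication over
  the structure sheaf, with the even global vector field \<open>e\<close> as identity. Bilinearity in the
  second argument involves the usual sign.
\<close>

definition tangent_mult ::
    "('x, 'k, 'a) superspace \<Rightarrow> ('x, 'a) vf_mult \<Rightarrow> ('x, 'a) vfield \<Rightarrow> bool" where
  "tangent_mult M circ e \<longleftrightarrow>
     e \<in> homog (tangent M (topspace (base M))) 0 \<and>
     (\<forall>U. openin (base M) U \<longrightarrow> (let T = tangent M U; A = sheaf M U in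
        (\<forall>X\<in>carrier T. \<forall>Y\<in>carrier T. circ U X Y \<in> carrier T) \<and>
        (\<forall>a b. \<forall>X\<in>homog T a. \<forall>Y\<in>homog T b. circ U X Y \<in> homog T (a + b)) \<and>
        (\<forall>X\<in>carrier T. \<forall>Y\<in>carrier T. \<forall>Z\<in>carrier T.
           circ U (X \<oplus>\<^bsub>T\<^esub> Y) Z = circ U X Z \<oplus>\<^bsub>T\<^esub> circ U Y Z \<and>
           circ U X (Y \<oplus>\<^bsub>T\<^esub> Z) = circ U X Y \<oplus>\<^bsub>T\<^esub> circ U X Z) \<and>
        (\<forall>f\<in>carrier A. \<forall>X\<in>carrier T. \<forall>Y\<in>carrier T.
           circ U (f \<odot>\<^bsub>T\<^esub> X) Y = f \<odot>\<^bsub>T\<^esub> circ U X Y) \<and>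
        (\<forall>a b. \<forall>f\<in>homog A b. \<forall>X\<in>homog T a. \<forall>Y\<in>carrier T.
           circ U X (f \<odot>\<^bsub>T\<^esub> Y) = signed T (a * b) (f \<odot>\<^bsub>T\<^esub> circ U X Y)) \<and>
        (\<forall>a b. \<forall>X\<in>homog T a. \<forall>Y\<in>homog T b. circ U X Y = signed T (a * b) (circ U Y X)) \<and>
        (\<forall>X\<in>carrier T. \<forall>Y\<in>carrier T. \<forall>Z\<in>carrier T.
           circ U (circ U X Y) Z = circ U X (circ U Y Z)) \<and>
        (\<forall>X\<in>carrier T. circ U (mk_vf M U e) X = X \<and> circ U X (mk_vf M U e) = X) \<and>
        (\<forall>V. openin (base M) V \<and> V \<subseteq> U \<longrightarrow> (\<forall>X\<in>carrier T. \<forall>Y\<in>carrier T.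
           mk_vf M V (circ U X Y) = circ V (mk_vf M V X) (mk_vf M V Y)))))"

text \<open>
  The Poisson tensor \<open>P_X(Z,W) = [X, Z \<circ> W] - [X, Z] \<circ> W - (-1)^(XZ) Z \<circ> [X, W]\<close> for \<open>X\<close>, \<open>Z\<close>, \<open>W\<close>
  of parities \<open>a\<close>, \<open>c\<close>, \<open>d\<close>.
\<close>

definition poisson_tensor :: "('x, 'k, 'a) superspace \<Rightarrow> ('x, 'a) vf_mult \<Rightarrow> 'x set
    \<Rightarrow> bit \<Rightarrow> bit \<Rightarrow> bit \<Rightarrow> ('x, 'a) vfield \<Rightarrow> ('x, 'a) vfield \<Rightarrow> ('x, 'a) vfield \<Rightarrow> ('x, 'a) vfield" where
  "poisson_tensor M circ U a c d X Z W =
     lie_bracket M U a (c + d) X (circ U Z W)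
     \<ominus>\<^bsub>tangent M U\<^esub> circ U (lie_bracket M U a c X Z) W
     \<ominus>\<^bsub>tangent M U\<^esub> signed (tangent M U) (a * c) (circ U Z (lie_bracket M U a d X W))"


section \<open>The symmetric algebra of the tangent sheaf\<close>

text \<open>
  The supersymmetric algebra of the module of vector fields on \<open>U\<close> is presented by generators,
  namely the functions and the vector fields on \<open>U\<close>, and relations: elements are represented by
  terms, and \<open>symm_eq M U\<close> is the least congruence that makes the terms a ring, embeds
  \<open>sheaf M U\<close> as a subring and \<open>tangent M U\<close> as a submodule, and makes generators supercommute.
\<close>

datatype ('a, 'v) symm_term =
    Fn 'a
  | Vec 'v
  | Plus "('a, 'v) symm_term" "('a, 'v) symm_term"
  | Times "('a, 'v) symm_term" "('a, 'v) symm_term"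

primrec symm_wf :: "('x, 'k, 'a) superspace \<Rightarrow> 'x set
    \<Rightarrow> ('a, ('x, 'a) vfield) symm_term \<Rightarrow> bool" where
  "symm_wf M U (Fn f) \<longleftrightarrow> f \<in> carrier (sheaf M U)"
| "symm_wf M U (Vec X) \<longleftrightarrow> X \<in> carrier (tangent M U)"
| "symm_wf M U (Plus t u) \<longleftrightarrow> symm_wf M U t \<and> symm_wf M U u"
| "symm_wf M U (Times t u) \<longleftrightarrow> symm_wf M U t \<and> symm_wf M U u"

definition symm_signed :: "('x, 'k, 'a) superspace \<Rightarrow> 'x set \<Rightarrow> bit
    \<Rightarrow> ('a, ('x, 'a) vfield) symm_term \<Rightarrow> ('a, ('x, 'a) vfield) symm_term" where
  "symm_signed M U s t = Times (Fn (signed (sheaf M U) s \<one>\<^bsub>sheaf M U\<^esub>)) t"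

inductive symm_eq :: "('x, 'k, 'a) superspace \<Rightarrow> 'x set
    \<Rightarrow> ('a, ('x, 'a) vfield) symm_term \<Rightarrow> ('a, ('x, 'a) vfield) symm_term \<Rightarrow> bool"
  for M U where
  refl: "symm_wf M U t \<Longrightarrow> symm_eq M U t t"
| sym: "symm_eq M U t u \<Longrightarrow> symm_eq M U u t"
| trans: "symm_eq M U t u \<Longrightarrow> symm_eq M U u v \<Longrightarrow> symm_eq M U t v"
| plus_cong: "symm_eq M U t t' \<Longrightarrow> symm_eq M U u u' \<Longrightarrow> symm_eq M U (Plus t u) (Plus t' u')"
| times_cong: "symm_eq M U t t' \<Longrightarrow> symm_eq M U u u' \<Longrightarrow> symm_eq M U (Times t u) (Times t' u')"
| plus_assoc: "symm_wf M U t \<Longrightarrow> symm_wf M U u \<Longrightarrow> symm_wf M U v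
    \<Longrightarrow> symm_eq M U (Plus (Plus t u) v) (Plus t (Plus u v))"
| plus_comm: "symm_wf M U t \<Longrightarrow> symm_wf M U u \<Longrightarrow> symm_eq M U (Plus t u) (Plus u t)"
| plus_zero: "symm_wf M U t \<Longrightarrow> symm_eq M U (Plus (Fn \<zero>\<^bsub>sheaf M U\<^esub>) t) t"
| plus_neg: "symm_wf M U t \<Longrightarrow> symm_eq M U (Plus (symm_signed M U 1 t) t) (Fn \<zero>\<^bsub>sheaf M U\<^esub>)"
| times_assoc: "symm_wf M U t \<Longrightarrow> symm_wf M U u \<Longrightarrow> symm_wf M U v
    \<Longrightarrow> symm_eq M U (Times (Times t u) v) (Times t (Times u v))"
| one_times: "symm_wf M U t \<Longrightarrow> symm_eq M U (Times (Fn \<one>\<^bsub>sheaf M U\<^esub>) t) t"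
| times_one: "symm_wf M U t \<Longrightarrow> symm_eq M U (Times t (Fn \<one>\<^bsub>sheaf M U\<^esub>)) t"
| distrib_left: "symm_wf M U t \<Longrightarrow> symm_wf M U u \<Longrightarrow> symm_wf M U v
    \<Longrightarrow> symm_eq M U (Times t (Plus u v)) (Plus (Times t u) (Times t v))"
| distrib_right: "symm_wf M U t \<Longrightarrow> symm_wf M U u \<Longrightarrow> symm_wf M U v
    \<Longrightarrow> symm_eq M U (Times (Plus t u) v) (Plus (Times t v) (Times u v))"
| Fn_plus: "f \<in> carrier (sheaf M U) \<Longrightarrow> g \<in> carrier (sheaf M U)
    \<Longrightarrow> symm_eq M U (Plus (Fn f) (Fn g)) (Fn (f \<oplus>\<^bsub>sheaf M U\<^esub> g))"
| Fn_times: "f \<in> carrier (sheaf M U) \<Longrightarrow> g \<in> carrier (sheaf M U)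
    \<Longrightarrow> symm_eq M U (Times (Fn f) (Fn g)) (Fn (f \<otimes>\<^bsub>sheaf M U\<^esub> g))"
| Vec_plus: "X \<in> carrier (tangent M U) \<Longrightarrow> Y \<in> carrier (tangent M U)
    \<Longrightarrow> symm_eq M U (Plus (Vec X) (Vec Y)) (Vec (X \<oplus>\<^bsub>tangent M U\<^esub> Y))"
| Vec_smult: "f \<in> carrier (sheaf M U) \<Longrightarrow> X \<in> carrier (tangent M U)
    \<Longrightarrow> symm_eq M U (Times (Fn f) (Vec X)) (Vec (f \<odot>\<^bsub>tangent M U\<^esub> X))"
| Vec_Fn_commute: "X \<in> homog (tangent M U) a \<Longrightarrow> f \<in> homog (sheaf M U) b
    \<Longrightarrow> symm_eq M U (Times (Vec X) (Fn f)) (symm_signed M U (a * b) (Times (Fn f) (Vec X)))"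
| Vec_Vec_commute: "X \<in> homog (tangent M U) a \<Longrightarrow> Y \<in> homog (tangent M U) b
    \<Longrightarrow> symm_eq M U (Times (Vec X) (Vec Y)) (symm_signed M U (a * b) (Times (Vec Y) (Vec X)))"

inductive symm_homog :: "('x, 'k, 'a) superspace \<Rightarrow> 'x set \<Rightarrow> bit
    \<Rightarrow> ('a, ('x, 'a) vfield) symm_term \<Rightarrow> bool" for M U where
  "f \<in> homog (sheaf M U) a \<Longrightarrow> symm_homog M U a (Fn f)"
| "X \<in> homog (tangent M U) a \<Longrightarrow> symm_homog M U a (Vec X)"
| "symm_homog M U a t \<Longrightarrow> symm_homog M U a u \<Longrightarrow> symm_homog M U a (Plus t u)"
| "symm_homog M U a t \<Longrightarrow> symm_homog M U b u \<Longrightarrow> symm_homog M U (a + b) (Times t u)"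

definition symm_restr :: "('x, 'k, 'a) superspace \<Rightarrow> 'x set \<Rightarrow> 'x set
    \<Rightarrow> ('a, ('x, 'a) vfield) symm_term \<Rightarrow> ('a, ('x, 'a) vfield) symm_term" where
  "symm_restr M U V = map_symm_term (restr M U V) (mk_vf M V)"

text \<open>
  The presheaf of supersymmetric algebras is now sheafified. Its germs are classes of pairs
  \<open>(V, t)\<close>, where \<open>t\<close> is a term over \<open>V\<close>; the sections over \<open>U\<close> of the associated sheaf are the
  families of germs at the points of \<open>U\<close> that are locally induced by terms.
\<close>

type_synonym ('x, 'a) symm_germ = "('x set \<times> ('a, ('x, 'a) vfield) symm_term) set"

definition symm_germ :: "('x, 'k, 'a) superspace \<Rightarrow> 'x \<Rightarrow> 'x set
    \<Rightarrow> ('a, ('x, 'a) vfield) symm_term \<Rightarrow> ('x, 'a) symm_germ" where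
  "symm_germ M p V t = {(W, u). openin (base M) W \<and> p \<in> W \<and> symm_wf M W u \<and>
     (\<exists>N. openin (base M) N \<and> p \<in> N \<and> N \<subseteq> V \<inter> W \<and>
          symm_eq M N (symm_restr M V N t) (symm_restr M W N u))}"

definition symm_section :: "('x, 'k, 'a) superspace \<Rightarrow> 'x set
    \<Rightarrow> ('a, ('x, 'a) vfield) symm_term \<Rightarrow> 'x \<Rightarrow> ('x, 'a) symm_germ" where
  "symm_section M U t = (\<lambda>p\<in>U. symm_germ M p U t)"

text \<open>The operation on germs induced by an operation on terms, using representatives over a
  common neighbourhood.\<close>

definition germ_lift :: "('x, 'k, 'a) superspace
    \<Rightarrow> (('a, ('x, 'a) vfield) symm_term \<Rightarrow> ('a, ('x, 'a) vfield) symm_term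
        \<Rightarrow> ('a, ('x, 'a) vfield) symm_term)
    \<Rightarrow> 'x \<Rightarrow> ('x, 'a) symm_germ \<Rightarrow> ('x, 'a) symm_germ \<Rightarrow> ('x, 'a) symm_germ" where
  "germ_lift M c p G H = \<Union>{symm_germ M p V (c t u) | V t u. (V, t) \<in> G \<and> (V, u) \<in> H}"

definition symm :: "('x, 'k, 'a) superspace \<Rightarrow> 'x set
    \<Rightarrow> ('k, 'x \<Rightarrow> ('x, 'a) symm_germ) superalgebra" where
  "symm M U =
    (let C = {s \<in> extensional U. \<forall>p\<in>U. \<exists>V t. openin (base M) V \<and> p \<in> V \<and> V \<subseteq> U \<and>
                symm_wf M V t \<and> (\<forall>q\<in>V. s q = symm_germ M q V t)};
         times = (\<lambda>s s'. \<lambda>p\<in>U. germ_lift M Times p (s p) (s' p))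
     in \<lparr> carrier = C,
          mult = times,
          one = symm_section M U (Fn \<one>\<^bsub>sheaf M U\<^esub>),
          zero = symm_section M U (Fn \<zero>\<^bsub>sheaf M U\<^esub>),
          add = (\<lambda>s s'. \<lambda>p\<in>U. germ_lift M Plus p (s p) (s' p)),
          smult = (\<lambda>k. times (symm_section M U (Fn (k \<odot>\<^bsub>sheaf M U\<^esub> \<one>\<^bsub>sheaf M U\<^esub>)))),
          homog = (\<lambda>a. {s \<in> C. \<forall>p\<in>U. \<exists>(V, t) \<in> s p. symm_homog M V a t}) \<rparr>)"

abbreviation symm_fn :: "('x, 'k, 'a) superspace \<Rightarrow> 'x set \<Rightarrow> 'a \<Rightarrow> 'x \<Rightarrow> ('x, 'a) symm_germ" where
  "symm_fn M U f \<equiv> symm_section M U (Fn f)"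

abbreviation symm_vec ::
    "('x, 'k, 'a) superspace \<Rightarrow> 'x set \<Rightarrow> ('x, 'a) vfield \<Rightarrow> 'x \<Rightarrow> ('x, 'a) symm_germ" where
  "symm_vec M U X \<equiv> symm_section M U (Vec X)"


section \<open>The canonical morphism and its kernel\<close>

primrec symm_eval :: "('x, 'k, 'a) superspace \<Rightarrow> ('x, 'a) vf_mult \<Rightarrow> ('x, 'a) vfield \<Rightarrow> 'x set
    \<Rightarrow> ('a, ('x, 'a) vfield) symm_term \<Rightarrow> ('x, 'a) vfield" where
  "symm_eval M circ e U (Fn f) = f \<odot>\<^bsub>tangent M U\<^esub> mk_vf M U e"
| "symm_eval M circ e U (Vec X) = X"
| "symm_eval M circ e U (Plus t u) = symm_eval M circ e U t \<oplus>\<^bsub>tangent M U\<^esub> symm_eval M circ e U u"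
| "symm_eval M circ e U (Times t u) = circ U (symm_eval M circ e U t) (symm_eval M circ e U u)"

text \<open>The image of a section is the unique vector field that has everywhere the germ obtained by
  evaluating representing terms.\<close>

definition canonical_morphism :: "('x, 'k, 'a) superspace \<Rightarrow> ('x, 'a) vf_mult \<Rightarrow> ('x, 'a) vfield
    \<Rightarrow> 'x set \<Rightarrow> ('x \<Rightarrow> ('x, 'a) symm_germ) \<Rightarrow> ('x, 'a) vfield" where
  "canonical_morphism M circ e U s = (THE X. X \<in> carrier (tangent M U) \<and>
     (\<forall>p\<in>U. \<forall>(V, t) \<in> s p. \<exists>N. openin (base M) N \<and> p \<in> N \<and> N \<subseteq> U \<inter> V \<and>
        mk_vf M N X = mk_vf M N (symm_eval M circ e V t)))"

definition spectral_ideal :: "('x, 'k, 'a) superspace \<Rightarrow> ('x, 'a) vf_mult \<Rightarrow> ('x, 'a) vfield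
    \<Rightarrow> 'x set \<Rightarrow> ('x \<Rightarrow> ('x, 'a) symm_germ) set" where
  "spectral_ideal M circ e U =
     {s \<in> carrier (symm M U). canonical_morphism M circ e U s = \<zero>\<^bsub>tangent M U\<^esub>}"


section \<open>The Poisson bracket\<close>

text \<open>
  The canonical bracket on \<open>symm M\<close>, characterized as the morphism of sheaves that is an even
  Lie superbracket over \<open>'k\<close> and a superderivation in each argument and has the prescribed
  values on functions and vector fields. (Restriction of sections of \<open>symm M\<close> to \<open>V\<close> is
  restriction of functions.)
\<close>

definition canonical_poisson_bracket :: "('x, 'k, 'a) superspace
    \<Rightarrow> ('x set \<Rightarrow> ('x \<Rightarrow> ('x, 'a) symm_germ) \<Rightarrow> ('x \<Rightarrow> ('x, 'a) symm_germ) \<Rightarrow> ('x \<Rightarrow> ('x, 'a) symm_germ))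
    \<Rightarrow> bool" where
  "canonical_poisson_bracket M br \<longleftrightarrow>
     (\<forall>U. openin (base M) U \<longrightarrow> (let S = symm M U; T = tangent M U; A = sheaf M U in
        (\<forall>s\<in>carrier S. \<forall>t\<in>carrier S. br U s t \<in> carrier S) \<and>
        (\<forall>a b. \<forall>s\<in>homog S a. \<forall>t\<in>homog S b. br U s t \<in> homog S (a + b)) \<and>
        (\<forall>V. openin (base M) V \<and> V \<subseteq> U \<longrightarrow> (\<forall>s\<in>carrier S. \<forall>t\<in>carrier S.
           restrict (br U s t) V = br V (restrict s V) (restrict t V))) \<and>
        (\<forall>s\<in>carrier S. \<forall>t\<in>carrier S. \<forall>u\<in>carrier S.
           br U (s \<oplus>\<^bsub>S\<^esub> t) u = br U s u \<oplus>\<^bsub>S\<^esub> br U t u \<and>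
           br U s (t \<oplus>\<^bsub>S\<^esub> u) = br U s t \<oplus>\<^bsub>S\<^esub> br U s u) \<and>
        (\<forall>k. \<forall>s\<in>carrier S. \<forall>t\<in>carrier S.
           br U (k \<odot>\<^bsub>S\<^esub> s) t = k \<odot>\<^bsub>S\<^esub> br U s t \<and> br U s (k \<odot>\<^bsub>S\<^esub> t) = k \<odot>\<^bsub>S\<^esub> br U s t) \<and>
        (\<forall>a b. \<forall>s\<in>homog S a. \<forall>t\<in>homog S b.
           br U s t = \<ominus>\<^bsub>S\<^esub> signed S (a * b) (br U t s)) \<and>
        (\<forall>a b c. \<forall>s\<in>homog S a. \<forall>t\<in>homog S b. \<forall>u\<in>homog S c.
           br U s (br U t u) = br U (br U s t) u \<oplus>\<^bsub>S\<^esub> signed S (a * b) (br U t (br U s u))) \<and>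
        (\<forall>a b c. \<forall>s\<in>homog S a. \<forall>t\<in>homog S b. \<forall>u\<in>homog S c.
           br U s (t \<otimes>\<^bsub>S\<^esub> u) = br U s t \<otimes>\<^bsub>S\<^esub> u \<oplus>\<^bsub>S\<^esub> signed S (a * b) (t \<otimes>\<^bsub>S\<^esub> br U s u) \<and>
           br U (s \<otimes>\<^bsub>S\<^esub> t) u = s \<otimes>\<^bsub>S\<^esub> br U t u \<oplus>\<^bsub>S\<^esub> signed S (b * c) (br U s u \<otimes>\<^bsub>S\<^esub> t)) \<and>
        (\<forall>f\<in>carrier A. \<forall>h\<in>carrier A. br U (symm_fn M U f) (symm_fn M U h) = \<zero>\<^bsub>S\<^esub>) \<and>
        (\<forall>X\<in>carrier T. \<forall>f\<in>carrier A. br U (symm_vec M U X) (symm_fn M U f) = symm_fn M U (X U f)) \<and>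
        (\<forall>a b. \<forall>X\<in>homog T a. \<forall>Y\<in>homog T b.
           br U (symm_vec M U X) (symm_vec M U Y) = symm_vec M U (lie_bracket M U a b X Y))))"

end

theory Submission
  imports Defs
begin

text \<open>
  As the canonical morphism \<open>\<phi>\<close> is the identity on vector fields, its kernel is locally generated
  by \<open>1 - e\<close> and the elements \<open>X Y - X \<circ> Y\<close>. The Leibniz rule gives
  \<open>\<phi> {X, Z W - Z \<circ> W} = - P_X(Z,W)\<close> and, applied once more,
  \<open>\<phi> {X Y - X \<circ> Y, Z W - Z \<circ> W} = P_(X \<circ> Y)(Z,W) - X \<circ> P_Y(Z,W) - (-1)^(XY) Y \<circ> P_X(Z,W)\<close>.
  So stability implies the structure identity. Conversely, the identity makes the generators bracket
  into the kernel; for \<open>X = Y = e\<close> it gives \<open>P_e = 0\<close>, which settles the brackets with \<open>e\<close>. If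
  \<open>\<phi> {t, e} = 0\<close> and \<open>\<phi> {t, Z W - Z \<circ> W} = 0\<close> for all \<open>Z\<close>, \<open>W\<close>, then \<open>\<phi> {t, u}\<close> depends only on
  \<open>\<phi> u\<close>, by induction on the expression \<open>u\<close>. Applied first to \<open>t = e\<close> and \<open>t = X Y - X \<circ> Y\<close>, and then,
  by antisymmetry, to arbitrary \<open>t\<close> in the kernel, this yields stability.

  The kernel is defined by a definite description, so that the image of a section of the symmetric
  algebra must be shown to exist: this is the gluing of vector fields.
\<close>

text \<open>The bracket is known only through its axioms. Its Leibniz and antisymmetry rules, like
  the structure identity, speak of homogeneous arguments, whereas a section of the symmetric algebra
  is a family of germs represented by inhomogeneous terms on small open sets. So a section is
  restricted until it comes from one term, the term is split into an even and an odd part, and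
  uniqueness of the parity decomposition of vector fields keeps both parts in the kernel. The
  vanishing of the resulting vector field is then checked on a cover.

  That the kernel is locally generated as described is never proved as such. Instead the second
  argument of the bracket is rewritten along the structure of its term, with the elements
  \<open>X Y - X \<circ> Y\<close> as corrections for products. The generator \<open>1 - e\<close>
  is replaced by the field \<open>e\<close>: by the Leibniz rule the images of \<open>{t, f}\<close>
  and \<open>{t, f e}\<close> differ by a multiple of the image of \<open>{t, e}\<close>.\<close>

section \<open>Signs and gradings\<close>

text \<open>These simplification rules would turn sums and products of parities into bit operations.\<close>

declare add_bit_eq_xor [simp del] mult_bit_eq_and [simp del]

lemma bit_plus_self [simp]: "a + a = (0::bit)"
  by (cases a) simp_all

context abelian_group
begin

text \<open>\<open>signed\<close> involves only the additive inverse, so its laws are those of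
  abelian groups. This generality matters because the module of vector fields carries no ring
  multiplication.\<close>

lemma signed_0 [simp]: "signed G 0 x = x"
  by (simp add: signed_def)

lemma signed_1 [simp]: "signed G 1 x = \<ominus> x"
  by (simp add: signed_def)

lemma signed_closed [simp, intro]: "x \<in> carrier G \<Longrightarrow> signed G s x \<in> carrier G"
  by (simp add: signed_def)

lemma signed_add: "x \<in> carrier G \<Longrightarrow> y \<in> carrier G \<Longrightarrow> signed G s (x \<oplus> y) = signed G s x \<oplus> signed G s y"
  by (simp add: signed_def minus_add)

lemma signed_minus: "x \<in> carrier G \<Longrightarrow> signed G s (\<ominus> x) = \<ominus> signed G s x"
  by (simp add: signed_def)

lemma signed_signed: "x \<in> carrier G \<Longrightarrow> signed G s (signed G t x) = signed G (s + t) x"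
  by (cases s; cases t) simp_all

lemma add_minus_cancel_left: "x \<in> carrier G \<Longrightarrow> y \<in> carrier G \<Longrightarrow> (x \<oplus> y) \<ominus> x = y"
  by (simp add: minus_eq a_assoc a_comm r_neg2) (simp add: a_assoc[symmetric] l_neg)

lemma signed_zero [simp]: "signed G s \<zero> = \<zero>"
  by (simp add: signed_def)

end

context ring
begin

lemma signed_l: "x \<in> carrier R \<Longrightarrow> y \<in> carrier R \<Longrightarrow> signed R s x \<otimes> y = signed R s (x \<otimes> y)"
  by (simp add: signed_def l_minus)

lemma signed_r: "x \<in> carrier R \<Longrightarrow> y \<in> carrier R \<Longrightarrow> x \<otimes> signed R s y = signed R s (x \<otimes> y)"
  by (simp add: signed_def r_minus)

end

text \<open>Only additivity is asked of \<open>h\<close>, so that the facts apply alike to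
  restrictions, derivations, scalar multiplication in either argument, \<open>circ\<close> and the
  canonical morphism. They are the laws of a group homomorphism between the additive
  monoids.\<close>

lemma
  assumes "abelian_group G" "abelian_group H" "\<And>x. x \<in> carrier G \<Longrightarrow> h x \<in> carrier H"
    and "\<And>x y. x \<in> carrier G \<Longrightarrow> y \<in> carrier G \<Longrightarrow> h (x \<oplus>\<^bsub>G\<^esub> y) = h x \<oplus>\<^bsub>H\<^esub> h y"
  shows additive_zero: "h \<zero>\<^bsub>G\<^esub> = \<zero>\<^bsub>H\<^esub>"
    and additive_minus: "x \<in> carrier G \<Longrightarrow> h (\<ominus>\<^bsub>G\<^esub> x) = \<ominus>\<^bsub>H\<^esub> h x"
    and additive_diff: "x \<in> carrier G \<Longrightarrow> y \<in> carrier G \<Longrightarrow> h (x \<ominus>\<^bsub>G\<^esub> y) = h x \<ominus>\<^bsub>H\<^esub> h y"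
    and additive_signed: "x \<in> carrier G \<Longrightarrow> h (signed G s x) = signed H s (h x)"
proof -
  interpret G: abelian_group G by fact
  interpret H: abelian_group H by fact
  interpret group_hom "add_monoid G" "add_monoid H" h
    using assms by unfold_locales (auto simp: hom_def)
  show "h \<zero>\<^bsub>G\<^esub> = \<zero>\<^bsub>H\<^esub>" using hom_one by simp
  show m: "x \<in> carrier G \<Longrightarrow> h (\<ominus>\<^bsub>G\<^esub> x) = \<ominus>\<^bsub>H\<^esub> h x" for x
    using hom_inv[of x] by (simp add: a_inv_def)
  show "x \<in> carrier G \<Longrightarrow> y \<in> carrier G \<Longrightarrow> h (x \<ominus>\<^bsub>G\<^esub> y) = h x \<ominus>\<^bsub>H\<^esub> h y"
    by (simp add: G.minus_eq H.minus_eq assms m)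
  show "x \<in> carrier G \<Longrightarrow> h (signed G s x) = signed H s (h x)"
    by (simp add: signed_def m)
qed

section \<open>Parity components of a supercommutative algebra\<close>

context supercommutative_algebra
begin

lemma homog_closed [intro]: "x \<in> homog A i \<Longrightarrow> x \<in> carrier A"
  using subgroup.subset[OF homog_subgroup[of i]] by auto

lemma homog_zero [simp]: "\<zero> \<in> homog A i"
  using subgroup.one_closed[OF homog_subgroup[of i]] by simp

lemma homog_add: "x \<in> homog A i \<Longrightarrow> y \<in> homog A i \<Longrightarrow> x \<oplus> y \<in> homog A i"
  using subgroup.m_closed[OF homog_subgroup[of i]] by simp

lemma homog_minus: "x \<in> homog A i \<Longrightarrow> \<ominus> x \<in> homog A i"
  using subgroup.m_inv_closed[OF homog_subgroup[of i]] by (simp add: a_inv_def)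

lemma homog_signed: "x \<in> homog A i \<Longrightarrow> signed A s x \<in> homog A i"
  by (simp add: signed_def homog_minus)

text \<open>In the two-element field \<open>i + 1\<close> is the parity opposite to
  \<open>i\<close>; this form avoids distinguishing the even and the odd component.\<close>

lemma homog_both: "x \<in> homog A i \<Longrightarrow> x \<in> homog A (i + 1) \<Longrightarrow> x = \<zero>"
  using homog_direct by (cases i) auto

lemma homog_sum': "x \<in> carrier A \<Longrightarrow> \<exists>y\<in>homog A i. \<exists>z\<in>homog A (i + 1). x = y \<oplus> z"
proof (cases "i = 1")
  case True
  assume "x \<in> carrier A"
  then obtain y z where yz: "y \<in> homog A 0" "z \<in> homog A 1" "x = y \<oplus> z" using homog_sum by blast
  then have "x = z \<oplus> y" using a_comm homog_closed by metis
  moreover have "i + 1 = 0" using True by simp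
  ultimately show ?thesis using yz(1,2) True by metis
qed (use homog_sum in simp)

text \<open>Evenness of the unit is not an axiom but follows from the grading. Write
  \<open>1 = y + z\<close> with \<open>y\<close> even and \<open>z\<close> odd. Comparing odd parts
  in \<open>y = y y + y z\<close> gives \<open>y z = 0\<close>, hence
  \<open>z = y z + z z = z z\<close> is even as well as odd, and vanishes.\<close>

lemma one_homog: "\<one> \<in> homog A 0"
proof -
  obtain y z where yz: "y \<in> homog A 0" "z \<in> homog A 1" "\<one> = y \<oplus> z"
    using homog_sum[OF one_closed] by blast
  have yc: "y \<in> carrier A" and zc: "z \<in> carrier A" using yz by auto
  have "y = y \<otimes> y \<oplus> y \<otimes> z"
    using r_one[OF yc] unfolding yz(3) by (simp add: r_distr yc zc)
  then have "y \<ominus> y \<otimes> y = (y \<otimes> y \<oplus> y \<otimes> z) \<ominus> y \<otimes> y" by (rule arg_cong)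
  also have "\<dots> = y \<otimes> z" using yc zc by algebra
  finally have "y \<otimes> z = y \<ominus> y \<otimes> y" ..
  moreover have "y \<ominus> y \<otimes> y \<in> homog A 0"
    using homog_mult[OF yz(1) yz(1)] yz(1) by (simp add: minus_eq homog_add homog_minus)
  moreover have "y \<otimes> z \<in> homog A 1"
    using homog_mult[OF yz(1) yz(2)] by simp
  ultimately have 1: "y \<otimes> z = \<zero>" using homog_both[of _ 0] by simp
  have "z = y \<otimes> z \<oplus> z \<otimes> z"
    using l_one[OF zc] unfolding yz(3) by (simp add: l_distr yc zc)
  also have "\<dots> = z \<otimes> z" using 1 zc by simp
  finally have 2: "z = z \<otimes> z" .
  have "z \<otimes> z \<in> homog A 0" using homog_mult[OF yz(2) yz(2)] by simp
  then have "z \<in> homog A 0" using 2 by metis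
  then have "z = \<zero>" using yz(2) homog_both[of z 0] by simp
  with yz yc show ?thesis by simp
qed

end

section \<open>Sections of the structure sheaf\<close>

context superringed_space
begin

abbreviation opn where "opn V \<equiv> openin (base M) V"

lemma
  assumes "opn U" "opn V" "V \<subseteq> U"
  shows restr_closed: "f \<in> carrier (sheaf M U) \<Longrightarrow> restr M U V f \<in> carrier (sheaf M V)"
    and restr_add: "f \<in> carrier (sheaf M U) \<Longrightarrow> g \<in> carrier (sheaf M U) \<Longrightarrow>
      restr M U V (f \<oplus>\<^bsub>sheaf M U\<^esub> g) = restr M U V f \<oplus>\<^bsub>sheaf M V\<^esub> restr M U V g"
    and restr_mult: "f \<in> carrier (sheaf M U) \<Longrightarrow> g \<in> carrier (sheaf M U) \<Longrightarrow>
      restr M U V (f \<otimes>\<^bsub>sheaf M U\<^esub> g) = restr M U V f \<otimes>\<^bsub>sheaf M V\<^esub> restr M U V g"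
    and restr_one: "restr M U V \<one>\<^bsub>sheaf M U\<^esub> = \<one>\<^bsub>sheaf M V\<^esub>"
    and restr_smult: "f \<in> carrier (sheaf M U) \<Longrightarrow>
      restr M U V (k \<odot>\<^bsub>sheaf M U\<^esub> f) = k \<odot>\<^bsub>sheaf M V\<^esub> restr M U V f"
    and restr_homog: "f \<in> homog (sheaf M U) a \<Longrightarrow> restr M U V f \<in> homog (sheaf M V) a"
  using restr_hom[OF assms]
  by (auto simp: superalgebra_hom_def ring_hom_closed ring_hom_add ring_hom_mult ring_hom_one
      image_subset_iff)

lemma sheaf_group: "opn U \<Longrightarrow> abelian_group (sheaf M U)"
  using sheaf_algebra[of U] by (simp add: supercommutative_algebra_def ring_def)

lemma sheaf_ring: "opn U \<Longrightarrow> ring (sheaf M U)"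
  using sheaf_algebra[of U] by (simp add: supercommutative_algebra_def)

lemma
  assumes "opn U" "opn V" "V \<subseteq> U"
  shows restr_zero: "restr M U V \<zero>\<^bsub>sheaf M U\<^esub> = \<zero>\<^bsub>sheaf M V\<^esub>"
    and restr_minus: "f \<in> carrier (sheaf M U) \<Longrightarrow>
      restr M U V (\<ominus>\<^bsub>sheaf M U\<^esub> f) = \<ominus>\<^bsub>sheaf M V\<^esub> restr M U V f"
    and restr_signed: "f \<in> carrier (sheaf M U) \<Longrightarrow>
      restr M U V (signed (sheaf M U) s f) = signed (sheaf M V) s (restr M U V f)"
proof -
  note * = sheaf_group[OF assms(1)] sheaf_group[OF assms(2)]
    restr_closed[OF assms] restr_add[OF assms]
  show "restr M U V \<zero>\<^bsub>sheaf M U\<^esub> = \<zero>\<^bsub>sheaf M V\<^esub>"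
    by (rule additive_zero[OF *])
  show "restr M U V (\<ominus>\<^bsub>sheaf M U\<^esub> f) = \<ominus>\<^bsub>sheaf M V\<^esub> restr M U V f" if "f \<in> carrier (sheaf M U)"
    by (rule additive_minus[OF * that])
  show "restr M U V (signed (sheaf M U) s f) = signed (sheaf M V) s (restr M U V f)"
    if "f \<in> carrier (sheaf M U)"
    by (rule additive_signed[OF * that])
qed

lemma opn_Union: "(\<And>N. N \<in> \<BB> \<Longrightarrow> opn N) \<Longrightarrow> \<Union>\<BB> = U \<Longrightarrow> opn U"
  by (metis openin_Union)

text \<open>Separation is the uniqueness half of the gluing axiom, applied to the family of
  restrictions of \<open>f\<close>: this family is compatible, and both \<open>f\<close> and
  \<open>g\<close> glue it.\<close>

lemma separated:
  assumes "\<And>N. N \<in> \<BB> \<Longrightarrow> opn N" "\<Union>\<BB> = U" "f \<in> carrier (sheaf M U)" "g \<in> carrier (sheaf M U)"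
    and "\<And>N. N \<in> \<BB> \<Longrightarrow> restr M U N f = restr M U N g"
  shows "f = g"
proof -
  have U: "opn U" using opn_Union assms(1,2) by metis
  have sub: "N \<subseteq> U" if "N \<in> \<BB>" for N using that assms(2) by auto
  have "\<exists>!h. h \<in> carrier (sheaf M (\<Union>\<BB>)) \<and> (\<forall>V\<in>\<BB>. restr M (\<Union>\<BB>) V h = restr M U V f)"
  proof (rule gluing)
    fix V W assume VW: "V \<in> \<BB>" "W \<in> \<BB>"
    then have o: "opn (V \<inter> W)" using assms(1) by auto
    show "restr M V (V \<inter> W) (restr M U V f) = restr M W (V \<inter> W) (restr M U W f)"
      by (simp add: restr_restr[OF U assms(1)[OF VW(1)] o _ sub[OF VW(1)] assms(3)]
          restr_restr[OF U assms(1)[OF VW(2)] o _ sub[OF VW(2)] assms(3)])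
  qed (use assms(1,3) restr_closed[OF U] sub in auto)
  then show ?thesis using assms by metis
qed

text \<open>For a family of open sets closed under passing to smaller ones, compatibility on an
  intersection reduces to compatibility along inclusions, since the intersection is itself a
  member.\<close>

lemma glue_sections:
  assumes "\<And>N. N \<in> \<BB> \<Longrightarrow> opn N" "\<Union>\<BB> = U"
    and down: "\<And>N N'. N \<in> \<BB> \<Longrightarrow> opn N' \<Longrightarrow> N' \<subseteq> N \<Longrightarrow> N' \<in> \<BB>"
    and "\<And>N. N \<in> \<BB> \<Longrightarrow> s N \<in> carrier (sheaf M N)"
    and "\<And>N N'. N \<in> \<BB> \<Longrightarrow> N' \<in> \<BB> \<Longrightarrow> N' \<subseteq> N \<Longrightarrow> restr M N N' (s N) = s N'"
  shows "\<exists>g\<in>carrier (sheaf M U). \<forall>N\<in>\<BB>. restr M U N g = s N"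
proof -
  have "\<exists>!h. h \<in> carrier (sheaf M (\<Union>\<BB>)) \<and> (\<forall>V\<in>\<BB>. restr M (\<Union>\<BB>) V h = s V)"
  proof (rule gluing)
    fix V W assume VW: "V \<in> \<BB>" "W \<in> \<BB>"
    then have "V \<inter> W \<in> \<BB>" using assms(1)[OF VW(1)] assms(1)[OF VW(2)]
        by (intro down[of V "V \<inter> W"]) auto
    then show "restr M V (V \<inter> W) (s V) = restr M W (V \<inter> W) (s W)"
      using assms(5)[OF VW(1), of "V \<inter> W"] assms(5)[OF VW(2), of "V \<inter> W"] by (metis Int_lower1 Int_lower2)
  qed (use assms(1,4) in auto)
  then show ?thesis unfolding assms(2) by (rule ex1E) blast
qed

text \<open>Split \<open>g\<close> into parts \<open>y\<close> of parity \<open>b\<close> and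
  \<open>z\<close> of the other parity. On each member of the cover \<open>z\<close> is the
  difference of two sections of parity \<open>b\<close>, so it has both parities and vanishes there;
  separation gives \<open>z = 0\<close>.\<close>

lemma homog_local:
  assumes "\<And>N. N \<in> \<BB> \<Longrightarrow> opn N" "\<Union>\<BB> = U" "g \<in> carrier (sheaf M U)"
    and "\<And>N. N \<in> \<BB> \<Longrightarrow> restr M U N g \<in> homog (sheaf M N) b"
  shows "g \<in> homog (sheaf M U) b"
proof -
  have U: "opn U" using opn_Union assms(1,2) by metis
  interpret A: supercommutative_algebra "sheaf M U" using sheaf_algebra U .
  obtain y z where yz: "y \<in> homog (sheaf M U) b" "z \<in> homog (sheaf M U) (b + 1)" "g = y \<oplus>\<^bsub>sheaf M U\<^esub> z"
    using A.homog_sum'[OF assms(3)] by blast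
  have c: "y \<in> carrier (sheaf M U)" "z \<in> carrier (sheaf M U)" using yz by auto
  have "z = \<zero>\<^bsub>sheaf M U\<^esub>"
  proof (rule separated[OF assms(1,2), of z "\<zero>\<^bsub>sheaf M U\<^esub>"])
    fix N assume N: "N \<in> \<BB>"
    then have o: "opn N" "N \<subseteq> U" using assms by auto
    interpret B: supercommutative_algebra "sheaf M N" using sheaf_algebra o by simp
    have h: "restr M U N y \<in> homog (sheaf M N) b" "restr M U N z \<in> homog (sheaf M N) (b + 1)"
      using restr_homog[OF U o] yz by auto
    have hc: "restr M U N y \<in> carrier (sheaf M N)" "restr M U N z \<in> carrier (sheaf M N)" using h by auto
    have "restr M U N g = restr M U N y \<oplus>\<^bsub>sheaf M N\<^esub> restr M U N z"
      using restr_add[OF U o c] yz(3) by simp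
    then have "restr M U N z = restr M U N g \<ominus>\<^bsub>sheaf M N\<^esub> restr M U N y"
      using hc by (simp add: B.add_minus_cancel_left)
    then have "restr M U N z \<in> homog (sheaf M N) b"
      using B.homog_add[OF assms(4)[OF N] B.homog_minus[OF h(1)]] by (simp add: B.minus_eq)
    then show "restr M U N z = restr M U N \<zero>\<^bsub>sheaf M U\<^esub>"
      using B.homog_both[OF _ h(2)] by (simp add: restr_zero[OF U o])
  qed (simp_all add: c)
  then show ?thesis using yz(1,3) c(1) by simp
qed

end

context abelian_group
begin

lemma diff_add_cancel_right:
  assumes [simp]: "x \<in> carrier G" "y \<in> carrier G" "z \<in> carrier G"
  shows "(x \<oplus> z) \<ominus> (y \<oplus> z) = x \<ominus> y"
proof -
  have "(x \<oplus> z) \<ominus> (y \<oplus> z) = x \<oplus> (z \<oplus> (\<ominus> z \<oplus> \<ominus> y))"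
    by (simp add: minus_eq minus_add a_comm a_assoc)
  also have "z \<oplus> (\<ominus> z \<oplus> \<ominus> y) = \<ominus> y" by (rule r_neg2) simp_all
  finally show ?thesis by (simp add: minus_eq)
qed

text \<open>The sign bookkeeping behind the Leibniz rule for a superbracket of fields
  \<open>X\<close>, \<open>Y\<close> of parities \<open>a\<close>, \<open>b\<close>, applied to
  \<open>f g\<close> with \<open>f\<close> of parity \<open>c\<close>. Here \<open>p1\<close>,
  \<open>p2\<close> stand for \<open>X(Y f) g\<close> and \<open>Y(X f) g\<close>,
  \<open>q1\<close>, \<open>q2\<close> for \<open>f X(Y g)\<close> and \<open>f Y(X g)\<close>, and
  \<open>r\<close>, \<open>t\<close> for the mixed terms \<open>Y f X g\<close> and
  \<open>X f Y g\<close>, which cancel.\<close>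

lemma leibniz_signs:
  assumes [simp]: "p1 \<in> carrier G" "p2 \<in> carrier G" "q1 \<in> carrier G" "q2 \<in> carrier G" "r \<in> carrier G" "t \<in> carrier G"
  shows "(p1 \<oplus> signed G (a * (b + c)) r \<oplus> signed G (b * c) (t \<oplus> signed G (a * c) q1))
      \<ominus> signed G (a * b) (p2 \<oplus> signed G (b * (a + c)) t \<oplus> signed G (a * c) (r \<oplus> signed G (b * c) q2)) =
    (p1 \<ominus> signed G (a * b) p2) \<oplus> signed G ((a + b) * c) (q1 \<ominus> signed G (a * b) q2)"
proof -
  define R T Q P' Q' where "R = signed G (a * (b + c)) r" "T = signed G (b * c) t"
    "Q = signed G ((a + b) * c) q1" "P' = signed G (a * b) p2" "Q' = signed G ((a + b) * c + a * b) q2"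
  note defs = this
  have [simp]: "R \<in> carrier G" "T \<in> carrier G" "Q \<in> carrier G" "P' \<in> carrier G" "Q' \<in> carrier G"
    by (simp_all add: defs)
  have bits: "b * c + a * c = (a + b) * c" "a * b + b * (a + c) = b * c"
    "a * b + a * c = a * (b + c)" "a * b + (a * c + b * c) = (a + b) * c + a * b"
    by (cases a; cases b; cases c; simp)+
  have "?thesis \<longleftrightarrow> (p1 \<oplus> R \<oplus> (T \<oplus> Q)) \<ominus> (P' \<oplus> T \<oplus> (R \<oplus> Q')) = (p1 \<ominus> P') \<oplus> (Q \<ominus> Q')"
    by (simp add: signed_add signed_signed bits defs[symmetric] signed_minus minus_eq add.assoc)
  moreover have "(p1 \<oplus> R \<oplus> (T \<oplus> Q)) \<ominus> (P' \<oplus> T \<oplus> (R \<oplus> Q'))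
      = ((p1 \<oplus> Q) \<oplus> (R \<oplus> T)) \<ominus> ((P' \<oplus> Q') \<oplus> (R \<oplus> T))" by (simp add: a_ac)
  moreover have "\<dots> = (p1 \<ominus> P') \<oplus> (Q \<ominus> Q')"
    by (subst diff_add_cancel_right) (simp_all add: minus_eq minus_add a_ac)
  ultimately show ?thesis by simp
qed

end

section \<open>Vector fields\<close>

text \<open>\<open>mk_vf M U\<close> fixes the values outside the domain, so it is at once the
  normal form of a vector field on \<open>U\<close> and the restriction to \<open>U\<close>.
  Transitivity of restriction is therefore a single simplification rule.\<close>

lemma mk_vf_mk_vf [simp]: "V \<subseteq> U \<Longrightarrow> mk_vf M V (mk_vf M U X) = mk_vf M V X"
  by (auto simp: mk_vf_def vf_domain_def fun_eq_iff)

lemma mk_vf_apply [simp]: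
  "openin (base M) V \<Longrightarrow> V \<subseteq> U \<Longrightarrow> f \<in> carrier (sheaf M V) \<Longrightarrow> mk_vf M U X V f = X V f"
  by (simp add: mk_vf_def vf_domain_def)

lemma mk_vf_eqI:
  "(\<And>V f. openin (base M) V \<Longrightarrow> V \<subseteq> U \<Longrightarrow> f \<in> carrier (sheaf M V) \<Longrightarrow> X V f = Y V f)
    \<Longrightarrow> mk_vf M U X = mk_vf M U Y"
  by (auto simp: mk_vf_def vf_domain_def fun_eq_iff)

lemma tangent_sel:
  "zero (tangent M U) = mk_vf M U (\<lambda>V f. \<zero>\<^bsub>sheaf M V\<^esub>)"
  "add (tangent M U) X Y = mk_vf M U (\<lambda>V f. X V f \<oplus>\<^bsub>sheaf M V\<^esub> Y V f)"
  "smult (tangent M U) g X = mk_vf M U (\<lambda>V f. restr M U V g \<otimes>\<^bsub>sheaf M V\<^esub> X V f)"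
  by (simp_all add: tangent_def)

lemma homog_tangent: "homog (tangent M U) = superderivations M U"
  by (simp add: tangent_def)

lemma carrier_tangent:
  "carrier (tangent M U) =
    {X \<oplus>\<^bsub>tangent M U\<^esub> Y | X Y. X \<in> homog (tangent M U) 0 \<and> Y \<in> homog (tangent M U) 1}"
  by (simp add: tangent_def)

section \<open>Homogeneous vector fields and the operations that respect parity\<close>

context superringed_space
begin

text \<open>The Leibniz premise supplies \<open>f\<close> both as homogeneous and as an element of
  the carrier, so that closure facts about \<open>f\<close> are at hand whenever a candidate is
  shown to be a superderivation.\<close>

lemma homog_tangentI:
  assumes "X = mk_vf M U X"
    and "\<And>V f. opn V \<Longrightarrow> V \<subseteq> U \<Longrightarrow> f \<in> carrier (sheaf M V) \<Longrightarrow> X V f \<in> carrier (sheaf M V)"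
    and "\<And>V b f. opn V \<Longrightarrow> V \<subseteq> U \<Longrightarrow> f \<in> homog (sheaf M V) b \<Longrightarrow> X V f \<in> homog (sheaf M V) (a + b)"
    and "\<And>V f g. opn V \<Longrightarrow> V \<subseteq> U \<Longrightarrow> f \<in> carrier (sheaf M V) \<Longrightarrow> g \<in> carrier (sheaf M V) \<Longrightarrow>
      X V (f \<oplus>\<^bsub>sheaf M V\<^esub> g) = X V f \<oplus>\<^bsub>sheaf M V\<^esub> X V g"
    and "\<And>V k f. opn V \<Longrightarrow> V \<subseteq> U \<Longrightarrow> f \<in> carrier (sheaf M V) \<Longrightarrow>
      X V (k \<odot>\<^bsub>sheaf M V\<^esub> f) = k \<odot>\<^bsub>sheaf M V\<^esub> X V f"
    and "\<And>V b f g. opn V \<Longrightarrow> V \<subseteq> U \<Longrightarrow> f \<in> homog (sheaf M V) b \<Longrightarrow> g \<in> carrier (sheaf M V) \<Longrightarrow>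
      f \<in> carrier (sheaf M V) \<Longrightarrow>
      X V (f \<otimes>\<^bsub>sheaf M V\<^esub> g) =
        X V f \<otimes>\<^bsub>sheaf M V\<^esub> g \<oplus>\<^bsub>sheaf M V\<^esub> signed (sheaf M V) (a * b) (f \<otimes>\<^bsub>sheaf M V\<^esub> X V g)"
    and "\<And>V W f. opn V \<Longrightarrow> V \<subseteq> U \<Longrightarrow> opn W \<Longrightarrow> W \<subseteq> V \<Longrightarrow> f \<in> carrier (sheaf M V) \<Longrightarrow>
      restr M V W (X V f) = X W (restr M V W f)"
  shows "X \<in> homog (tangent M U) a"
  unfolding homog_tangent superderivations_def
  by (intro CollectI conjI allI impI ballI Pi_I; (elim conjE)?;
      (rule assms; (assumption | rule supercommutative_algebra.homog_closed[OF sheaf_algebra])+)?)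

lemma
  assumes "X \<in> homog (tangent M U) a"
  shows homog_vf_mk: "mk_vf M U X = X"
    and homog_vf_closed: "opn V \<Longrightarrow> V \<subseteq> U \<Longrightarrow> f \<in> carrier (sheaf M V) \<Longrightarrow> X V f \<in> carrier (sheaf M V)"
    and homog_vf_homog: "opn V \<Longrightarrow> V \<subseteq> U \<Longrightarrow> f \<in> homog (sheaf M V) b \<Longrightarrow> X V f \<in> homog (sheaf M V) (a + b)"
    and homog_vf_add: "opn V \<Longrightarrow> V \<subseteq> U \<Longrightarrow> f \<in> carrier (sheaf M V) \<Longrightarrow> g \<in> carrier (sheaf M V) \<Longrightarrow>
      X V (f \<oplus>\<^bsub>sheaf M V\<^esub> g) = X V f \<oplus>\<^bsub>sheaf M V\<^esub> X V g"
    and homog_vf_smult: "opn V \<Longrightarrow> V \<subseteq> U \<Longrightarrow> f \<in> carrier (sheaf M V) \<Longrightarrow>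
      X V (k \<odot>\<^bsub>sheaf M V\<^esub> f) = k \<odot>\<^bsub>sheaf M V\<^esub> X V f"
    and homog_vf_mult: "opn V \<Longrightarrow> V \<subseteq> U \<Longrightarrow> f \<in> homog (sheaf M V) b \<Longrightarrow> g \<in> carrier (sheaf M V) \<Longrightarrow>
      X V (f \<otimes>\<^bsub>sheaf M V\<^esub> g) =
        X V f \<otimes>\<^bsub>sheaf M V\<^esub> g \<oplus>\<^bsub>sheaf M V\<^esub> signed (sheaf M V) (a * b) (f \<otimes>\<^bsub>sheaf M V\<^esub> X V g)"
    and homog_vf_restr: "opn V \<Longrightarrow> V \<subseteq> U \<Longrightarrow> opn W \<Longrightarrow> W \<subseteq> V \<Longrightarrow> f \<in> carrier (sheaf M V) \<Longrightarrow>
      restr M V W (X V f) = X W (restr M V W f)"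
  using assms unfolding homog_tangent superderivations_def by (simp_all add: Pi_iff)

lemma zero_homog: "opn U \<Longrightarrow> \<zero>\<^bsub>tangent M U\<^esub> \<in> homog (tangent M U) a"
proof (rule homog_tangentI)
  fix V assume V: "opn V" "V \<subseteq> U"
  interpret A: supercommutative_algebra "sheaf M V" by (rule sheaf_algebra[OF V(1)])
  let ?X = "\<zero>\<^bsub>tangent M U\<^esub>"
  have [simp]: "?X V f = \<zero>\<^bsub>sheaf M V\<^esub>" if "f \<in> carrier (sheaf M V)" for f
    using that V by (simp add: tangent_sel)
  show "?X V f \<in> carrier (sheaf M V)" if "f \<in> carrier (sheaf M V)" for f using that by simp
  show "?X V f \<in> homog (sheaf M V) (a + b)" if "f \<in> homog (sheaf M V) b" for b f
    using that A.homog_closed by simp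
  show "?X V (f \<oplus>\<^bsub>sheaf M V\<^esub> g) = ?X V f \<oplus>\<^bsub>sheaf M V\<^esub> ?X V g"
    if "f \<in> carrier (sheaf M V)" "g \<in> carrier (sheaf M V)" for f g using that by simp
  show "?X V (k \<odot>\<^bsub>sheaf M V\<^esub> f) = k \<odot>\<^bsub>sheaf M V\<^esub> ?X V f" if "f \<in> carrier (sheaf M V)" for k f
  proof -
    have "k \<odot>\<^bsub>sheaf M V\<^esub> \<zero>\<^bsub>sheaf M V\<^esub> = \<zero>\<^bsub>sheaf M V\<^esub>"
      by (rule additive_zero[OF A.abelian_group_axioms A.abelian_group_axioms A.smult_closed A.smult_add_right])
    then show ?thesis using that A.smult_closed by simp
  qed
  show "?X V (f \<otimes>\<^bsub>sheaf M V\<^esub> g) =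
      ?X V f \<otimes>\<^bsub>sheaf M V\<^esub> g \<oplus>\<^bsub>sheaf M V\<^esub> signed (sheaf M V) (a * b) (f \<otimes>\<^bsub>sheaf M V\<^esub> ?X V g)"
    if "f \<in> carrier (sheaf M V)" "g \<in> carrier (sheaf M V)" for b f g using that by simp
  show "restr M V W (?X V f) = ?X W (restr M V W f)"
    if "opn W" "W \<subseteq> V" "f \<in> carrier (sheaf M V)" for W f
  proof -
    have "W \<subseteq> U" using that V by blast
    then show ?thesis using that restr_closed[OF V(1) that(1,2)] restr_zero[OF V(1) that(1,2)]
      by (simp add: tangent_sel V)
  qed
qed (simp add: tangent_sel)

lemma add_homog:
  assumes "opn U" and X: "X \<in> homog (tangent M U) a" and Y: "Y \<in> homog (tangent M U) a"
  shows "X \<oplus>\<^bsub>tangent M U\<^esub> Y \<in> homog (tangent M U) a"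
proof (rule homog_tangentI)
  fix V assume V: "opn V" "V \<subseteq> U"
  interpret A: supercommutative_algebra "sheaf M V" by (rule sheaf_algebra[OF V(1)])
  let ?X = "X \<oplus>\<^bsub>tangent M U\<^esub> Y"
  have [simp]: "?X V f = X V f \<oplus>\<^bsub>sheaf M V\<^esub> Y V f" if "f \<in> carrier (sheaf M V)" for f
    using that V by (simp add: tangent_sel)
  note [simp] = homog_vf_closed[OF X V] homog_vf_closed[OF Y V]
  show "?X V f \<in> carrier (sheaf M V)" if "f \<in> carrier (sheaf M V)" for f using that by simp
  show "?X V f \<in> homog (sheaf M V) (a + b)" if "f \<in> homog (sheaf M V) b" for b f
    using that homog_vf_homog[OF X V that] homog_vf_homog[OF Y V that]
    by (simp add: A.homog_add A.homog_closed)
  show "?X V (f \<oplus>\<^bsub>sheaf M V\<^esub> g) = ?X V f \<oplus>\<^bsub>sheaf M V\<^esub> ?X V g"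
    if "f \<in> carrier (sheaf M V)" "g \<in> carrier (sheaf M V)" for f g
    using that by (simp add: homog_vf_add[OF X V] homog_vf_add[OF Y V] A.a_ac)
  show "?X V (k \<odot>\<^bsub>sheaf M V\<^esub> f) = k \<odot>\<^bsub>sheaf M V\<^esub> ?X V f" if "f \<in> carrier (sheaf M V)" for k f
    using that by (simp add: homog_vf_smult[OF X V] homog_vf_smult[OF Y V] A.smult_closed A.smult_add_right)
  show "?X V (f \<otimes>\<^bsub>sheaf M V\<^esub> g) =
      ?X V f \<otimes>\<^bsub>sheaf M V\<^esub> g \<oplus>\<^bsub>sheaf M V\<^esub> signed (sheaf M V) (a * b) (f \<otimes>\<^bsub>sheaf M V\<^esub> ?X V g)"
    if "f \<in> homog (sheaf M V) b" "g \<in> carrier (sheaf M V)" "f \<in> carrier (sheaf M V)" for b f g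
    using that by (simp add: homog_vf_mult[OF X V that(1)] homog_vf_mult[OF Y V that(1)]
        A.l_distr A.r_distr A.signed_add A.a_ac)
  show "restr M V W (?X V f) = ?X W (restr M V W f)"
    if W: "opn W" "W \<subseteq> V" and "f \<in> carrier (sheaf M V)" for W f
  proof -
    have "W \<subseteq> U" using that V by blast
    then show ?thesis using that restr_closed[OF V(1) W] restr_add[OF V(1) W]
        homog_vf_restr[OF X V W] homog_vf_restr[OF Y V W]
      by (simp add: tangent_sel V)
  qed
qed (simp add: tangent_sel)

text \<open>The Leibniz sign \<open>(c + a) * b\<close> has two sources: \<open>a * b\<close> from
  moving \<open>X\<close> past \<open>f\<close>, and \<open>c * b\<close> from moving the function
  \<open>g\<close> past \<open>f\<close> by supercommutativity.\<close>

lemma smult_homog: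
  assumes U: "opn U" and g: "g \<in> homog (sheaf M U) c" and X: "X \<in> homog (tangent M U) a"
  shows "g \<odot>\<^bsub>tangent M U\<^esub> X \<in> homog (tangent M U) (c + a)"
proof (rule homog_tangentI)
  fix V assume V: "opn V" "V \<subseteq> U"
  interpret A: supercommutative_algebra "sheaf M V" by (rule sheaf_algebra[OF V(1)])
  let ?X = "g \<odot>\<^bsub>tangent M U\<^esub> X"
  let ?g = "restr M U V g"
  have [simp]: "?X V f = ?g \<otimes>\<^bsub>sheaf M V\<^esub> X V f" if "f \<in> carrier (sheaf M V)" for f
    using that V by (simp add: tangent_sel)
  have gh: "?g \<in> homog (sheaf M V) c" using restr_homog[OF U V] g by simp
  then have [simp]: "?g \<in> carrier (sheaf M V)" by auto
  note [simp] = homog_vf_closed[OF X V]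
  show "?X V f \<in> carrier (sheaf M V)" if "f \<in> carrier (sheaf M V)" for f using that by simp
  show "?X V f \<in> homog (sheaf M V) (c + a + b)" if "f \<in> homog (sheaf M V) b" for b f
    using A.homog_mult[OF gh homog_vf_homog[OF X V that]] that by (simp add: A.homog_closed add.assoc)
  show "?X V (h \<oplus>\<^bsub>sheaf M V\<^esub> k) = ?X V h \<oplus>\<^bsub>sheaf M V\<^esub> ?X V k"
    if "h \<in> carrier (sheaf M V)" "k \<in> carrier (sheaf M V)" for h k
    using that by (simp add: homog_vf_add[OF X V] A.r_distr)
  show "?X V (k \<odot>\<^bsub>sheaf M V\<^esub> f) = k \<odot>\<^bsub>sheaf M V\<^esub> ?X V f" if "f \<in> carrier (sheaf M V)" for k f
    using that by (simp add: homog_vf_smult[OF X V] A.smult_closed A.smult_mult_right)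
  show "?X V (f \<otimes>\<^bsub>sheaf M V\<^esub> h) =
      ?X V f \<otimes>\<^bsub>sheaf M V\<^esub> h \<oplus>\<^bsub>sheaf M V\<^esub> signed (sheaf M V) ((c + a) * b) (f \<otimes>\<^bsub>sheaf M V\<^esub> ?X V h)"
    if f: "f \<in> homog (sheaf M V) b" and h: "h \<in> carrier (sheaf M V)" and fc: "f \<in> carrier (sheaf M V)" for b f h
  proof -
    have "?g \<otimes>\<^bsub>sheaf M V\<^esub> (f \<otimes>\<^bsub>sheaf M V\<^esub> X V h) = (?g \<otimes>\<^bsub>sheaf M V\<^esub> f) \<otimes>\<^bsub>sheaf M V\<^esub> X V h"
      using h fc by (simp add: A.m_assoc)
    also have "\<dots> = signed (sheaf M V) (c * b) (f \<otimes>\<^bsub>sheaf M V\<^esub> (?g \<otimes>\<^bsub>sheaf M V\<^esub> X V h))"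
      using h fc by (simp add: A.supercommute[OF gh f] A.signed_l A.m_assoc)
    finally show ?thesis
      using h fc by (simp add: homog_vf_mult[OF X V f] A.r_distr A.signed_r A.m_assoc A.signed_signed
          ring_class.ring_distribs(2) add.commute)
  qed
  show "restr M V W (?X V f) = ?X W (restr M V W f)"
    if W: "opn W" "W \<subseteq> V" and "f \<in> carrier (sheaf M V)" for W f
  proof -
    have WU: "W \<subseteq> U" using that V by blast
    have "g \<in> carrier (sheaf M U)" using g supercommutative_algebra.homog_closed[OF sheaf_algebra[OF U]] by blast
    then show ?thesis using that WU restr_closed[OF V(1) W] restr_mult[OF V(1) W]
        homog_vf_restr[OF X V W] restr_restr[OF U V(1) W(1) W(2) V(2)]
      by (simp add: tangent_sel V)
  qed
qed (simp add: tangent_sel)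

lemma restrict_homog:
  assumes "opn U" "opn V" "V \<subseteq> U" and X: "X \<in> homog (tangent M U) a"
  shows "mk_vf M V X \<in> homog (tangent M V) a"
proof (rule homog_tangentI)
  fix W assume W: "opn W" "W \<subseteq> V"
  then have WU: "W \<subseteq> U" using assms by blast
  interpret A: supercommutative_algebra "sheaf M W" by (rule sheaf_algebra[OF W(1)])
  note [simp] = homog_vf_closed[OF X W(1) WU] W WU
  show "mk_vf M V X W f \<in> carrier (sheaf M W)" if "f \<in> carrier (sheaf M W)" for f using that by simp
  show "mk_vf M V X W f \<in> homog (sheaf M W) (a + b)" if "f \<in> homog (sheaf M W) b" for b f
    using that homog_vf_homog[OF X W(1) WU] A.homog_closed by simp
  show "mk_vf M V X W (f \<oplus>\<^bsub>sheaf M W\<^esub> g) = mk_vf M V X W f \<oplus>\<^bsub>sheaf M W\<^esub> mk_vf M V X W g"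
    if "f \<in> carrier (sheaf M W)" "g \<in> carrier (sheaf M W)" for f g
    using that homog_vf_add[OF X W(1) WU] by simp
  show "mk_vf M V X W (k \<odot>\<^bsub>sheaf M W\<^esub> f) = k \<odot>\<^bsub>sheaf M W\<^esub> mk_vf M V X W f"
    if "f \<in> carrier (sheaf M W)" for k f
    using that homog_vf_smult[OF X W(1) WU] A.smult_closed by simp
  show "mk_vf M V X W (f \<otimes>\<^bsub>sheaf M W\<^esub> g) = mk_vf M V X W f \<otimes>\<^bsub>sheaf M W\<^esub> g
      \<oplus>\<^bsub>sheaf M W\<^esub> signed (sheaf M W) (a * b) (f \<otimes>\<^bsub>sheaf M W\<^esub> mk_vf M V X W g)"
    if "f \<in> homog (sheaf M W) b" "g \<in> carrier (sheaf M W)" "f \<in> carrier (sheaf M W)" for b f g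
    using that homog_vf_mult[OF X W(1) WU] by simp
  show "restr M W N (mk_vf M V X W f) = mk_vf M V X N (restr M W N f)"
    if N: "opn N" "N \<subseteq> W" and "f \<in> carrier (sheaf M W)" for N f
  proof -
    have "N \<subseteq> V" using that W by blast
    then show ?thesis using that homog_vf_restr[OF X W(1) WU N] restr_closed[OF W(1) N] by simp
  qed
qed simp

text \<open>The second-order parts are no derivations by themselves. In the Leibniz rule the mixed
  terms, where \<open>X\<close> and \<open>Y\<close> differentiate different factors, occur in both
  iterated derivatives and cancel by \<open>leibniz_signs\<close>.\<close>

lemma bracket_homog:
  assumes "opn U" and X: "X \<in> homog (tangent M U) a" and Y: "Y \<in> homog (tangent M U) b"
  shows "lie_bracket M U a b X Y \<in> homog (tangent M U) (a + b)"
proof (rule homog_tangentI)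
  fix V assume V: "opn V" "V \<subseteq> U"
  interpret A: supercommutative_algebra "sheaf M V" by (rule sheaf_algebra[OF V(1)])
  let ?X = "lie_bracket M U a b X Y"
  have [simp]: "?X V f = X V (Y V f) \<ominus>\<^bsub>sheaf M V\<^esub> signed (sheaf M V) (a * b) (Y V (X V f))"
    if "f \<in> carrier (sheaf M V)" for f
    using that V by (simp add: lie_bracket_def)
  note [simp] = homog_vf_closed[OF X V] homog_vf_closed[OF Y V]
  show "?X V f \<in> carrier (sheaf M V)" if "f \<in> carrier (sheaf M V)" for f using that by simp
  show "?X V f \<in> homog (sheaf M V) (a + b + c)" if f: "f \<in> homog (sheaf M V) c" for c f
    using homog_vf_homog[OF X V homog_vf_homog[OF Y V f]] homog_vf_homog[OF Y V homog_vf_homog[OF X V f]]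
    by (simp add: A.homog_add A.homog_minus A.homog_signed A.homog_closed[OF f] A.minus_eq ac_simps)
  note add = homog_vf_add[OF X V] homog_vf_add[OF Y V]
  have signed: "X V (signed (sheaf M V) s f) = signed (sheaf M V) s (X V f)"
    "Y V (signed (sheaf M V) s f) = signed (sheaf M V) s (Y V f)" if "f \<in> carrier (sheaf M V)" for s f
    using that additive_signed[OF A.abelian_group_axioms A.abelian_group_axioms] add by simp_all
  show "?X V (f \<oplus>\<^bsub>sheaf M V\<^esub> g) = ?X V f \<oplus>\<^bsub>sheaf M V\<^esub> ?X V g"
    if "f \<in> carrier (sheaf M V)" "g \<in> carrier (sheaf M V)" for f g
    using that by (simp add: add A.signed_add A.minus_eq A.minus_add A.a_ac)
  show "?X V (k \<odot>\<^bsub>sheaf M V\<^esub> f) = k \<odot>\<^bsub>sheaf M V\<^esub> ?X V f" if "f \<in> carrier (sheaf M V)" for k f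
  proof -
    have "k \<odot>\<^bsub>sheaf M V\<^esub> signed (sheaf M V) s g = signed (sheaf M V) s (k \<odot>\<^bsub>sheaf M V\<^esub> g)"
      "k \<odot>\<^bsub>sheaf M V\<^esub> (h \<ominus>\<^bsub>sheaf M V\<^esub> g) = k \<odot>\<^bsub>sheaf M V\<^esub> h \<ominus>\<^bsub>sheaf M V\<^esub> k \<odot>\<^bsub>sheaf M V\<^esub> g"
      if "g \<in> carrier (sheaf M V)" "h \<in> carrier (sheaf M V)" for s g h
      using that additive_signed[where h = "smult (sheaf M V) k", OF A.abelian_group_axioms A.abelian_group_axioms]
        additive_diff[where h = "smult (sheaf M V) k", OF A.abelian_group_axioms A.abelian_group_axioms]
      by (simp_all add: A.smult_closed A.smult_add_right)
    then show ?thesis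
      using that by (simp add: homog_vf_smult[OF X V] homog_vf_smult[OF Y V] A.smult_closed)
  qed
  show "?X V (f \<otimes>\<^bsub>sheaf M V\<^esub> g) =
      ?X V f \<otimes>\<^bsub>sheaf M V\<^esub> g \<oplus>\<^bsub>sheaf M V\<^esub> signed (sheaf M V) ((a + b) * c) (f \<otimes>\<^bsub>sheaf M V\<^esub> ?X V g)"
    if f: "f \<in> homog (sheaf M V) c" and [simp]: "g \<in> carrier (sheaf M V)" "f \<in> carrier (sheaf M V)" for c f g
  proof -
    define p1 p2 q1 q2 r t where "p1 = X V (Y V f) \<otimes>\<^bsub>sheaf M V\<^esub> g" "p2 = Y V (X V f) \<otimes>\<^bsub>sheaf M V\<^esub> g"
      "q1 = f \<otimes>\<^bsub>sheaf M V\<^esub> X V (Y V g)" "q2 = f \<otimes>\<^bsub>sheaf M V\<^esub> Y V (X V g)"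
      "r = Y V f \<otimes>\<^bsub>sheaf M V\<^esub> X V g" "t = X V f \<otimes>\<^bsub>sheaf M V\<^esub> Y V g"
    note defs = this
    have [simp]: "p1 \<in> carrier (sheaf M V)" "p2 \<in> carrier (sheaf M V)" "q1 \<in> carrier (sheaf M V)"
      "q2 \<in> carrier (sheaf M V)" "r \<in> carrier (sheaf M V)" "t \<in> carrier (sheaf M V)"
      by (simp_all add: defs)
    have XY: "X V (Y V (f \<otimes>\<^bsub>sheaf M V\<^esub> g)) = (p1 \<oplus>\<^bsub>sheaf M V\<^esub> signed (sheaf M V) (a * (b + c)) r)
        \<oplus>\<^bsub>sheaf M V\<^esub> signed (sheaf M V) (b * c) (t \<oplus>\<^bsub>sheaf M V\<^esub> signed (sheaf M V) (a * c) q1)"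
      by (simp add: homog_vf_mult[OF Y V f] homog_vf_mult[OF X V f]
          homog_vf_mult[OF X V homog_vf_homog[OF Y V f]] add signed defs)
    have YX: "Y V (X V (f \<otimes>\<^bsub>sheaf M V\<^esub> g)) = (p2 \<oplus>\<^bsub>sheaf M V\<^esub> signed (sheaf M V) (b * (a + c)) t)
        \<oplus>\<^bsub>sheaf M V\<^esub> signed (sheaf M V) (a * c) (r \<oplus>\<^bsub>sheaf M V\<^esub> signed (sheaf M V) (b * c) q2)"
      by (simp add: homog_vf_mult[OF Y V f] homog_vf_mult[OF X V f]
          homog_vf_mult[OF Y V homog_vf_homog[OF X V f]] add signed defs)
    have R1: "?X V f \<otimes>\<^bsub>sheaf M V\<^esub> g = p1 \<ominus>\<^bsub>sheaf M V\<^esub> signed (sheaf M V) (a * b) p2"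
      by (simp add: A.minus_eq A.l_distr A.l_minus A.signed_l defs)
    have R2: "f \<otimes>\<^bsub>sheaf M V\<^esub> ?X V g = q1 \<ominus>\<^bsub>sheaf M V\<^esub> signed (sheaf M V) (a * b) q2"
      by (simp add: A.minus_eq A.r_distr A.r_minus A.signed_r defs)
    have "?X V (f \<otimes>\<^bsub>sheaf M V\<^esub> g) = X V (Y V (f \<otimes>\<^bsub>sheaf M V\<^esub> g))
        \<ominus>\<^bsub>sheaf M V\<^esub> signed (sheaf M V) (a * b) (Y V (X V (f \<otimes>\<^bsub>sheaf M V\<^esub> g)))"
      by simp
    then show ?thesis
      unfolding R1 R2 XY YX by (simp only:) (rule A.leibniz_signs; simp)
  qed
  show "restr M V W (?X V f) = ?X W (restr M V W f)"
    if W: "opn W" "W \<subseteq> V" and "f \<in> carrier (sheaf M V)" for W f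
  proof -
    have "W \<subseteq> U" using that V by blast
    then show ?thesis using that restr_closed[OF V(1) W] restr_add[OF V(1) W] restr_minus[OF V(1) W]
        restr_signed[OF V(1) W] homog_vf_restr[OF X V W] homog_vf_restr[OF Y V W]
      by (simp add: lie_bracket_def V A.minus_eq a_minus_def)
  qed
qed (simp add: lie_bracket_def)

end

lemma (in abelian_group) diff_zero_imp_eq:
  assumes "x \<in> carrier G" "y \<in> carrier G" "x \<ominus> y = \<zero>"
  shows "x = y"
  using minus_equality[of x "\<ominus> y"] assms by (simp add: minus_eq)

section \<open>The module of all vector fields and its parity decomposition\<close>

context superringed_space
begin

lemma
  assumes "opn V" "V \<subseteq> U" "f \<in> carrier (sheaf M V)"
  shows tangent_zero_apply: "\<zero>\<^bsub>tangent M U\<^esub> V f = \<zero>\<^bsub>sheaf M V\<^esub>"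
    and tangent_add_apply: "(X \<oplus>\<^bsub>tangent M U\<^esub> Y) V f = X V f \<oplus>\<^bsub>sheaf M V\<^esub> Y V f"
    and tangent_smult_apply: "(g \<odot>\<^bsub>tangent M U\<^esub> X) V f = restr M U V g \<otimes>\<^bsub>sheaf M V\<^esub> X V f"
  using assms by (simp_all add: tangent_sel)

lemma homog_tangent_zero_right:
  assumes "opn U" "X \<in> homog (tangent M U) a"
  shows "X \<oplus>\<^bsub>tangent M U\<^esub> \<zero>\<^bsub>tangent M U\<^esub> = X" "\<zero>\<^bsub>tangent M U\<^esub> \<oplus>\<^bsub>tangent M U\<^esub> X = X"
proof -
  have "mk_vf M U (\<lambda>V f. X V f \<oplus>\<^bsub>sheaf M V\<^esub> \<zero>\<^bsub>tangent M U\<^esub> V f) = mk_vf M U X"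
    "mk_vf M U (\<lambda>V f. \<zero>\<^bsub>tangent M U\<^esub> V f \<oplus>\<^bsub>sheaf M V\<^esub> X V f) = mk_vf M U X"
    using abelian_monoid.r_zero[OF abelian_group.axioms(1)[OF sheaf_group]]
      abelian_monoid.l_zero[OF abelian_group.axioms(1)[OF sheaf_group]]
    by (auto intro!: mk_vf_eqI simp: tangent_zero_apply homog_vf_closed[OF assms(2)])
  then show "X \<oplus>\<^bsub>tangent M U\<^esub> \<zero>\<^bsub>tangent M U\<^esub> = X" "\<zero>\<^bsub>tangent M U\<^esub> \<oplus>\<^bsub>tangent M U\<^esub> X = X"
    using homog_vf_mk[OF assms(2)] by (simp_all add: tangent_sel(2))
qed

text \<open>The carrier consists of sums of an even and an odd field, so a homogeneous field is
  completed by the zero field, which is homogeneous of either parity.\<close>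

lemma homog_tangent_closed: "opn U \<Longrightarrow> X \<in> homog (tangent M U) a \<Longrightarrow> X \<in> carrier (tangent M U)"
  using homog_tangent_zero_right[of U X a, symmetric] zero_homog[of U] unfolding carrier_tangent
  by (cases "a = 0") (blast, force)

text \<open>These are the laws that survive for inhomogeneous fields; the Leibniz rule does not, as
  its sign depends on the parity of the field.\<close>

lemma
  assumes X: "X \<in> carrier (tangent M U)"
  shows vf_mk: "mk_vf M U X = X"
    and vf_closed: "opn V \<Longrightarrow> V \<subseteq> U \<Longrightarrow> f \<in> carrier (sheaf M V) \<Longrightarrow> X V f \<in> carrier (sheaf M V)"
    and vf_restr: "opn V \<Longrightarrow> V \<subseteq> U \<Longrightarrow> opn W \<Longrightarrow> W \<subseteq> V \<Longrightarrow> f \<in> carrier (sheaf M V) \<Longrightarrow>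
      restr M V W (X V f) = X W (restr M V W f)"
proof -
  obtain Y Z where YZ: "X = Y \<oplus>\<^bsub>tangent M U\<^esub> Z" "Y \<in> homog (tangent M U) 0" "Z \<in> homog (tangent M U) 1"
    using X by (auto simp: carrier_tangent)
  show "mk_vf M U X = X" by (simp add: YZ tangent_sel)
  show cl: "X V f \<in> carrier (sheaf M V)" if "opn V" "V \<subseteq> U" "f \<in> carrier (sheaf M V)" for V f
    using that homog_vf_closed[OF YZ(2)] homog_vf_closed[OF YZ(3)]
      abelian_monoid.a_closed[OF abelian_group.axioms(1)[OF sheaf_group[OF that(1)]]]
    by (simp add: YZ(1) tangent_add_apply)
  show "restr M V W (X V f) = X W (restr M V W f)"
    if V: "opn V" "V \<subseteq> U" and W: "opn W" "W \<subseteq> V" and f: "f \<in> carrier (sheaf M V)"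
  proof -
    have WU: "W \<subseteq> U" using V W by blast
    show ?thesis
      using V W WU f restr_closed[OF V(1) W] homog_vf_closed[OF YZ(2) V] homog_vf_closed[OF YZ(3) V]
      by (simp add: YZ(1) tangent_add_apply restr_add[OF V(1) W] homog_vf_restr[OF YZ(2) V W]
          homog_vf_restr[OF YZ(3) V W])
  qed
qed

lemma tangent_eqI:
  assumes "X \<in> carrier (tangent M U)" "Y \<in> carrier (tangent M U)"
    and "\<And>V f. opn V \<Longrightarrow> V \<subseteq> U \<Longrightarrow> f \<in> carrier (sheaf M V) \<Longrightarrow> X V f = Y V f"
  shows "X = Y"
  using mk_vf_eqI[of M U X Y] assms vf_mk by metis

lemma tangent_homogE:
  assumes "X \<in> carrier (tangent M U)"
  obtains Y Z where "X = Y \<oplus>\<^bsub>tangent M U\<^esub> Z" "Y \<in> homog (tangent M U) 0" "Z \<in> homog (tangent M U) 1"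
  using assms by (auto simp: carrier_tangent)

text \<open>Sorts the sum of two parity decompositions by parity. It is proved pointwise because the
  group laws of the module rely on it.\<close>

lemma add_interchange:
  assumes "opn U" and c: "Y \<in> homog (tangent M U) a" "Z \<in> homog (tangent M U) b"
    "Y' \<in> homog (tangent M U) a'" "Z' \<in> homog (tangent M U) b'"
  shows "(Y \<oplus>\<^bsub>tangent M U\<^esub> Z) \<oplus>\<^bsub>tangent M U\<^esub> (Y' \<oplus>\<^bsub>tangent M U\<^esub> Z')
    = (Y \<oplus>\<^bsub>tangent M U\<^esub> Y') \<oplus>\<^bsub>tangent M U\<^esub> (Z \<oplus>\<^bsub>tangent M U\<^esub> Z')"
proof -
  have "mk_vf M U (\<lambda>V f. (Y \<oplus>\<^bsub>tangent M U\<^esub> Z) V f \<oplus>\<^bsub>sheaf M V\<^esub> (Y' \<oplus>\<^bsub>tangent M U\<^esub> Z') V f)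
    = mk_vf M U (\<lambda>V f. (Y \<oplus>\<^bsub>tangent M U\<^esub> Y') V f \<oplus>\<^bsub>sheaf M V\<^esub> (Z \<oplus>\<^bsub>tangent M U\<^esub> Z') V f)"
  proof (rule mk_vf_eqI)
    fix V f assume V: "opn V" "V \<subseteq> U" "f \<in> carrier (sheaf M V)"
    interpret A: abelian_group "sheaf M V" using sheaf_group V by simp
    note [simp] = c[THEN homog_vf_closed, OF V]
    show "(Y \<oplus>\<^bsub>tangent M U\<^esub> Z) V f \<oplus>\<^bsub>sheaf M V\<^esub> (Y' \<oplus>\<^bsub>tangent M U\<^esub> Z') V f
      = (Y \<oplus>\<^bsub>tangent M U\<^esub> Y') V f \<oplus>\<^bsub>sheaf M V\<^esub> (Z \<oplus>\<^bsub>tangent M U\<^esub> Z') V f"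
      using V by (simp add: tangent_add_apply A.a_ac)
  qed
  then show ?thesis by (simp only: tangent_sel(2)[of M U "_ \<oplus>\<^bsub>tangent M U\<^esub> _"])
qed

lemma tangent_add_closed:
  assumes U: "opn U" and "X \<in> carrier (tangent M U)" "Y \<in> carrier (tangent M U)"
  shows "X \<oplus>\<^bsub>tangent M U\<^esub> Y \<in> carrier (tangent M U)"
  using assms(2,3)
  by (elim tangent_homogE) (auto simp: add_interchange[OF U] carrier_tangent intro: add_homog[OF U])

text \<open>Supplies additive inverses before the group is available. The scalar \<open>-1\<close>
  preserves parity because the unit of the algebra is even.\<close>

lemma minus_one_smult:
  assumes U: "opn U" and X: "X \<in> homog (tangent M U) a"
  shows "\<ominus>\<^bsub>sheaf M U\<^esub> \<one>\<^bsub>sheaf M U\<^esub> \<odot>\<^bsub>tangent M U\<^esub> X \<in> homog (tangent M U) a"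
    and "(\<ominus>\<^bsub>sheaf M U\<^esub> \<one>\<^bsub>sheaf M U\<^esub> \<odot>\<^bsub>tangent M U\<^esub> X) \<oplus>\<^bsub>tangent M U\<^esub> X = \<zero>\<^bsub>tangent M U\<^esub>"
proof -
  interpret A: supercommutative_algebra "sheaf M U" by (rule sheaf_algebra[OF U])
  show h: "\<ominus>\<^bsub>sheaf M U\<^esub> \<one>\<^bsub>sheaf M U\<^esub> \<odot>\<^bsub>tangent M U\<^esub> X \<in> homog (tangent M U) a"
    using smult_homog[OF U A.homog_minus[OF A.one_homog] X] by simp
  show "(\<ominus>\<^bsub>sheaf M U\<^esub> \<one>\<^bsub>sheaf M U\<^esub> \<odot>\<^bsub>tangent M U\<^esub> X) \<oplus>\<^bsub>tangent M U\<^esub> X = \<zero>\<^bsub>tangent M U\<^esub>"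
  proof (rule tangent_eqI)
    fix V f assume V: "opn V" "V \<subseteq> U" "f \<in> carrier (sheaf M V)"
    interpret B: ring "sheaf M V" using sheaf_ring V by simp
    note [simp] = X[THEN homog_vf_closed, OF V]
    show "((\<ominus>\<^bsub>sheaf M U\<^esub> \<one>\<^bsub>sheaf M U\<^esub> \<odot>\<^bsub>tangent M U\<^esub> X) \<oplus>\<^bsub>tangent M U\<^esub> X) V f = \<zero>\<^bsub>tangent M U\<^esub> V f"
      using V by (simp add: tangent_add_apply tangent_smult_apply tangent_zero_apply restr_minus[OF U]
        restr_one[OF U] B.l_minus B.l_neg)
  qed (use U X h in \<open>auto intro: homog_tangent_closed zero_homog tangent_add_closed\<close>)
qed

lemma tangent_group:
  assumes U: "opn U" shows "abelian_group (tangent M U)"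
proof (rule abelian_groupI)
  show "X \<oplus>\<^bsub>tangent M U\<^esub> Y \<in> carrier (tangent M U)"
    if "X \<in> carrier (tangent M U)" "Y \<in> carrier (tangent M U)" for X Y
    using tangent_add_closed U that .
  note closed = this
  show zero: "\<zero>\<^bsub>tangent M U\<^esub> \<in> carrier (tangent M U)"
    by (rule homog_tangent_closed[OF U zero_homog[OF U]])
  show "(X \<oplus>\<^bsub>tangent M U\<^esub> Y) \<oplus>\<^bsub>tangent M U\<^esub> Z = X \<oplus>\<^bsub>tangent M U\<^esub> (Y \<oplus>\<^bsub>tangent M U\<^esub> Z)"
    if "X \<in> carrier (tangent M U)" "Y \<in> carrier (tangent M U)" "Z \<in> carrier (tangent M U)" for X Y Z
    by (rule tangent_eqI[of _ U]) (use that closed in \<open>simp_all add: tangent_add_apply vf_closed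
        abelian_monoid.a_assoc[OF abelian_group.axioms(1)[OF sheaf_group]]\<close>)
  show "X \<oplus>\<^bsub>tangent M U\<^esub> Y = Y \<oplus>\<^bsub>tangent M U\<^esub> X"
    if "X \<in> carrier (tangent M U)" "Y \<in> carrier (tangent M U)" for X Y
    by (rule tangent_eqI[of _ U]) (use that closed in \<open>simp_all add: tangent_add_apply vf_closed
        abelian_monoid.a_comm[OF abelian_group.axioms(1)[OF sheaf_group]]\<close>)
  show "\<zero>\<^bsub>tangent M U\<^esub> \<oplus>\<^bsub>tangent M U\<^esub> X = X" if "X \<in> carrier (tangent M U)" for X
    by (rule tangent_eqI[of _ U]) (use that closed zero in \<open>simp_all add: tangent_add_apply vf_closed
        tangent_zero_apply abelian_monoid.l_zero[OF abelian_group.axioms(1)[OF sheaf_group]]\<close>)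
  show "\<exists>Y\<in>carrier (tangent M U). Y \<oplus>\<^bsub>tangent M U\<^esub> X = \<zero>\<^bsub>tangent M U\<^esub>" if X: "X \<in> carrier (tangent M U)" for X
  proof -
    obtain Y Z where YZ: "X = Y \<oplus>\<^bsub>tangent M U\<^esub> Z" "Y \<in> homog (tangent M U) 0" "Z \<in> homog (tangent M U) 1"
      using tangent_homogE[OF X] .
    let ?m = "\<lambda>X. \<ominus>\<^bsub>sheaf M U\<^esub> \<one>\<^bsub>sheaf M U\<^esub> \<odot>\<^bsub>tangent M U\<^esub> X"
    note h = minus_one_smult[OF U YZ(2)] minus_one_smult[OF U YZ(3)]
    have "(?m Y \<oplus>\<^bsub>tangent M U\<^esub> ?m Z) \<oplus>\<^bsub>tangent M U\<^esub> (Y \<oplus>\<^bsub>tangent M U\<^esub> Z) = \<zero>\<^bsub>tangent M U\<^esub>"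
      using add_interchange[OF U h(1) h(3) YZ(2,3)] h(2,4) homog_tangent_zero_right[OF U zero_homog[OF U]]
      by simp
    then show ?thesis using YZ(1) closed h(1,3) homog_tangent_closed[OF U] by metis
  qed
qed

lemma restrict_add:
  assumes "opn V" "V \<subseteq> U"
  shows "mk_vf M V (X \<oplus>\<^bsub>tangent M U\<^esub> Y) = mk_vf M V X \<oplus>\<^bsub>tangent M V\<^esub> mk_vf M V Y"
  unfolding tangent_sel mk_vf_mk_vf[OF assms(2)] by (rule mk_vf_eqI) (use assms in auto)

lemma restrict_closed:
  assumes "opn U" "opn V" "V \<subseteq> U" "X \<in> carrier (tangent M U)"
  shows "mk_vf M V X \<in> carrier (tangent M V)"
  using assms(4)
  by (elim tangent_homogE)
    (simp add: restrict_add assms tangent_add_closed homog_tangent_closed[OF _ restrict_homog[OF assms(1-3)]])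

lemma restrict_zero:
  assumes "opn U" "opn V" "V \<subseteq> U"
  shows "mk_vf M V \<zero>\<^bsub>tangent M U\<^esub> = \<zero>\<^bsub>tangent M V\<^esub>"
  using additive_zero[where h = "mk_vf M V", OF tangent_group[OF assms(1)] tangent_group[OF assms(2)]]
  by (simp add: restrict_closed[OF assms] restrict_add[OF assms(2,3)])

lemma restrict_smult:
  assumes "opn U" "opn V" "V \<subseteq> U" "g \<in> carrier (sheaf M U)"
  shows "mk_vf M V (g \<odot>\<^bsub>tangent M U\<^esub> X) = restr M U V g \<odot>\<^bsub>tangent M V\<^esub> mk_vf M V X"
  unfolding tangent_sel mk_vf_mk_vf[OF assms(3)]
  by (rule mk_vf_eqI) (use assms in \<open>auto simp: restr_restr[OF assms(1,2) _ _ assms(3,4)]\<close>)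

lemma tangent_smult_add:
  assumes U: "opn U" and "g \<in> carrier (sheaf M U)" and X: "X \<in> carrier (tangent M U)" "Y \<in> carrier (tangent M U)"
  shows "g \<odot>\<^bsub>tangent M U\<^esub> (X \<oplus>\<^bsub>tangent M U\<^esub> Y) = g \<odot>\<^bsub>tangent M U\<^esub> X \<oplus>\<^bsub>tangent M U\<^esub> g \<odot>\<^bsub>tangent M U\<^esub> Y"
  unfolding tangent_sel
proof (rule mk_vf_eqI)
  fix V f assume V: "opn V" "V \<subseteq> U" and f: "f \<in> carrier (sheaf M V)"
  interpret B: ring "sheaf M V" using sheaf_ring V by simp
  show "restr M U V g \<otimes>\<^bsub>sheaf M V\<^esub> mk_vf M U (\<lambda>V f. X V f \<oplus>\<^bsub>sheaf M V\<^esub> Y V f) V f =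
    mk_vf M U (\<lambda>V f. restr M U V g \<otimes>\<^bsub>sheaf M V\<^esub> X V f) V f \<oplus>\<^bsub>sheaf M V\<^esub>
    mk_vf M U (\<lambda>V f. restr M U V g \<otimes>\<^bsub>sheaf M V\<^esub> Y V f) V f"
    using assms V f by (simp add: restr_closed vf_closed B.r_distr)
qed

lemma tangent_add_smult:
  assumes U: "opn U" and "g \<in> carrier (sheaf M U)" "h \<in> carrier (sheaf M U)" "X \<in> carrier (tangent M U)"
  shows "(g \<oplus>\<^bsub>sheaf M U\<^esub> h) \<odot>\<^bsub>tangent M U\<^esub> X = g \<odot>\<^bsub>tangent M U\<^esub> X \<oplus>\<^bsub>tangent M U\<^esub> h \<odot>\<^bsub>tangent M U\<^esub> X"
  unfolding tangent_sel
proof (rule mk_vf_eqI)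
  fix V f assume V: "opn V" "V \<subseteq> U" and f: "f \<in> carrier (sheaf M V)"
  interpret B: ring "sheaf M V" using sheaf_ring V by simp
  show "restr M U V (g \<oplus>\<^bsub>sheaf M U\<^esub> h) \<otimes>\<^bsub>sheaf M V\<^esub> X V f =
    mk_vf M U (\<lambda>V f. restr M U V g \<otimes>\<^bsub>sheaf M V\<^esub> X V f) V f \<oplus>\<^bsub>sheaf M V\<^esub>
    mk_vf M U (\<lambda>V f. restr M U V h \<otimes>\<^bsub>sheaf M V\<^esub> X V f) V f"
    using assms V f by (simp add: restr_closed restr_add vf_closed B.l_distr)
qed

lemma tangent_smult_smult:
  assumes U: "opn U" and "g \<in> carrier (sheaf M U)" "h \<in> carrier (sheaf M U)" "X \<in> carrier (tangent M U)"
  shows "(g \<otimes>\<^bsub>sheaf M U\<^esub> h) \<odot>\<^bsub>tangent M U\<^esub> X = g \<odot>\<^bsub>tangent M U\<^esub> (h \<odot>\<^bsub>tangent M U\<^esub> X)"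
  unfolding tangent_sel
proof (rule mk_vf_eqI)
  fix V f assume V: "opn V" "V \<subseteq> U" and f: "f \<in> carrier (sheaf M V)"
  interpret B: ring "sheaf M V" using sheaf_ring V by simp
  show "restr M U V (g \<otimes>\<^bsub>sheaf M U\<^esub> h) \<otimes>\<^bsub>sheaf M V\<^esub> X V f =
    restr M U V g \<otimes>\<^bsub>sheaf M V\<^esub> mk_vf M U (\<lambda>V f. restr M U V h \<otimes>\<^bsub>sheaf M V\<^esub> X V f) V f"
    using assms V f by (simp add: restr_closed restr_mult vf_closed B.m_assoc)
qed

lemma tangent_one_smult:
  assumes U: "opn U" and X: "X \<in> carrier (tangent M U)"
  shows "\<one>\<^bsub>sheaf M U\<^esub> \<odot>\<^bsub>tangent M U\<^esub> X = X"
proof -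
  have "mk_vf M U (\<lambda>V f. restr M U V \<one>\<^bsub>sheaf M U\<^esub> \<otimes>\<^bsub>sheaf M V\<^esub> X V f) = mk_vf M U X"
    by (rule mk_vf_eqI) (simp add: restr_one U vf_closed[OF X] monoid.l_one[OF ring.is_monoid[OF sheaf_ring]])
  then show ?thesis by (simp add: tangent_sel vf_mk X)
qed

text \<open>Parity is controlled only for products of homogeneous factors, so the function and the
  field are both split and the four products are treated separately.\<close>

lemma tangent_smult_closed:
  assumes U: "opn U" and g: "g \<in> carrier (sheaf M U)" and X: "X \<in> carrier (tangent M U)"
  shows "g \<odot>\<^bsub>tangent M U\<^esub> X \<in> carrier (tangent M U)"
proof -
  interpret A: supercommutative_algebra "sheaf M U" by (rule sheaf_algebra[OF U])
  obtain h k where hk: "h \<in> homog (sheaf M U) 0" "k \<in> homog (sheaf M U) 1" "g = h \<oplus>\<^bsub>sheaf M U\<^esub> k"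
    using A.homog_sum[OF g] by blast
  obtain Y Z where YZ: "X = Y \<oplus>\<^bsub>tangent M U\<^esub> Z" "Y \<in> homog (tangent M U) 0" "Z \<in> homog (tangent M U) 1"
    using tangent_homogE[OF X] .
  note c = homog_tangent_closed[OF U]
  show ?thesis using hk(1,2) YZ(2,3) X
    by (simp add: hk(3) YZ(1) tangent_add_smult[OF U] A.homog_closed tangent_smult_add[OF U] c
        tangent_add_closed[OF U] c[OF smult_homog[OF U]])
qed

text \<open>Signs in the symmetric algebra are multiplications by the functions \<open>1\<close> and
  \<open>-1\<close>; this identifies them with the signs of the module.\<close>

lemma signed_one_smult:
  assumes U: "opn U" and X: "X \<in> carrier (tangent M U)"
  shows "signed (sheaf M U) s \<one>\<^bsub>sheaf M U\<^esub> \<odot>\<^bsub>tangent M U\<^esub> X = signed (tangent M U) s X"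
proof -
  interpret A: ring "sheaf M U" by (rule sheaf_ring[OF U])
  show ?thesis
    using additive_signed[where h = "\<lambda>g. g \<odot>\<^bsub>tangent M U\<^esub> X", OF sheaf_group[OF U] tangent_group[OF U]]
    by (simp add: tangent_smult_closed U X tangent_add_smult tangent_one_smult)
qed

lemma signed_homog:
  assumes "opn U" "X \<in> homog (tangent M U) a"
  shows "signed (tangent M U) s X \<in> homog (tangent M U) a"
proof -
  interpret A: supercommutative_algebra "sheaf M U" by (rule sheaf_algebra[OF assms(1)])
  show ?thesis
    using smult_homog[OF assms(1) A.homog_signed[OF A.one_homog] assms(2)]
    by (simp add: signed_one_smult assms homog_tangent_closed[OF assms])
qed

lemma minus_homog: "opn U \<Longrightarrow> X \<in> homog (tangent M U) a \<Longrightarrow> \<ominus>\<^bsub>tangent M U\<^esub> X \<in> homog (tangent M U) a"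
  using signed_homog[of U X a 1] by (simp add: signed_def)

text \<open>Applied to a homogeneous function, \<open>X\<close> yields a function of both parities,
  which is zero; every function is a sum of two homogeneous ones.\<close>

lemma homog_both_zero:
  assumes U: "opn U" and X: "X \<in> homog (tangent M U) a" "X \<in> homog (tangent M U) (a + 1)"
  shows "X = \<zero>\<^bsub>tangent M U\<^esub>"
proof (rule tangent_eqI)
  fix V f assume V: "opn V" "V \<subseteq> U" and f: "f \<in> carrier (sheaf M V)"
  interpret A: supercommutative_algebra "sheaf M V" by (rule sheaf_algebra[OF V(1)])
  have z: "X V g = \<zero>\<^bsub>sheaf M V\<^esub>" if "g \<in> homog (sheaf M V) b" for g b
    using homog_vf_homog[OF X(1) V that] homog_vf_homog[OF X(2) V that]
      A.homog_both[of "X V g" "a + b"] by (simp add: ac_simps)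
  obtain g h where gh: "g \<in> homog (sheaf M V) 0" "h \<in> homog (sheaf M V) 1" "f = g \<oplus>\<^bsub>sheaf M V\<^esub> h"
    using A.homog_sum[OF f] by blast
  then have "X V f = \<zero>\<^bsub>sheaf M V\<^esub>"
    by (simp add: homog_vf_add[OF X(1) V] A.homog_closed z)
  then show "X V f = \<zero>\<^bsub>tangent M U\<^esub> V f" using V f by (simp add: tangent_zero_apply)
qed (use homog_tangent_closed[OF U] zero_homog[OF U] X in auto)

text \<open>The equation makes \<open>X\<close> the negative of \<open>Y\<close>, hence of both
  parities. The point of the lemma is that the parity parts of an element of the kernel again lie in
  the kernel.\<close>

lemma homog_sum_zero:
  assumes U: "opn U" and X: "X \<in> homog (tangent M U) a" and Y: "Y \<in> homog (tangent M U) (a + 1)"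
    and z: "X \<oplus>\<^bsub>tangent M U\<^esub> Y = \<zero>\<^bsub>tangent M U\<^esub>"
  shows "X = \<zero>\<^bsub>tangent M U\<^esub>" "Y = \<zero>\<^bsub>tangent M U\<^esub>"
proof -
  interpret T: abelian_group "tangent M U" by (rule tangent_group[OF U])
  have c: "X \<in> carrier (tangent M U)" "Y \<in> carrier (tangent M U)" using homog_tangent_closed[OF U] X Y by auto
  have "X = \<ominus>\<^bsub>tangent M U\<^esub> Y" using T.minus_equality[OF z] c by simp
  then have "X \<in> homog (tangent M U) (a + 1)" using minus_homog[OF U Y] by simp
  then show "X = \<zero>\<^bsub>tangent M U\<^esub>" using homog_both_zero[OF U X] by simp
  then show "Y = \<zero>\<^bsub>tangent M U\<^esub>" using z c by simp
qed

lemma homog_sum_unique: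
  assumes U: "opn U" and X: "X \<in> homog (tangent M U) a" "X' \<in> homog (tangent M U) a"
    and Y: "Y \<in> homog (tangent M U) (a + 1)" "Y' \<in> homog (tangent M U) (a + 1)"
    and e: "X \<oplus>\<^bsub>tangent M U\<^esub> Y = X' \<oplus>\<^bsub>tangent M U\<^esub> Y'"
  shows "X = X'" "Y = Y'"
proof -
  interpret T: abelian_group "tangent M U" by (rule tangent_group[OF U])
  have [simp]: "X \<in> carrier (tangent M U)" "Y \<in> carrier (tangent M U)"
    "X' \<in> carrier (tangent M U)" "Y' \<in> carrier (tangent M U)" using homog_tangent_closed[OF U] X Y by auto
  have "(X \<ominus>\<^bsub>tangent M U\<^esub> X') \<oplus>\<^bsub>tangent M U\<^esub> (Y \<ominus>\<^bsub>tangent M U\<^esub> Y')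
    = (X \<oplus>\<^bsub>tangent M U\<^esub> Y) \<ominus>\<^bsub>tangent M U\<^esub> (X' \<oplus>\<^bsub>tangent M U\<^esub> Y')"
    by (simp add: T.minus_eq T.minus_add T.a_ac)
  also have "\<dots> = \<zero>\<^bsub>tangent M U\<^esub>" by (simp add: e T.minus_eq T.r_neg)
  finally have "X \<ominus>\<^bsub>tangent M U\<^esub> X' = \<zero>\<^bsub>tangent M U\<^esub>" "Y \<ominus>\<^bsub>tangent M U\<^esub> Y' = \<zero>\<^bsub>tangent M U\<^esub>"
    using homog_sum_zero[OF U, of "X \<ominus>\<^bsub>tangent M U\<^esub> X'" a "Y \<ominus>\<^bsub>tangent M U\<^esub> Y'"] X Y
    by (simp_all add: T.minus_eq add_homog[OF U] minus_homog[OF U])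
  then show "X = X'" "Y = Y'" using T.diff_zero_imp_eq by simp_all
qed

section \<open>Vector fields form a sheaf: separation and gluing\<close>

lemma vf_separated:
  assumes \<BB>: "\<And>N. N \<in> \<BB> \<Longrightarrow> opn N" "\<Union>\<BB> = U"
    and X: "X \<in> carrier (tangent M U)" "Y \<in> carrier (tangent M U)"
    and eq: "\<And>N. N \<in> \<BB> \<Longrightarrow> mk_vf M N X = mk_vf M N Y"
  shows "X = Y"
proof (rule tangent_eqI[OF X])
  fix V f assume V: "opn V" "V \<subseteq> U" and f: "f \<in> carrier (sheaf M V)"
  show "X V f = Y V f"
  \<comment> \<open>The members of the cover need not lie in \<open>V\<close>, so the values over
    \<open>V\<close> are compared on the traces \<open>V \<inter> N\<close>. There restriction moves
    inside the derivations, and both fields are determined by their restrictions to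
    \<open>N\<close>.\<close>
  proof (rule separated[of "(\<lambda>N. V \<inter> N) ` \<BB>"])
    fix W assume "W \<in> (\<lambda>N. V \<inter> N) ` \<BB>"
    then obtain N where N: "N \<in> \<BB>" "W = V \<inter> N" by blast
    then have W: "opn W" "W \<subseteq> V" "W \<subseteq> N" using V \<BB> by auto
    have "X W g = Y W g" if "g \<in> carrier (sheaf M W)" for g
      using eq[OF N(1)] that W mk_vf_apply[of M W N g X] mk_vf_apply[of M W N g Y] by simp
    then show "restr M V W (X V f) = restr M V W (Y V f)"
      using W V f by (simp add: vf_restr[OF X(1)] vf_restr[OF X(2)] restr_closed)
  next
    show "\<Union>((\<lambda>N. V \<inter> N) ` \<BB>) = V" using V(2) \<BB>(2) by blast
  qed (use V \<BB> f vf_closed X in auto)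
qed

text \<open>The value of the glued field at a function \<open>f\<close> on \<open>V\<close> is glued
  from the values of the given fields at the restrictions of \<open>f\<close> to the members inside
  \<open>V\<close>. These cover \<open>V\<close> because the family is closed under smaller open
  sets. All laws of a superderivation hold on the members and pass to \<open>V\<close> by
  separation, parity by \<open>homog_local\<close>.\<close>

lemma glue_homog:
  assumes \<BB>: "\<And>N. N \<in> \<BB> \<Longrightarrow> opn N" "\<Union>\<BB> = U"
    and down: "\<And>N N'. N \<in> \<BB> \<Longrightarrow> opn N' \<Longrightarrow> N' \<subseteq> N \<Longrightarrow> N' \<in> \<BB>"
    and X: "\<And>N. N \<in> \<BB> \<Longrightarrow> X N \<in> homog (tangent M N) a"
    and compat: "\<And>N N'. N \<in> \<BB> \<Longrightarrow> N' \<in> \<BB> \<Longrightarrow> N' \<subseteq> N \<Longrightarrow> mk_vf M N' (X N) = X N'"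
  shows "\<exists>Y\<in>homog (tangent M U) a. \<forall>N\<in>\<BB>. mk_vf M N Y = X N"
proof -
  have "\<exists>g\<in>carrier (sheaf M V). \<forall>N\<in>{N\<in>\<BB>. N \<subseteq> V}. restr M V N g = X N N (restr M V N f)"
    if V: "opn V" "V \<subseteq> U" and f: "f \<in> carrier (sheaf M V)" for V f
  proof (rule glue_sections)
    show "\<Union>{N\<in>\<BB>. N \<subseteq> V} = V"
    proof
      show "V \<subseteq> \<Union>{N\<in>\<BB>. N \<subseteq> V}"
      proof
        fix p assume "p \<in> V"
        then obtain N where N: "N \<in> \<BB>" "p \<in> N" using V \<BB>(2) by blast
        then have "V \<inter> N \<in> \<BB>" using down[OF N(1), of "V \<inter> N"] V \<BB>(1) by auto
        then show "p \<in> \<Union>{N\<in>\<BB>. N \<subseteq> V}" using N \<open>p \<in> V\<close> by blast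
      qed
    qed blast
  next
    fix N assume "N \<in> {N\<in>\<BB>. N \<subseteq> V}"
    then show "X N N (restr M V N f) \<in> carrier (sheaf M N)"
      using homog_vf_closed[OF X, of N N] restr_closed[OF V(1), of N f] \<BB>(1) f by auto
  next
    fix N N' assume N: "N \<in> {N\<in>\<BB>. N \<subseteq> V}" and N': "N' \<in> {N\<in>\<BB>. N \<subseteq> V}" and sub: "N' \<subseteq> N"
    have o: "opn N" "opn N'" "N \<subseteq> V" "N' \<subseteq> V" using N N' \<BB>(1) by auto
    have f': "restr M V N f \<in> carrier (sheaf M N)" "restr M V N' f \<in> carrier (sheaf M N')"
      using restr_closed V(1) o f by auto
    have "restr M N N' (X N N (restr M V N f)) = X N N' (restr M V N' f)"
      using homog_vf_restr[OF X, of N N N' "restr M V N f"] N o sub f' restr_restr[OF V(1) o(1,2) sub o(3) f]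
      by simp
    also have "\<dots> = mk_vf M N' (X N) N' (restr M V N' f)" using o f' by simp
    also have "mk_vf M N' (X N) = X N'" using compat[of N N'] N N' sub by blast
    finally show "restr M N N' (X N N (restr M V N f)) = X N' N' (restr M V N' f)" .
  next
    fix N N' assume "N \<in> {N\<in>\<BB>. N \<subseteq> V}" "opn N'" "N' \<subseteq> N"
    then show "N' \<in> {N\<in>\<BB>. N \<subseteq> V}" using down[of N N'] by blast
  qed (use \<BB>(1) in auto)
  note ex = this
  \<comment> \<open>The choice is harmless: the section is determined by its restrictions to the
    members inside \<open>V\<close>, and only these restrictions are used below.\<close>
  define Y where "Y = mk_vf M U (\<lambda>V f. SOME g. g \<in> carrier (sheaf M V) \<and>
      (\<forall>N\<in>{N\<in>\<BB>. N \<subseteq> V}. restr M V N g = X N N (restr M V N f)))"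
  have Y: "Y V f \<in> carrier (sheaf M V) \<and> (\<forall>N\<in>{N\<in>\<BB>. N \<subseteq> V}. restr M V N (Y V f) = X N N (restr M V N f))"
    if "opn V" "V \<subseteq> U" "f \<in> carrier (sheaf M V)" for V f
    unfolding Y_def mk_vf_apply[OF that] by (rule someI_ex) (use ex[OF that] in blast)
  have Yc: "Y V f \<in> carrier (sheaf M V)" if "opn V" "V \<subseteq> U" "f \<in> carrier (sheaf M V)" for V f
    using Y[OF that] by blast
  have YN: "restr M V N (Y V f) = X N N (restr M V N f)"
    if "opn V" "V \<subseteq> U" "f \<in> carrier (sheaf M V)" "N \<in> \<BB>" "N \<subseteq> V" for V N f
    using Y[OF that(1-3)] that(4,5) by blast
  have cover: "\<Union>{N\<in>\<BB>. N \<subseteq> V} = V" if V: "opn V" "V \<subseteq> U" for V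
  proof
    show "V \<subseteq> \<Union>{N\<in>\<BB>. N \<subseteq> V}"
    proof
      fix p assume "p \<in> V"
      then obtain N where N: "N \<in> \<BB>" "p \<in> N" using V \<BB>(2) by blast
      then have "V \<inter> N \<in> \<BB>" using down[OF N(1), of "V \<inter> N"] V \<BB>(1) by auto
      then show "p \<in> \<Union>{N\<in>\<BB>. N \<subseteq> V}" using N \<open>p \<in> V\<close> by blast
    qed
  qed blast
  \<comment> \<open>The trivial premise \<open>N \<subseteq> N\<close> is passed on because the laws
    of the field \<open>X N\<close> are applied to functions on all of \<open>N\<close>, where the
    open set and the domain of the field coincide.\<close>
  have eqI: "g = h" if V: "opn V" "V \<subseteq> U" and "g \<in> carrier (sheaf M V)" "h \<in> carrier (sheaf M V)"
    "\<And>N. N \<in> \<BB> \<Longrightarrow> N \<subseteq> V \<Longrightarrow> opn N \<Longrightarrow> N \<subseteq> N \<Longrightarrow> restr M V N g = restr M V N h" for V g h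
    by (rule separated[OF _ cover[OF V]]) (use that \<BB>(1) in auto)
  have "Y \<in> homog (tangent M U) a"
  proof (rule homog_tangentI)
    fix V assume V: "opn V" "V \<subseteq> U"
    interpret A: supercommutative_algebra "sheaf M V" by (rule sheaf_algebra[OF V(1)])
    note [simp] = Yc[OF V] YN[OF V]
    show "Y V f \<in> carrier (sheaf M V)" if "f \<in> carrier (sheaf M V)" for f using that by simp
    show "Y V f \<in> homog (sheaf M V) (a + b)" if f: "f \<in> homog (sheaf M V) b" for b f
    proof (rule homog_local[OF _ cover[OF V]])
      fix N assume N: "N \<in> {N\<in>\<BB>. N \<subseteq> V}"
      then have o: "opn N" "N \<subseteq> V" "N \<in> \<BB>" using \<BB>(1) by auto
      show "restr M V N (Y V f) \<in> homog (sheaf M N) (a + b)"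
        using homog_vf_homog[OF X[OF o(3)] o(1) subset_refl restr_homog[OF V(1) o(1,2) f]] o f
        by (simp add: A.homog_closed)
    qed (use \<BB>(1) f A.homog_closed in auto)
    show "Y V (f \<oplus>\<^bsub>sheaf M V\<^esub> g) = Y V f \<oplus>\<^bsub>sheaf M V\<^esub> Y V g"
      if fg: "f \<in> carrier (sheaf M V)" "g \<in> carrier (sheaf M V)" for f g
    proof (rule eqI[OF V])
      fix N assume N: "N \<in> \<BB>" "N \<subseteq> V" "opn N" "N \<subseteq> N"
      then show "restr M V N (Y V (f \<oplus>\<^bsub>sheaf M V\<^esub> g)) = restr M V N (Y V f \<oplus>\<^bsub>sheaf M V\<^esub> Y V g)"
        using fg by (simp add: restr_add[OF V(1) N(3,2)] restr_closed[OF V(1) N(3,2)]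
            homog_vf_add[OF X[OF N(1)] N(3,4)])
    qed (use fg in simp_all)
    show "Y V (k \<odot>\<^bsub>sheaf M V\<^esub> f) = k \<odot>\<^bsub>sheaf M V\<^esub> Y V f" if f: "f \<in> carrier (sheaf M V)" for k f
    proof (rule eqI[OF V])
      fix N assume N: "N \<in> \<BB>" "N \<subseteq> V" "opn N" "N \<subseteq> N"
      then show "restr M V N (Y V (k \<odot>\<^bsub>sheaf M V\<^esub> f)) = restr M V N (k \<odot>\<^bsub>sheaf M V\<^esub> Y V f)"
        using f by (simp add: A.smult_closed restr_smult[OF V(1) N(3,2)] restr_closed[OF V(1) N(3,2)]
            homog_vf_smult[OF X[OF N(1)] N(3,4)])
    qed (use f A.smult_closed in simp_all)
    show "Y V (f \<otimes>\<^bsub>sheaf M V\<^esub> g) =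
        Y V f \<otimes>\<^bsub>sheaf M V\<^esub> g \<oplus>\<^bsub>sheaf M V\<^esub> signed (sheaf M V) (a * b) (f \<otimes>\<^bsub>sheaf M V\<^esub> Y V g)"
      if fh: "f \<in> homog (sheaf M V) b" and fg: "g \<in> carrier (sheaf M V)" "f \<in> carrier (sheaf M V)" for b f g
    proof (rule eqI[OF V])
      fix N assume N: "N \<in> \<BB>" "N \<subseteq> V" "opn N" "N \<subseteq> N"
      then show "restr M V N (Y V (f \<otimes>\<^bsub>sheaf M V\<^esub> g)) =
          restr M V N (Y V f \<otimes>\<^bsub>sheaf M V\<^esub> g \<oplus>\<^bsub>sheaf M V\<^esub> signed (sheaf M V) (a * b) (f \<otimes>\<^bsub>sheaf M V\<^esub> Y V g))"
        using fg by (simp add: restr_add[OF V(1) N(3,2)] restr_mult[OF V(1) N(3,2)]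
            restr_signed[OF V(1) N(3,2)] restr_closed[OF V(1) N(3,2)]
            homog_vf_mult[OF X[OF N(1)] N(3,4) restr_homog[OF V(1) N(3,2) fh]])
    qed (use fg in simp_all)
    show "restr M V W (Y V f) = Y W (restr M V W f)"
      if W: "opn W" "W \<subseteq> V" and f: "f \<in> carrier (sheaf M V)" for W f
    proof (rule eqI)
      show WU: "W \<subseteq> U" using W V by blast
      fix N assume N: "N \<in> \<BB>" "N \<subseteq> W" "opn N"
      have NV: "N \<subseteq> V" using N W by blast
      show "restr M W N (restr M V W (Y V f)) = restr M W N (Y W (restr M V W f))"
        using restr_restr[OF V(1) W(1) N(3,2) W(2)] YN[OF W(1) WU _ N(1,2)] restr_closed[OF V(1) W] f N NV
        by simp
    qed (use W V f Yc restr_closed in auto)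
  qed (simp add: Y_def)
  moreover have "mk_vf M N Y = X N" if N: "N \<in> \<BB>" for N
  proof -
    have "mk_vf M N Y = mk_vf M N (X N)"
    proof (rule mk_vf_eqI)
      fix V f assume V: "opn V" "V \<subseteq> N" and f: "f \<in> carrier (sheaf M V)"
      \<comment> \<open>As \<open>V\<close> is itself a member, restriction to \<open>V\<close>,
        which is the identity, computes the value of the glued field over \<open>V\<close>.\<close>
      have VB: "V \<in> \<BB>" using down N V by simp
      have VU: "V \<subseteq> U" using VB \<BB>(2) by blast
      have "Y V f = restr M V V (Y V f)" using restr_id V Yc[OF V(1) VU f] by simp
      also have "\<dots> = X V V f" using YN[OF V(1) VU f VB] restr_id V f by simp
      also have "\<dots> = X N V f" using mk_vf_apply[OF V(1) subset_refl f, of "X N"] unfolding compat[OF N VB V(2)] .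
      finally show "Y V f = X N V f" .
    qed
    then show ?thesis using homog_vf_mk[OF X[OF N]] by simp
  qed
  ultimately show ?thesis by blast
qed

text \<open>The even and odd parts are glued separately. They may be chosen arbitrarily on each
  member: restriction preserves parity and the decomposition is unique, so the parts inherit the
  compatibility of the whole fields.\<close>

lemma glue_vf:
  assumes \<BB>: "\<And>N. N \<in> \<BB> \<Longrightarrow> opn N" "\<Union>\<BB> = U"
    and down: "\<And>N N'. N \<in> \<BB> \<Longrightarrow> opn N' \<Longrightarrow> N' \<subseteq> N \<Longrightarrow> N' \<in> \<BB>"
    and X: "\<And>N. N \<in> \<BB> \<Longrightarrow> X N \<in> carrier (tangent M N)"
    and compat: "\<And>N N'. N \<in> \<BB> \<Longrightarrow> N' \<in> \<BB> \<Longrightarrow> N' \<subseteq> N \<Longrightarrow> mk_vf M N' (X N) = X N'"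
  shows "\<exists>Y\<in>carrier (tangent M U). \<forall>N\<in>\<BB>. mk_vf M N Y = X N"
proof -
  have U: "opn U" using opn_Union \<BB> by metis
  have "\<forall>N. \<exists>Y Z. N \<in> \<BB> \<longrightarrow> X N = Y \<oplus>\<^bsub>tangent M N\<^esub> Z \<and> Y \<in> homog (tangent M N) 0 \<and> Z \<in> homog (tangent M N) 1"
    using X tangent_homogE by metis
  then obtain Y Z where YZ: "\<And>N. N \<in> \<BB> \<Longrightarrow> X N = Y N \<oplus>\<^bsub>tangent M N\<^esub> Z N"
    "\<And>N. N \<in> \<BB> \<Longrightarrow> Y N \<in> homog (tangent M N) 0" "\<And>N. N \<in> \<BB> \<Longrightarrow> Z N \<in> homog (tangent M N) 1"
    by metis
  have c: "mk_vf M N' (Y N) = Y N' \<and> mk_vf M N' (Z N) = Z N'" if N: "N \<in> \<BB>" "N' \<in> \<BB>" "N' \<subseteq> N" for N N'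
  proof -
    note o = \<BB>(1)[OF N(1)] \<BB>(1)[OF N(2)]
    have "mk_vf M N' (Y N) \<oplus>\<^bsub>tangent M N'\<^esub> mk_vf M N' (Z N) = Y N' \<oplus>\<^bsub>tangent M N'\<^esub> Z N'"
      using compat[OF N] YZ(1)[OF N(1)] YZ(1)[OF N(2)] restrict_add[OF o(2) N(3)] by simp
    then show ?thesis
      using homog_sum_unique[OF o(2), of "mk_vf M N' (Y N)" 0 "Y N'" "mk_vf M N' (Z N)" "Z N'"]
        restrict_homog[OF o N(3)] YZ(2,3) N by simp
  qed
  have "\<exists>W\<in>homog (tangent M U) 0. \<forall>N\<in>\<BB>. mk_vf M N W = Y N"
    by (rule glue_homog[OF \<BB> down]) (use YZ(2) c in blast)+
  then obtain Y' where Y': "Y' \<in> homog (tangent M U) 0" "\<And>N. N \<in> \<BB> \<Longrightarrow> mk_vf M N Y' = Y N"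
    by blast
  have "\<exists>W\<in>homog (tangent M U) 1. \<forall>N\<in>\<BB>. mk_vf M N W = Z N"
    by (rule glue_homog[OF \<BB> down]) (use YZ(3) c in blast)+
  then obtain Z' where Z': "Z' \<in> homog (tangent M U) 1" "\<And>N. N \<in> \<BB> \<Longrightarrow> mk_vf M N Z' = Z N"
    by blast
  have "mk_vf M N (Y' \<oplus>\<^bsub>tangent M U\<^esub> Z') = X N" if "N \<in> \<BB>" for N
  proof -
    have "N \<subseteq> U" using that \<BB>(2) by blast
    then show ?thesis using restrict_add[OF \<BB>(1)[OF that]] Y'(2) Z'(2) YZ(1) that by simp
  qed
  then show ?thesis using Y'(1) Z'(1) by (intro bexI[of _ "Y' \<oplus>\<^bsub>tangent M U\<^esub> Z'"]) (auto simp: carrier_tangent)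
qed

end

section \<open>Terms of the symmetric algebra and their evaluation\<close>

declare symm_eq.trans [trans]

lemma symm_restr_simps [simp]:
  "symm_restr M U V (Fn f) = Fn (restr M U V f)"
  "symm_restr M U V (Vec X) = Vec (mk_vf M V X)"
  "symm_restr M U V (Plus t u) = Plus (symm_restr M U V t) (symm_restr M U V u)"
  "symm_restr M U V (Times t u) = Times (symm_restr M U V t) (symm_restr M U V u)"
  by (simp_all add: symm_restr_def)

context superringed_space
begin

lemma signed_one_closed: "opn U \<Longrightarrow> signed (sheaf M U) s \<one>\<^bsub>sheaf M U\<^esub> \<in> carrier (sheaf M U)"
  by (rule abelian_group.signed_closed[OF sheaf_group])
    (auto intro: monoid.one_closed ring.is_monoid sheaf_ring)

lemma symm_wf_signed: "opn U \<Longrightarrow> symm_wf M U t \<Longrightarrow> symm_wf M U (symm_signed M U s t)"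
  by (simp add: symm_signed_def signed_one_closed)

lemma sheaf_ops_closed:
  assumes "opn U"
  shows "\<zero>\<^bsub>sheaf M U\<^esub> \<in> carrier (sheaf M U)" "\<one>\<^bsub>sheaf M U\<^esub> \<in> carrier (sheaf M U)"
    "f \<in> carrier (sheaf M U) \<Longrightarrow> g \<in> carrier (sheaf M U) \<Longrightarrow> f \<oplus>\<^bsub>sheaf M U\<^esub> g \<in> carrier (sheaf M U)"
    "f \<in> carrier (sheaf M U) \<Longrightarrow> g \<in> carrier (sheaf M U) \<Longrightarrow> f \<otimes>\<^bsub>sheaf M U\<^esub> g \<in> carrier (sheaf M U)"
proof -
  interpret ring "sheaf M U" by (rule sheaf_ring[OF assms])
  show "\<zero>\<^bsub>sheaf M U\<^esub> \<in> carrier (sheaf M U)" "\<one>\<^bsub>sheaf M U\<^esub> \<in> carrier (sheaf M U)"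
    "f \<in> carrier (sheaf M U) \<Longrightarrow> g \<in> carrier (sheaf M U) \<Longrightarrow> f \<oplus>\<^bsub>sheaf M U\<^esub> g \<in> carrier (sheaf M U)"
    "f \<in> carrier (sheaf M U) \<Longrightarrow> g \<in> carrier (sheaf M U) \<Longrightarrow> f \<otimes>\<^bsub>sheaf M U\<^esub> g \<in> carrier (sheaf M U)"
    by simp_all
qed

lemma homog_sheaf_closed: "opn U \<Longrightarrow> f \<in> homog (sheaf M U) a \<Longrightarrow> f \<in> carrier (sheaf M U)"
  by (rule supercommutative_algebra.homog_closed[OF sheaf_algebra])

lemma symm_eq_wf:
  assumes "opn U" "symm_eq M U t u"
  shows "symm_wf M U t" "symm_wf M U u"
proof -
  have "symm_wf M U t \<and> symm_wf M U u"
    using assms(2)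
    by induction (use assms(1) in \<open>simp_all add: sheaf_ops_closed symm_wf_signed tangent_add_closed
      tangent_smult_closed homog_sheaf_closed homog_tangent_closed\<close>)
  then show "symm_wf M U t" "symm_wf M U u" by auto
qed

lemma symm_homog_wf:
  assumes "opn U"
  shows "symm_homog M U a t \<Longrightarrow> symm_wf M U t"
  by (induction rule: symm_homog.induct) (use assms in \<open>simp_all add: homog_sheaf_closed homog_tangent_closed\<close>)

context
  fixes U V assumes UV: "opn U" "opn V" "V \<subseteq> U"
begin

lemma symm_wf_restr: "symm_wf M U t \<Longrightarrow> symm_wf M V (symm_restr M U V t)"
  by (induction t) (simp_all add: restr_closed[OF UV] restrict_closed[OF UV])

lemma symm_restr_signed: "symm_restr M U V (symm_signed M U s t) = symm_signed M V s (symm_restr M U V t)"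
  by (simp add: symm_signed_def restr_signed[OF UV] restr_one[OF UV] sheaf_ops_closed UV)

text \<open>Restriction is compatible with all operations and preserves parity, so each defining
  relation becomes an instance of the same relation over the smaller set.\<close>

lemma symm_eq_restr: "symm_eq M U t u \<Longrightarrow> symm_eq M V (symm_restr M U V t) (symm_restr M U V u)"
proof (induction rule: symm_eq.induct)
  case (refl t)
  then show ?case by (rule symm_eq.refl[OF symm_wf_restr])
next
  case (sym t u)
  then show ?case by (rule_tac symm_eq.sym)
next
  case (trans t u v)
  then show ?case by (rule_tac symm_eq.trans)
next
  case (plus_neg t)
  then show ?case
    by (simp add: symm_restr_signed restr_zero[OF UV] symm_eq.plus_neg symm_wf_restr)
next
  case (Vec_Fn_commute X a f b)
  then show ?case
    using symm_eq.Vec_Fn_commute[OF restrict_homog[OF UV] restr_homog[OF UV], of X a f b]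
    by (simp add: symm_restr_signed)
next
  case (Vec_Vec_commute X a Y b)
  then show ?case
    using symm_eq.Vec_Vec_commute[OF restrict_homog[OF UV] restrict_homog[OF UV], of X a Y b]
    by (simp add: symm_restr_signed)
qed (simp_all add: restr_zero[OF UV] restr_one[OF UV] restr_add[OF UV] restr_mult[OF UV]
      restrict_add[OF UV(2,3)] restrict_smult[OF UV] symm_eq.intros(4-18) symm_wf_restr
      restr_closed[OF UV] restrict_closed[OF UV])

end

lemma symm_restr_id: "opn U \<Longrightarrow> symm_wf M U t \<Longrightarrow> symm_restr M U U t = t"
  by (induction t) (simp_all add: restr_id vf_mk)

lemma symm_restr_restr:
  "opn U \<Longrightarrow> opn V \<Longrightarrow> opn W \<Longrightarrow> W \<subseteq> V \<Longrightarrow> V \<subseteq> U \<Longrightarrow> symm_wf M U t \<Longrightarrow>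
    symm_restr M V W (symm_restr M U V t) = symm_restr M U W t"
  by (induction t) (simp_all add: restr_restr)

text \<open>Gives access to the Leibniz rules and to the structure identity, which concern
  homogeneous elements, for arbitrary terms. The grading is built along the term: generators split
  in their own modules, and a product is expanded into four products.\<close>

lemma symm_term_homog_split:
  assumes U: "opn U"
  shows "symm_wf M U t \<Longrightarrow> \<exists>u v. symm_homog M U 0 u \<and> symm_homog M U 1 v \<and> symm_eq M U t (Plus u v)"
proof (induction t)
  case (Fn f)
  then obtain g h where gh: "g \<in> homog (sheaf M U) 0" "h \<in> homog (sheaf M U) 1" "f = g \<oplus>\<^bsub>sheaf M U\<^esub> h"
    using supercommutative_algebra.homog_sum[OF sheaf_algebra[OF U], of f] by auto
  then have "symm_eq M U (Fn f) (Plus (Fn g) (Fn h))"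
    using symm_eq.sym[OF symm_eq.Fn_plus[of g M U h]] by (simp add: homog_sheaf_closed[OF U])
  moreover have "symm_homog M U 0 (Fn g)" "symm_homog M U 1 (Fn h)"
    using gh(1,2) by (simp_all add: symm_homog.intros(1))
  ultimately show ?case by blast
next
  case (Vec X)
  then have "X \<in> carrier (tangent M U)" by simp
  then obtain Y Z where YZ: "X = Y \<oplus>\<^bsub>tangent M U\<^esub> Z" "Y \<in> homog (tangent M U) 0" "Z \<in> homog (tangent M U) 1"
    by (rule tangent_homogE)
  then have "symm_eq M U (Vec X) (Plus (Vec Y) (Vec Z))"
    using symm_eq.sym[OF symm_eq.Vec_plus[of Y M U Z]] by (simp add: homog_tangent_closed[OF U])
  moreover have "symm_homog M U 0 (Vec Y)" "symm_homog M U 1 (Vec Z)"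
    using YZ(2,3) by (simp_all add: symm_homog.intros(2))
  ultimately show ?case by blast
next
  case (Plus t t')
  then obtain u v u' v' where h: "symm_homog M U 0 u" "symm_homog M U 1 v" "symm_eq M U t (Plus u v)"
    "symm_homog M U 0 u'" "symm_homog M U 1 v'" "symm_eq M U t' (Plus u' v')" by auto
  note wf = h(1,2,4,5)[THEN symm_homog_wf[OF U]]
  have "symm_eq M U (Plus t t') (Plus (Plus u v) (Plus u' v'))"
    using h by (intro symm_eq.plus_cong)
  also have "symm_eq M U \<dots> (Plus u (Plus v (Plus u' v')))"
    using wf by (intro symm_eq.plus_assoc) auto
  also have "symm_eq M U \<dots> (Plus u (Plus u' (Plus v v')))"
  proof (rule symm_eq.plus_cong[OF symm_eq.refl])
    have "symm_eq M U (Plus v (Plus u' v')) (Plus (Plus v u') v')"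
      using wf by (intro symm_eq.sym[OF symm_eq.plus_assoc]) auto
    also have "symm_eq M U \<dots> (Plus (Plus u' v) v')"
      using wf by (intro symm_eq.plus_cong[OF symm_eq.plus_comm symm_eq.refl])
    also have "symm_eq M U \<dots> (Plus u' (Plus v v'))"
      using wf by (intro symm_eq.plus_assoc) auto
    finally show "symm_eq M U (Plus v (Plus u' v')) (Plus u' (Plus v v'))" .
  qed (use wf in simp)
  also have "symm_eq M U \<dots> (Plus (Plus u u') (Plus v v'))"
    using wf by (intro symm_eq.sym[OF symm_eq.plus_assoc]) auto
  finally have "symm_eq M U (Plus t t') (Plus (Plus u u') (Plus v v'))" .
  moreover have "symm_homog M U 0 (Plus u u')" "symm_homog M U 1 (Plus v v')"
    using h by (simp_all add: symm_homog.intros(3))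
  ultimately show ?case by blast
next
  case (Times t t')
  then obtain u v u' v' where h: "symm_homog M U 0 u" "symm_homog M U 1 v" "symm_eq M U t (Plus u v)"
    "symm_homog M U 0 u'" "symm_homog M U 1 v'" "symm_eq M U t' (Plus u' v')" by auto
  note wf = h(1,2,4,5)[THEN symm_homog_wf[OF U]]
  \<comment> \<open>\<open>?A\<close> and \<open>?D\<close> are even, \<open>?B\<close> and
    \<open>?C\<close> odd; the chain of congruences only collects them accordingly.\<close>
  let ?A = "Times u u'" and ?B = "Times u v'" and ?C = "Times v u'" and ?D = "Times v v'"
  have "symm_eq M U (Times t t') (Times (Plus u v) (Plus u' v'))"
    using h by (intro symm_eq.times_cong)
  also have "symm_eq M U \<dots> (Plus (Times u (Plus u' v')) (Times v (Plus u' v')))"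
    using wf by (intro symm_eq.distrib_right) auto
  also have "symm_eq M U \<dots> (Plus (Plus ?A ?B) (Plus ?C ?D))"
    using wf by (intro symm_eq.plus_cong symm_eq.distrib_left) auto
  also have "symm_eq M U \<dots> (Plus (Plus ?A ?B) (Plus ?D ?C))"
    using wf by (intro symm_eq.plus_cong[OF symm_eq.refl symm_eq.plus_comm]) auto
  also have "symm_eq M U \<dots> (Plus ?A (Plus ?B (Plus ?D ?C)))"
    using wf by (intro symm_eq.plus_assoc) auto
  also have "symm_eq M U \<dots> (Plus ?A (Plus ?D (Plus ?B ?C)))"
  proof (rule symm_eq.plus_cong[OF symm_eq.refl])
    have "symm_eq M U (Plus ?B (Plus ?D ?C)) (Plus (Plus ?B ?D) ?C)"
      using wf by (intro symm_eq.sym[OF symm_eq.plus_assoc]) auto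
    also have "symm_eq M U \<dots> (Plus (Plus ?D ?B) ?C)"
      using wf by (intro symm_eq.plus_cong[OF symm_eq.plus_comm symm_eq.refl]) auto
    also have "symm_eq M U \<dots> (Plus ?D (Plus ?B ?C))"
      using wf by (intro symm_eq.plus_assoc) auto
    finally show "symm_eq M U (Plus ?B (Plus ?D ?C)) (Plus ?D (Plus ?B ?C))" .
  qed (use wf in simp)
  also have "symm_eq M U \<dots> (Plus (Plus ?A ?D) (Plus ?B ?C))"
    using wf by (intro symm_eq.sym[OF symm_eq.plus_assoc]) auto
  finally have "symm_eq M U (Times t t') (Plus (Plus ?A ?D) (Plus ?B ?C))" .
  moreover have "symm_homog M U 0 (Plus ?A ?D)" "symm_homog M U 1 (Plus ?B ?C)"
    using symm_homog.intros(4)[OF h(1) h(4)] symm_homog.intros(4)[OF h(2) h(5)]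
      symm_homog.intros(4)[OF h(1) h(5)] symm_homog.intros(4)[OF h(2) h(4)]
    by (simp_all add: symm_homog.intros(3))
  ultimately show ?case by blast
qed

end

section \<open>Evaluation of terms by means of the multiplication\<close>

locale tangent_multiplication = superringed_space M
  for M :: "('x, 'k::field, 'a) superspace" +
  fixes circ :: "('x, 'a) vf_mult" and e :: "('x, 'a) vfield"
  assumes mult: "tangent_mult M circ e"
begin

lemma e_homog: "opn U \<Longrightarrow> mk_vf M U e \<in> homog (tangent M U) 0"
  using mult restrict_homog[of "topspace (base M)" U e 0] openin_subset[of "base M" U]
  by (simp add: tangent_mult_def)

lemma e_closed: "opn U \<Longrightarrow> mk_vf M U e \<in> carrier (tangent M U)"
  using e_homog homog_tangent_closed by blast

lemma
  assumes U: "opn U"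
  shows circ_closed: "X \<in> carrier (tangent M U) \<Longrightarrow> Y \<in> carrier (tangent M U) \<Longrightarrow>
      circ U X Y \<in> carrier (tangent M U)"
    and circ_homog: "X \<in> homog (tangent M U) a \<Longrightarrow> Y \<in> homog (tangent M U) b \<Longrightarrow>
      circ U X Y \<in> homog (tangent M U) (a + b)"
    and circ_add_left: "X \<in> carrier (tangent M U) \<Longrightarrow> Y \<in> carrier (tangent M U) \<Longrightarrow>
      Z \<in> carrier (tangent M U) \<Longrightarrow>
      circ U (X \<oplus>\<^bsub>tangent M U\<^esub> Y) Z = circ U X Z \<oplus>\<^bsub>tangent M U\<^esub> circ U Y Z"
    and circ_add_right: "X \<in> carrier (tangent M U) \<Longrightarrow> Y \<in> carrier (tangent M U) \<Longrightarrow>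
      Z \<in> carrier (tangent M U) \<Longrightarrow>
      circ U X (Y \<oplus>\<^bsub>tangent M U\<^esub> Z) = circ U X Y \<oplus>\<^bsub>tangent M U\<^esub> circ U X Z"
    and circ_smult_left: "f \<in> carrier (sheaf M U) \<Longrightarrow> X \<in> carrier (tangent M U) \<Longrightarrow>
      Y \<in> carrier (tangent M U) \<Longrightarrow> circ U (f \<odot>\<^bsub>tangent M U\<^esub> X) Y = f \<odot>\<^bsub>tangent M U\<^esub> circ U X Y"
    and circ_smult_right: "f \<in> homog (sheaf M U) b \<Longrightarrow> X \<in> homog (tangent M U) a \<Longrightarrow>
      Y \<in> carrier (tangent M U) \<Longrightarrow>
      circ U X (f \<odot>\<^bsub>tangent M U\<^esub> Y) = signed (tangent M U) (a * b) (f \<odot>\<^bsub>tangent M U\<^esub> circ U X Y)"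
    and circ_commute: "X \<in> homog (tangent M U) a \<Longrightarrow> Y \<in> homog (tangent M U) b \<Longrightarrow>
      circ U X Y = signed (tangent M U) (a * b) (circ U Y X)"
    and circ_assoc: "X \<in> carrier (tangent M U) \<Longrightarrow> Y \<in> carrier (tangent M U) \<Longrightarrow>
      Z \<in> carrier (tangent M U) \<Longrightarrow> circ U (circ U X Y) Z = circ U X (circ U Y Z)"
    and circ_e_left: "X \<in> carrier (tangent M U) \<Longrightarrow> circ U (mk_vf M U e) X = X"
    and circ_e_right: "X \<in> carrier (tangent M U) \<Longrightarrow> circ U X (mk_vf M U e) = X"
    and circ_restrict: "opn V \<Longrightarrow> V \<subseteq> U \<Longrightarrow> X \<in> carrier (tangent M U) \<Longrightarrow> Y \<in> carrier (tangent M U) \<Longrightarrow>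
      mk_vf M V (circ U X Y) = circ V (mk_vf M V X) (mk_vf M V Y)"
proof -
  note m = mult[unfolded tangent_mult_def Let_def, THEN conjunct2, THEN spec, THEN mp, OF U]
  show "circ U X Y \<in> carrier (tangent M U)"
    if "X \<in> carrier (tangent M U)" "Y \<in> carrier (tangent M U)"
    using that by (rule m[THEN conjunct1, rule_format])
  show "circ U X Y \<in> homog (tangent M U) (a + b)"
    if "X \<in> homog (tangent M U) a" "Y \<in> homog (tangent M U) b"
    using that by (rule m[THEN conjunct2, THEN conjunct1, rule_format])
  show "circ U (X \<oplus>\<^bsub>tangent M U\<^esub> Y) Z = circ U X Z \<oplus>\<^bsub>tangent M U\<^esub> circ U Y Z"
    if "X \<in> carrier (tangent M U)" "Y \<in> carrier (tangent M U)" "Z \<in> carrier (tangent M U)"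
    using that by (rule m[THEN conjunct2, THEN conjunct2, THEN conjunct1, rule_format, THEN conjunct1])
  show "circ U X (Y \<oplus>\<^bsub>tangent M U\<^esub> Z) = circ U X Y \<oplus>\<^bsub>tangent M U\<^esub> circ U X Z"
    if "X \<in> carrier (tangent M U)" "Y \<in> carrier (tangent M U)" "Z \<in> carrier (tangent M U)"
    using that by (rule m[THEN conjunct2, THEN conjunct2, THEN conjunct1, rule_format, THEN conjunct2])
  show "circ U (f \<odot>\<^bsub>tangent M U\<^esub> X) Y = f \<odot>\<^bsub>tangent M U\<^esub> circ U X Y"
    if "f \<in> carrier (sheaf M U)" "X \<in> carrier (tangent M U)" "Y \<in> carrier (tangent M U)"
    using that by (rule m[THEN conjunct2, THEN conjunct2, THEN conjunct2, THEN conjunct1, rule_format])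
  show "circ U X (f \<odot>\<^bsub>tangent M U\<^esub> Y) = signed (tangent M U) (a * b) (f \<odot>\<^bsub>tangent M U\<^esub> circ U X Y)"
    if "f \<in> homog (sheaf M U) b" "X \<in> homog (tangent M U) a" "Y \<in> carrier (tangent M U)"
    using that by (rule m[THEN conjunct2, THEN conjunct2, THEN conjunct2, THEN conjunct2, THEN conjunct1, rule_format])
  show "circ U X Y = signed (tangent M U) (a * b) (circ U Y X)"
    if "X \<in> homog (tangent M U) a" "Y \<in> homog (tangent M U) b"
    using that by (rule m[THEN conjunct2, THEN conjunct2, THEN conjunct2, THEN conjunct2, THEN conjunct2, THEN conjunct1, rule_format])
  show "circ U (circ U X Y) Z = circ U X (circ U Y Z)"
    if "X \<in> carrier (tangent M U)" "Y \<in> carrier (tangent M U)" "Z \<in> carrier (tangent M U)"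
    using that by (rule m[THEN conjunct2, THEN conjunct2, THEN conjunct2, THEN conjunct2, THEN conjunct2, THEN conjunct2, THEN conjunct1, rule_format])
  show "circ U (mk_vf M U e) X = X"
    if "X \<in> carrier (tangent M U)"
    using that by (rule m[THEN conjunct2, THEN conjunct2, THEN conjunct2, THEN conjunct2, THEN conjunct2, THEN conjunct2, THEN conjunct2, THEN conjunct1, rule_format, THEN conjunct1])
  show "circ U X (mk_vf M U e) = X"
    if "X \<in> carrier (tangent M U)"
    using that by (rule m[THEN conjunct2, THEN conjunct2, THEN conjunct2, THEN conjunct2, THEN conjunct2, THEN conjunct2, THEN conjunct2, THEN conjunct1, rule_format, THEN conjunct2])
  show "mk_vf M V (circ U X Y) = circ V (mk_vf M V X) (mk_vf M V Y)"
    if "opn V" "V \<subseteq> U" "X \<in> carrier (tangent M U)" "Y \<in> carrier (tangent M U)"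
    using that by (intro conjI m[THEN conjunct2, THEN conjunct2, THEN conjunct2, THEN conjunct2, THEN conjunct2, THEN conjunct2, THEN conjunct2, THEN conjunct2, rule_format])
qed

lemma
  assumes U: "opn U" and X: "X \<in> carrier (tangent M U)" and Y: "Y \<in> carrier (tangent M U)"
  shows circ_signed_left: "circ U (signed (tangent M U) s X) Y = signed (tangent M U) s (circ U X Y)"
    and circ_minus_left: "circ U (\<ominus>\<^bsub>tangent M U\<^esub> X) Y = \<ominus>\<^bsub>tangent M U\<^esub> circ U X Y"
    and circ_minus_right: "circ U X (\<ominus>\<^bsub>tangent M U\<^esub> Y) = \<ominus>\<^bsub>tangent M U\<^esub> circ U X Y"
    and circ_zero_right: "circ U X \<zero>\<^bsub>tangent M U\<^esub> = \<zero>\<^bsub>tangent M U\<^esub>"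
proof -
  note G = tangent_group[OF U] tangent_group[OF U]
  note l = circ_closed[OF U _ Y] circ_add_left[OF U _ _ Y]
  note r = circ_closed[OF U X] circ_add_right[OF U X]
  show "circ U (signed (tangent M U) s X) Y = signed (tangent M U) s (circ U X Y)"
    by (rule additive_signed[where h = "\<lambda>X. circ U X Y", OF G l X])
  show "circ U (\<ominus>\<^bsub>tangent M U\<^esub> X) Y = \<ominus>\<^bsub>tangent M U\<^esub> circ U X Y"
    by (rule additive_minus[where h = "\<lambda>X. circ U X Y", OF G l X])
  show "circ U X (\<ominus>\<^bsub>tangent M U\<^esub> Y) = \<ominus>\<^bsub>tangent M U\<^esub> circ U X Y"
    by (rule additive_minus[where h = "circ U X", OF G r Y])
  show "circ U X \<zero>\<^bsub>tangent M U\<^esub> = \<zero>\<^bsub>tangent M U\<^esub>"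
    by (rule additive_zero[where h = "circ U X", OF G r])
qed

abbreviation eval where "eval \<equiv> symm_eval M circ e"

lemma eval_closed: "opn U \<Longrightarrow> symm_wf M U t \<Longrightarrow> eval U t \<in> carrier (tangent M U)"
  by (induction t) (simp_all add: tangent_smult_closed e_closed tangent_add_closed circ_closed)

lemma eval_homog:
  assumes U: "opn U"
  shows "symm_homog M U a t \<Longrightarrow> eval U t \<in> homog (tangent M U) a"
proof (induction rule: symm_homog.induct)
  case (1 f a)
  then show ?case using smult_homog[OF U 1 e_homog[OF U]] by simp
qed (simp_all add: U add_homog circ_homog)

lemma eval_restr:
  assumes UV: "opn U" "opn V" "V \<subseteq> U"
  shows "symm_wf M U t \<Longrightarrow> mk_vf M V (eval U t) = eval V (symm_restr M U V t)"
  by (induction t)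
    (simp_all add: restrict_smult[OF UV] restrict_add[OF UV(2,3)] circ_restrict[OF UV] eval_closed UV)

lemma eval_signed:
  assumes "opn U" "symm_wf M U t"
  shows "eval U (symm_signed M U s t) = signed (tangent M U) s (eval U t)"
  using assms by (simp add: symm_signed_def circ_smult_left signed_one_closed e_closed eval_closed
      circ_e_left signed_one_smult circ_signed_left)

text \<open>Evaluation factors through the presentation because each defining relation is a law of
  \<open>circ\<close>. For a field \<open>X\<close> and a function \<open>f\<close>, acting as
  \<open>f e\<close>, the relation is the signed linearity of \<open>circ\<close> in its second
  argument; for two fields it is supercommutativity.\<close>

lemma eval_eq:
  assumes U: "opn U"
  shows "symm_eq M U t u \<Longrightarrow> eval U t = eval U u"
proof -
  interpret T: abelian_group "tangent M U" by (rule tangent_group[OF U])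
  interpret A: ring "sheaf M U" by (rule sheaf_ring[OF U])
  note [simp] = eval_closed[OF U] e_closed[OF U] tangent_smult_closed[OF U] circ_closed[OF U]
    circ_e_left[OF U] circ_e_right[OF U] circ_smult_left[OF U]
  have zero_e: "\<zero>\<^bsub>sheaf M U\<^esub> \<odot>\<^bsub>tangent M U\<^esub> mk_vf M U e = \<zero>\<^bsub>tangent M U\<^esub>"
    using additive_zero[where h = "\<lambda>g. g \<odot>\<^bsub>tangent M U\<^esub> mk_vf M U e", OF sheaf_group[OF U] tangent_group[OF U]]
    by (simp add: tangent_add_smult[OF U])
  assume "symm_eq M U t u"
  then show "eval U t = eval U u"
  proof (induction rule: symm_eq.induct)
  case (plus_assoc t u v) then show ?case by (simp add: T.a_assoc)
next
  case (plus_comm t u) then show ?case by (simp add: T.a_comm)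
next
  case (plus_zero t) then show ?case by (simp add: zero_e)
next
  case (plus_neg t) then show ?case by (simp add: eval_signed[OF U] T.l_neg zero_e)
next
  case (times_assoc t u v) then show ?case by (simp add: circ_assoc[OF U])
next
  case (one_times t) then show ?case by (simp add: tangent_one_smult[OF U])
next
  case (times_one t) then show ?case by (simp add: tangent_one_smult[OF U])
next
  case (distrib_left t u v) then show ?case by (simp add: circ_add_right[OF U])
next
  case (distrib_right t u v) then show ?case by (simp add: circ_add_left[OF U])
next
  case (Fn_plus f g) then show ?case by (simp add: tangent_add_smult[OF U])
next
  case (Fn_times f g) then show ?case by (simp add: tangent_smult_smult[OF U])
next
  case (Vec_Fn_commute X a f b)
    then show ?case
      using homog_tangent_closed[OF U, of X a] homog_sheaf_closed[OF U, of f b]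
      by (simp add: eval_signed[OF U] circ_smult_right[OF U])
next
  case (Vec_Vec_commute X a Y b)
    then show ?case
      using homog_tangent_closed[OF U] circ_commute[OF U, of X a Y b]
      by (simp add: eval_signed[OF U])
qed (use U in \<open>simp_all add: circ_e_left circ_smult_left e_closed\<close>)
qed

end

section \<open>Germs and sections of the symmetric algebra\<close>

context superringed_space
begin

lemma germ_iff:
  "(W, u) \<in> symm_germ M p V t \<longleftrightarrow> opn W \<and> p \<in> W \<and> symm_wf M W u \<and>
     (\<exists>N. opn N \<and> p \<in> N \<and> N \<subseteq> V \<and> N \<subseteq> W \<and> symm_eq M N (symm_restr M V N t) (symm_restr M W N u))"
  unfolding symm_germ_def by (simp only: mem_Collect_eq prod.case le_inf_iff conj_assoc)

lemma germ_refl: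
  assumes "opn V" "p \<in> V" "symm_wf M V t"
  shows "(V, t) \<in> symm_germ M p V t"
  unfolding germ_iff using assms symm_eq.refl[OF assms(3)] by (auto simp: symm_restr_id intro!: exI[of _ V])

lemma germ_trans:
  assumes V: "opn V" "symm_wf M V t" and W: "(W, u) \<in> symm_germ M p V t" and Z: "(Z, v) \<in> symm_germ M p W u"
  shows "(Z, v) \<in> symm_germ M p V t"
proof -
  obtain N where N: "opn N" "p \<in> N" "N \<subseteq> V" "N \<subseteq> W" "symm_eq M N (symm_restr M V N t) (symm_restr M W N u)"
    and W: "opn W" "symm_wf M W u" using W unfolding germ_iff by blast
  obtain N' where N': "opn N'" "p \<in> N'" "N' \<subseteq> W" "N' \<subseteq> Z" "symm_eq M N' (symm_restr M W N' u) (symm_restr M Z N' v)"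
    and Z: "opn Z" "p \<in> Z" "symm_wf M Z v" using Z unfolding germ_iff by blast
  let ?N = "N \<inter> N'"
  have o: "opn ?N" "?N \<subseteq> N" "?N \<subseteq> N'" using N N' by auto
  have "symm_eq M ?N (symm_restr M V ?N t) (symm_restr M W ?N u)"
    using symm_eq_restr[OF N(1) o(1,2) N(5)]
    by (simp add: symm_restr_restr[OF V(1) N(1) o(1,2) N(3) V(2)] symm_restr_restr[OF W(1) N(1) o(1,2) N(4) W(2)])
  also have "symm_eq M ?N \<dots> (symm_restr M Z ?N v)"
    using symm_eq_restr[OF N'(1) o(1,3) N'(5)]
    by (simp add: symm_restr_restr[OF W(1) N'(1) o(1,3) N'(3) W(2)] symm_restr_restr[OF Z(1) N'(1) o(1,3) N'(4) Z(3)])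
  finally have "symm_eq M ?N (symm_restr M V ?N t) (symm_restr M Z ?N v)" .
  moreover have "p \<in> ?N" "?N \<subseteq> V" "?N \<subseteq> Z" using N N' by auto
  ultimately show ?thesis unfolding germ_iff using o(1) Z by blast
qed

lemma germ_sym:
  assumes "opn V" "p \<in> V" "symm_wf M V t" "(W, u) \<in> symm_germ M p V t"
  shows "(V, t) \<in> symm_germ M p W u"
proof -
  obtain N where N: "opn N" "p \<in> N" "N \<subseteq> V" "N \<subseteq> W" "symm_eq M N (symm_restr M V N t) (symm_restr M W N u)"
    using assms(4) unfolding germ_iff by blast
  show ?thesis unfolding germ_iff using assms(1-3) N(1-4) symm_eq.sym[OF N(5)] by blast
qed

text \<open>A germ is the class of all pairs that agree with a given one near \<open>p\<close>, so
  germs coincide as soon as one of them contains a representative of the other.\<close>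

lemma germ_eqI:
  assumes V: "opn V" "p \<in> V" "symm_wf M V t" and W: "(W, u) \<in> symm_germ M p V t"
  shows "symm_germ M p W u = symm_germ M p V t"
proof -
  have Wwf: "opn W" "symm_wf M W u" using W by (simp_all add: germ_iff)
  have "(Z, v) \<in> symm_germ M p W u \<longleftrightarrow> (Z, v) \<in> symm_germ M p V t" for Z v
    using germ_trans[OF V(1,3) W] germ_trans[OF Wwf germ_sym[OF V W]] by blast
  then show ?thesis by auto
qed

lemma germ_restr:
  assumes "opn V" "symm_wf M V t" "opn N" "N \<subseteq> V" "p \<in> N"
  shows "symm_germ M p N (symm_restr M V N t) = symm_germ M p V t"
proof (rule germ_eqI)
  have "symm_wf M N (symm_restr M V N t)" using symm_wf_restr[OF assms(1,3,4)] assms(2) by simp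
  then show "(N, symm_restr M V N t) \<in> symm_germ M p V t"
    unfolding germ_iff using assms symm_eq.refl by (auto simp: symm_restr_id intro!: exI[of _ N])
qed (use assms in auto)

lemma germ_cong:
  assumes V: "opn V" "p \<in> V" and eq: "symm_eq M V t u"
  shows "symm_germ M p V t = symm_germ M p V u"
proof (rule germ_eqI[OF V])
  note wf = symm_eq_wf[OF V(1) eq]
  then show "(V, t) \<in> symm_germ M p V u"
    unfolding germ_iff using V symm_eq.sym[OF eq] by (auto simp: symm_restr_id intro!: exI[of _ V])
  show "symm_wf M V u" by fact
qed

text \<open>\<open>germ_lift\<close> is a union over all pairs of representatives on a common
  neighbourhood. It is the expected germ because every such pair yields the same class, by
  congruence on the intersection of two neighbourhoods. Addition and multiplication share this
  argument.\<close>

lemma germ_lift_germ: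
  assumes V: "opn V" "p \<in> V" and wf: "symm_wf M V t" "symm_wf M V u"
    and c_wf: "\<And>W t u. symm_wf M W (c t u) \<longleftrightarrow> symm_wf M W t \<and> symm_wf M W u"
    and c_restr: "\<And>W N t u. symm_restr M W N (c t u) = c (symm_restr M W N t) (symm_restr M W N u)"
    and c_cong: "\<And>N t t' u u'. symm_eq M N t t' \<Longrightarrow> symm_eq M N u u' \<Longrightarrow> symm_eq M N (c t u) (c t' u')"
  shows "germ_lift M c p (symm_germ M p V t) (symm_germ M p V u) = symm_germ M p V (c t u)"
proof -
  have *: "symm_germ M p W (c t' u') = symm_germ M p V (c t u)"
    if t': "(W, t') \<in> symm_germ M p V t" and u': "(W, u') \<in> symm_germ M p V u" for W t' u'
  proof (rule germ_eqI[OF V])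
    obtain N where N: "opn N" "p \<in> N" "N \<subseteq> V" "N \<subseteq> W" "symm_eq M N (symm_restr M V N t) (symm_restr M W N t')"
      and W: "opn W" "p \<in> W" "symm_wf M W t'" using t' unfolding germ_iff by blast
    obtain N' where N': "opn N'" "p \<in> N'" "N' \<subseteq> V" "N' \<subseteq> W" "symm_eq M N' (symm_restr M V N' u) (symm_restr M W N' u')"
      and u': "symm_wf M W u'" using u' unfolding germ_iff by blast
    let ?N = "N \<inter> N'"
    have o: "opn ?N" "?N \<subseteq> N" "?N \<subseteq> N'" using N N' by auto
    have "symm_eq M ?N (symm_restr M V ?N t) (symm_restr M W ?N t')"
      using symm_eq_restr[OF N(1) o(1,2) N(5)]
      by (simp add: symm_restr_restr[OF V(1) N(1) o(1,2) N(3) wf(1)] symm_restr_restr[OF W(1) N(1) o(1,2) N(4) W(3)])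
    moreover have "symm_eq M ?N (symm_restr M V ?N u) (symm_restr M W ?N u')"
      using symm_eq_restr[OF N'(1) o(1,3) N'(5)]
      by (simp add: symm_restr_restr[OF V(1) N'(1) o(1,3) N'(3) wf(2)] symm_restr_restr[OF W(1) N'(1) o(1,3) N'(4) u'])
    ultimately have "symm_eq M ?N (symm_restr M V ?N (c t u)) (symm_restr M W ?N (c t' u'))"
      unfolding c_restr by (rule c_cong)
    moreover have "p \<in> ?N" "?N \<subseteq> V" "?N \<subseteq> W" using N N' by auto
    moreover have "symm_wf M W (c t' u')" using c_wf W(3) u' by blast
    ultimately show "(W, c t' u') \<in> symm_germ M p V (c t u)"
      unfolding germ_iff using o(1) W by blast
  qed (use c_wf wf in blast)
  have "{symm_germ M p W (c t' u') | W t' u'. (W, t') \<in> symm_germ M p V t \<and> (W, u') \<in> symm_germ M p V u}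
      = {symm_germ M p V (c t u)}"
    using * germ_refl[OF V wf(1)] germ_refl[OF V wf(2)] by blast
  then show ?thesis unfolding germ_lift_def by simp
qed

lemma germ_lift_Plus:
  "opn V \<Longrightarrow> p \<in> V \<Longrightarrow> symm_wf M V t \<Longrightarrow> symm_wf M V u \<Longrightarrow>
    germ_lift M Plus p (symm_germ M p V t) (symm_germ M p V u) = symm_germ M p V (Plus t u)"
  by (rule germ_lift_germ) (auto intro: symm_eq.plus_cong)

lemma germ_lift_Times:
  "opn V \<Longrightarrow> p \<in> V \<Longrightarrow> symm_wf M V t \<Longrightarrow> symm_wf M V u \<Longrightarrow>
    germ_lift M Times p (symm_germ M p V t) (symm_germ M p V u) = symm_germ M p V (Times t u)"
  by (rule germ_lift_germ) (auto intro: symm_eq.times_cong)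

section \<open>Sections of the sheafified algebra and the terms representing them\<close>

lemma symm_sel:
  "carrier (symm M U) = {s \<in> extensional U. \<forall>p\<in>U. \<exists>V t. opn V \<and> p \<in> V \<and> V \<subseteq> U \<and>
      symm_wf M V t \<and> (\<forall>q\<in>V. s q = symm_germ M q V t)}"
  "mult (symm M U) = (\<lambda>s s'. \<lambda>p\<in>U. germ_lift M Times p (s p) (s' p))"
  "one (symm M U) = symm_section M U (Fn \<one>\<^bsub>sheaf M U\<^esub>)"
  "zero (symm M U) = symm_section M U (Fn \<zero>\<^bsub>sheaf M U\<^esub>)"
  "add (symm M U) = (\<lambda>s s'. \<lambda>p\<in>U. germ_lift M Plus p (s p) (s' p))"
  "homog (symm M U) a = {s \<in> carrier (symm M U). \<forall>p\<in>U. \<exists>(V, t) \<in> s p. symm_homog M V a t}"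
  by (simp_all add: symm_def Let_def)

text \<open>Where a section is represented by a term on a whole open set, computations with germs
  become computations with terms. The equality of restricted functions is the form suited to the
  bracket, which commutes with \<open>restrict\<close>.\<close>

definition represents where
  "represents N t s \<longleftrightarrow> opn N \<and> symm_wf M N t \<and> restrict s N = symm_section M N t"

lemma representsD:
  assumes "represents N t s"
  shows "opn N" "symm_wf M N t" "q \<in> N \<Longrightarrow> s q = symm_germ M q N t"
proof -
  show "opn N" "symm_wf M N t" using assms by (auto simp: represents_def)
  show "s q = symm_germ M q N t" if "q \<in> N"
    using assms that unfolding represents_def symm_section_def by (metis restrict_apply')
qed

lemma representsI:
  "opn N \<Longrightarrow> symm_wf M N t \<Longrightarrow> (\<And>q. q \<in> N \<Longrightarrow> s q = symm_germ M q N t) \<Longrightarrow> represents N t s"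
  by (simp add: represents_def symm_section_def restrict_def fun_eq_iff)

lemma represents_restr:
  assumes "represents N t s" "opn N'" "N' \<subseteq> N"
  shows "represents N' (symm_restr M N N' t) s"
proof (rule representsI)
  note D = representsD[OF assms(1)]
  show "symm_wf M N' (symm_restr M N N' t)" using symm_wf_restr[OF D(1) assms(2,3) D(2)] .
  show "s q = symm_germ M q N' (symm_restr M N N' t)" if "q \<in> N'" for q
    using germ_restr[OF D(1,2) assms(2,3) that] D(3) that assms(3) by auto
qed fact

lemma represents_section: "opn U \<Longrightarrow> symm_wf M U t \<Longrightarrow> represents U t (symm_section M U t)"
  by (rule representsI) (simp_all add: symm_section_def)

lemma represents_restrict: "N \<subseteq> V \<Longrightarrow> represents N t (restrict s V) \<longleftrightarrow> represents N t s"
  by (simp add: represents_def Int_absorb1)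

lemma symm_carrierD:
  assumes "s \<in> carrier (symm M U)" "p \<in> U"
  obtains N t where "p \<in> N" "N \<subseteq> U" "represents N t s"
proof -
  obtain V t where "opn V" "p \<in> V" "V \<subseteq> U" "symm_wf M V t" "\<forall>q\<in>V. s q = symm_germ M q V t"
    using assms unfolding symm_sel(1) by blast
  then show thesis using that[OF _ _ representsI] by auto
qed

lemma symm_carrierI:
  assumes "s \<in> extensional U" "\<And>p. p \<in> U \<Longrightarrow> \<exists>N t. p \<in> N \<and> N \<subseteq> U \<and> represents N t s"
  shows "s \<in> carrier (symm M U)"
  unfolding symm_sel
proof (intro CollectI conjI ballI)
  fix p assume "p \<in> U"
  then obtain N t where N: "p \<in> N" "N \<subseteq> U" "represents N t s" using assms(2) by blast
  show "\<exists>V t. opn V \<and> p \<in> V \<and> V \<subseteq> U \<and> symm_wf M V t \<and> (\<forall>q\<in>V. s q = symm_germ M q V t)"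
    using N(1,2) representsD[OF N(3)] by blast
qed fact

lemma symm_carrierD2:
  assumes "s \<in> carrier (symm M U)" "s' \<in> carrier (symm M U)" "p \<in> U"
  obtains N t t' where "p \<in> N" "N \<subseteq> U" "represents N t s" "represents N t' s'"
proof -
  obtain N t where N: "p \<in> N" "N \<subseteq> U" "represents N t s" by (rule symm_carrierD[OF assms(1,3)])
  obtain N' t' where N': "p \<in> N'" "N' \<subseteq> U" "represents N' t' s'" by (rule symm_carrierD[OF assms(2,3)])
  have o: "opn (N \<inter> N')" using representsD(1)[OF N(3)] representsD(1)[OF N'(3)] by auto
  show thesis
    by (rule that[OF _ _ represents_restr[OF N(3) o] represents_restr[OF N'(3) o]]) (use N(1,2) N'(1) in auto)
qed

lemma symm_carrierD3:
  assumes "s \<in> carrier (symm M U)" "s' \<in> carrier (symm M U)" "s'' \<in> carrier (symm M U)" "p \<in> U"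
  obtains N t t' t'' where "p \<in> N" "N \<subseteq> U" "represents N t s" "represents N t' s'" "represents N t'' s''"
proof -
  obtain N t t' where N: "p \<in> N" "N \<subseteq> U" "represents N t s" "represents N t' s'"
    by (rule symm_carrierD2[OF assms(1,2,4)])
  obtain N' t'' where N': "p \<in> N'" "N' \<subseteq> U" "represents N' t'' s''" by (rule symm_carrierD[OF assms(3,4)])
  have o: "opn (N \<inter> N')" using representsD(1)[OF N(3)] representsD(1)[OF N'(3)] by auto
  show thesis
  proof (rule that)
    show "p \<in> N \<inter> N'" "N \<inter> N' \<subseteq> U" using N(1,2) N'(1) by auto
    show "represents (N \<inter> N') (symm_restr M N (N \<inter> N') t) s"
      "represents (N \<inter> N') (symm_restr M N (N \<inter> N') t') s'"
      "represents (N \<inter> N') (symm_restr M N' (N \<inter> N') t'') s''"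
      using represents_restr[OF N(3) o] represents_restr[OF N(4) o] represents_restr[OF N'(3) o] by simp_all
  qed
qed

lemma represents_add:
  assumes "represents N t s" "represents N t' s'" "N \<subseteq> U"
  shows "represents N (Plus t t') (s \<oplus>\<^bsub>symm M U\<^esub> s')"
proof (rule representsI)
  note D = representsD[OF assms(1)] representsD[OF assms(2)]
  show "(s \<oplus>\<^bsub>symm M U\<^esub> s') q = symm_germ M q N (Plus t t')" if "q \<in> N" for q
  proof -
    have q: "q \<in> U" using that assms(3) by blast
    show ?thesis
      unfolding symm_sel(5) restrict_apply'[OF q] D(3)[OF that] D(6)[OF that]
      by (rule germ_lift_Plus) (use that D(1,2,5) in auto)
  qed
qed (use representsD(1,2)[OF assms(1)] representsD(1,2)[OF assms(2)] in auto)

lemma represents_mult: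
  assumes "represents N t s" "represents N t' s'" "N \<subseteq> U"
  shows "represents N (Times t t') (s \<otimes>\<^bsub>symm M U\<^esub> s')"
proof (rule representsI)
  note D = representsD[OF assms(1)] representsD[OF assms(2)]
  show "(s \<otimes>\<^bsub>symm M U\<^esub> s') q = symm_germ M q N (Times t t')" if "q \<in> N" for q
  proof -
    have q: "q \<in> U" using that assms(3) by blast
    show ?thesis
      unfolding symm_sel(2) restrict_apply'[OF q] D(3)[OF that] D(6)[OF that]
      by (rule germ_lift_Times) (use that D(1,2,5) in auto)
  qed
qed (use representsD(1,2)[OF assms(1)] representsD(1,2)[OF assms(2)] in auto)

lemma section_closed:
  assumes "opn U" "symm_wf M U t"
  shows "symm_section M U t \<in> carrier (symm M U)"
proof (rule symm_carrierI)
  show "\<exists>N u. p \<in> N \<and> N \<subseteq> U \<and> represents N u (symm_section M U t)" if "p \<in> U" for p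
    using that represents_section[OF assms] by blast
qed (simp add: symm_section_def)

lemma section_homog:
  assumes "opn U" "symm_homog M U a t"
  shows "symm_section M U t \<in> homog (symm M U) a"
proof -
  have wf: "symm_wf M U t" using symm_homog_wf assms .
  have "\<exists>(V, t) \<in> symm_section M U t p. symm_homog M V a t" if "p \<in> U" for p
    using germ_refl[OF assms(1) that wf] assms(2) that by (auto simp: symm_section_def)
  then show ?thesis using section_closed[OF assms(1) wf] by (simp add: symm_sel(6))
qed

lemma symm_add_closed:
  assumes "s \<in> carrier (symm M U)" "s' \<in> carrier (symm M U)"
  shows "s \<oplus>\<^bsub>symm M U\<^esub> s' \<in> carrier (symm M U)"
proof (rule symm_carrierI)
  fix p assume p: "p \<in> U"
  obtain N t t' where N: "p \<in> N" "N \<subseteq> U" and r: "represents N t s" "represents N t' s'"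
    by (rule symm_carrierD2[OF assms p])
  show "\<exists>N t. p \<in> N \<and> N \<subseteq> U \<and> represents N t (s \<oplus>\<^bsub>symm M U\<^esub> s')"
    using represents_add[OF r N(2)] N by blast
qed (unfold symm_sel(5), rule restrict_extensional)

lemma symm_mult_closed:
  assumes "s \<in> carrier (symm M U)" "s' \<in> carrier (symm M U)"
  shows "s \<otimes>\<^bsub>symm M U\<^esub> s' \<in> carrier (symm M U)"
proof (rule symm_carrierI)
  fix p assume p: "p \<in> U"
  obtain N t t' where N: "p \<in> N" "N \<subseteq> U" and r: "represents N t s" "represents N t' s'"
    by (rule symm_carrierD2[OF assms p])
  show "\<exists>N t. p \<in> N \<and> N \<subseteq> U \<and> represents N t (s \<otimes>\<^bsub>symm M U\<^esub> s')"
    using represents_mult[OF r N(2)] N by blast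
qed (unfold symm_sel(2), rule restrict_extensional)

lemma restrict_symm_closed:
  assumes "opn V" "V \<subseteq> U" "s \<in> carrier (symm M U)"
  shows "restrict s V \<in> carrier (symm M V)"
proof (rule symm_carrierI)
  fix p assume p: "p \<in> V"
  then have "p \<in> U" using assms(2) by blast
  then obtain N t where N: "p \<in> N" "N \<subseteq> U" "represents N t s" by (rule symm_carrierD[OF assms(3)])
  have o: "opn (V \<inter> N)" using representsD(1)[OF N(3)] assms(1) by auto
  have "represents (V \<inter> N) (symm_restr M N (V \<inter> N) t) (restrict s V)"
    using represents_restr[OF N(3) o] represents_restrict[of "V \<inter> N" V] by simp
  then show "\<exists>N t. p \<in> N \<and> N \<subseteq> V \<and> represents N t (restrict s V)"
    using p N(1) by blast
qed simp

text \<open>Reduces an algebraic law for sections to the corresponding relation of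
  \<open>symm_eq\<close> between local representatives.\<close>

lemma symm_eq_representsI:
  assumes s: "s \<in> carrier (symm M U)" "s' \<in> carrier (symm M U)"
    and eq: "\<And>p. p \<in> U \<Longrightarrow> \<exists>N t t'. p \<in> N \<and> represents N t s \<and> represents N t' s' \<and> symm_eq M N t t'"
  shows "s = s'"
proof (rule extensionalityI[of s U s'])
  fix p assume "p \<in> U"
  then obtain N t t' where N: "p \<in> N" "represents N t s" "represents N t' s'" "symm_eq M N t t'"
    using eq by blast
  show "s p = s' p"
    using representsD(3)[OF N(2,1)] representsD(3)[OF N(3,1)] germ_cong[OF representsD(1)[OF N(2)] N(1,4)] by simp
qed (use s in \<open>simp_all add: symm_sel(1)\<close>)

lemma section_add:
  assumes "opn U" "symm_wf M U t" "symm_wf M U u"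
  shows "symm_section M U (Plus t u) = symm_section M U t \<oplus>\<^bsub>symm M U\<^esub> symm_section M U u"
  unfolding symm_sel(5) symm_section_def by (rule restrict_ext) (simp add: germ_lift_Plus assms)

lemma section_mult:
  assumes "opn U" "symm_wf M U t" "symm_wf M U u"
  shows "symm_section M U (Times t u) = symm_section M U t \<otimes>\<^bsub>symm M U\<^esub> symm_section M U u"
  unfolding symm_sel(2) symm_section_def by (rule restrict_ext) (simp add: germ_lift_Times assms)

lemma section_cong:
  assumes "opn U" "symm_eq M U t u"
  shows "symm_section M U t = symm_section M U u"
  unfolding symm_section_def using germ_cong[OF assms(1) _ assms(2)] by (rule restrict_ext)

text \<open>The group laws are needed for the canonical morphism to commute with negation and signs,
  which occur in the axioms of the bracket.\<close>

lemma symm_group: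
  assumes U: "opn U"
  shows "abelian_group (symm M U)"
proof (rule abelian_groupI)
  have zwf: "symm_wf M U (Fn \<zero>\<^bsub>sheaf M U\<^esub>)" by (simp add: sheaf_ops_closed U)
  show z: "\<zero>\<^bsub>symm M U\<^esub> \<in> carrier (symm M U)" using section_closed[OF U zwf] by (simp add: symm_sel(4))
  have zr: "represents N (Fn \<zero>\<^bsub>sheaf M N\<^esub>) \<zero>\<^bsub>symm M U\<^esub>" if "opn N" "N \<subseteq> U" for N
    using represents_restr[OF represents_section[OF U zwf] that] restr_zero[OF U that] by (simp add: symm_sel(4))
  show "s \<oplus>\<^bsub>symm M U\<^esub> s' \<oplus>\<^bsub>symm M U\<^esub> s'' = s \<oplus>\<^bsub>symm M U\<^esub> (s' \<oplus>\<^bsub>symm M U\<^esub> s'')"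
    if c: "s \<in> carrier (symm M U)" "s' \<in> carrier (symm M U)" "s'' \<in> carrier (symm M U)" for s s' s''
  proof (rule symm_eq_representsI[of _ U])
    fix p assume p: "p \<in> U"
    obtain N t t' t'' where N: "p \<in> N" "N \<subseteq> U" and r: "represents N t s" "represents N t' s'" "represents N t'' s''"
      using symm_carrierD3[OF c p] .
    show "\<exists>N t t'. p \<in> N \<and> represents N t (s \<oplus>\<^bsub>symm M U\<^esub> s' \<oplus>\<^bsub>symm M U\<^esub> s'')
        \<and> represents N t' (s \<oplus>\<^bsub>symm M U\<^esub> (s' \<oplus>\<^bsub>symm M U\<^esub> s'')) \<and> symm_eq M N t t'"
      using N(1) represents_add[OF represents_add[OF r(1,2) N(2)] r(3) N(2)]
        represents_add[OF r(1) represents_add[OF r(2,3) N(2)] N(2)]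
        symm_eq.plus_assoc[OF r[THEN representsD(2)]] by blast
  qed (simp_all add: symm_add_closed c)
  show "s \<oplus>\<^bsub>symm M U\<^esub> s' = s' \<oplus>\<^bsub>symm M U\<^esub> s"
    if c: "s \<in> carrier (symm M U)" "s' \<in> carrier (symm M U)" for s s'
  proof (rule symm_eq_representsI[of _ U])
    fix p assume p: "p \<in> U"
    obtain N t t' where N: "p \<in> N" "N \<subseteq> U" and r: "represents N t s" "represents N t' s'"
      using symm_carrierD2[OF c p] .
    show "\<exists>N t t'. p \<in> N \<and> represents N t (s \<oplus>\<^bsub>symm M U\<^esub> s')
        \<and> represents N t' (s' \<oplus>\<^bsub>symm M U\<^esub> s) \<and> symm_eq M N t t'"
      using N(1) represents_add[OF r N(2)] represents_add[OF r(2,1) N(2)]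
        symm_eq.plus_comm[OF r[THEN representsD(2)]] by blast
  qed (simp_all add: symm_add_closed c)
  show "\<zero>\<^bsub>symm M U\<^esub> \<oplus>\<^bsub>symm M U\<^esub> s = s" if c: "s \<in> carrier (symm M U)" for s
  proof (rule symm_eq_representsI[of _ U])
    fix p assume p: "p \<in> U"
    obtain N t where N: "p \<in> N" "N \<subseteq> U" and r: "represents N t s"
      using symm_carrierD[OF c p] .
    show "\<exists>N t t'. p \<in> N \<and> represents N t (\<zero>\<^bsub>symm M U\<^esub> \<oplus>\<^bsub>symm M U\<^esub> s)
        \<and> represents N t' s \<and> symm_eq M N t t'"
      using N(1) represents_add[OF zr[OF representsD(1)[OF r] N(2)] r N(2)] r
        symm_eq.plus_zero[OF r[THEN representsD(2)]] by blast
  qed (simp_all add: symm_add_closed c z)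
  show "\<exists>s'\<in>carrier (symm M U). s' \<oplus>\<^bsub>symm M U\<^esub> s = \<zero>\<^bsub>symm M U\<^esub>" if c: "s \<in> carrier (symm M U)" for s
  proof
    let ?m = "Fn (signed (sheaf M U) 1 \<one>\<^bsub>sheaf M U\<^esub>)"
    \<comment> \<open>The negative is the product with the constant section \<open>-1\<close>, as in
      the relation \<open>plus_neg\<close>.\<close>
    let ?s = "symm_section M U ?m \<otimes>\<^bsub>symm M U\<^esub> s"
    have mwf: "symm_wf M U ?m" using signed_one_closed[OF U] by simp
    show m: "?s \<in> carrier (symm M U)" using symm_mult_closed section_closed[OF U mwf] c by simp
    show "?s \<oplus>\<^bsub>symm M U\<^esub> s = \<zero>\<^bsub>symm M U\<^esub>"
    proof (rule symm_eq_representsI[of _ U])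
      fix p assume p: "p \<in> U"
      obtain N t where N: "p \<in> N" "N \<subseteq> U" and r: "represents N t s"
        using symm_carrierD[OF c p] .
      note o = representsD(1)[OF r]
      have "represents N (Fn (signed (sheaf M N) 1 \<one>\<^bsub>sheaf M N\<^esub>)) (symm_section M U ?m)"
        using represents_restr[OF represents_section[OF U mwf] o N(2)]
        by (simp add: restr_signed[OF U o N(2)] restr_one[OF U o N(2)] sheaf_ops_closed U)
      from represents_mult[OF this r N(2)] have "represents N (symm_signed M N 1 t) ?s"
        by (simp add: symm_signed_def)
      then show "\<exists>N t t'. p \<in> N \<and> represents N t (?s \<oplus>\<^bsub>symm M U\<^esub> s)
          \<and> represents N t' \<zero>\<^bsub>symm M U\<^esub> \<and> symm_eq M N t t'"
        using N(1) represents_add[OF _ r N(2)] zr[OF o N(2)]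
          symm_eq.plus_neg[OF representsD(2)[OF r]] by blast
    qed (simp_all add: symm_add_closed c z m)
  qed
qed (rule symm_add_closed)

end

section \<open>The canonical morphism\<close>

context tangent_multiplication
begin

text \<open>Two terms with the same germs are congruent only near each point, not necessarily over
  \<open>N\<close>. Their evaluations therefore agree locally, and vector fields are
  separated.\<close>

lemma represents_eval_eq:
  assumes "represents N t s" "represents N t' s"
  shows "eval N t = eval N t'"
proof (rule vf_separated)
  note D = representsD[OF assms(1)] representsD[OF assms(2)]
  let ?B = "{N'. opn N' \<and> N' \<subseteq> N \<and> mk_vf M N' (eval N t) = mk_vf M N' (eval N t')}"
  show "\<Union>?B = N"
  proof
    show "N \<subseteq> \<Union>?B"
    proof
      fix q assume q: "q \<in> N"
      have "(N, t') \<in> symm_germ M q N t"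
        using germ_refl[OF D(1) q D(5)] D(3)[OF q] D(6)[OF q] by simp
      then obtain N' where N': "opn N'" "q \<in> N'" "N' \<subseteq> N" "symm_eq M N' (symm_restr M N N' t) (symm_restr M N N' t')"
        unfolding germ_iff by blast
      have "mk_vf M N' (eval N t) = mk_vf M N' (eval N t')"
        using eval_eq[OF N'(1,4)] by (simp add: eval_restr D N')
      then show "q \<in> \<Union>?B" using N' by blast
    qed
  qed blast
qed (use representsD[OF assms(1)] representsD[OF assms(2)] eval_closed in auto)

text \<open>The field is glued from the evaluations over all open sets on which \<open>s\<close> is
  represented by a term; restricting representing terms shows that these sets are closed under
  passing to smaller ones.\<close>

lemma canonical_morphism_exists:
  assumes U: "opn U" and s: "s \<in> carrier (symm M U)"
  shows "\<exists>X\<in>carrier (tangent M U). \<forall>N t. N \<subseteq> U \<longrightarrow> represents N t s \<longrightarrow> mk_vf M N X = eval N t"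
proof -
  let ?B = "{N. N \<subseteq> U \<and> (\<exists>t. represents N t s)}"
  \<comment> \<open>By \<open>represents_eval_eq\<close> the evaluation does not depend on the
    chosen term.\<close>
  define X where "X N = eval N (SOME t. represents N t s)" for N
  have X: "X N = eval N t" if "represents N t s" for N t
    unfolding X_def by (rule represents_eval_eq[OF someI that]) (rule that)
  have "\<exists>Y\<in>carrier (tangent M U). \<forall>N\<in>?B. mk_vf M N Y = X N"
  proof (rule glue_vf)
    show "\<Union>?B = U"
    proof
      show "U \<subseteq> \<Union>?B"
      proof
        fix p assume "p \<in> U"
        then obtain N t where "p \<in> N" "N \<subseteq> U" "represents N t s" by (rule symm_carrierD[OF s])
        then show "p \<in> \<Union>?B" by blast
      qed
    qed blast
  next
    fix N N' assume N: "N \<in> ?B" "opn N'" "N' \<subseteq> N"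
    then obtain t where "represents N t s" by blast
    with represents_restr[OF this N(2,3)] show "N' \<in> ?B" using N by blast
  next
    fix N assume "N \<in> ?B"
    then obtain t where "represents N t s" by blast
    then show "X N \<in> carrier (tangent M N)"
      using X[of N t] eval_closed[OF representsD(1,2)[of N t s]] by simp
  next
    fix N N' assume N: "N \<in> ?B" "N' \<in> ?B" "N' \<subseteq> N"
    then obtain t where t: "represents N t s" by blast
    have o: "opn N'" using N(2) representsD(1) by blast
    show "mk_vf M N' (X N) = X N'"
      using X[OF t] X[OF represents_restr[OF t o N(3)]]
        eval_restr[OF representsD(1)[OF t] o N(3) representsD(2)[OF t]] by simp
  qed (use representsD(1) in blast)
  then obtain Y where Y: "Y \<in> carrier (tangent M U)" "\<And>N. N \<in> ?B \<Longrightarrow> mk_vf M N Y = X N" by blast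
  have "mk_vf M N Y = eval N t" if "N \<subseteq> U" "represents N t s" for N t
    using Y(2)[of N] X[OF that(2)] that by auto
  then show ?thesis using Y(1) by blast
qed

text \<open>This replaces the definite description by a usable characterization: the glued field
  satisfies it, and any other field satisfying it agrees with the glued one near every
  point.\<close>

lemma
  assumes U: "opn U" and s: "s \<in> carrier (symm M U)"
  shows canonical_morphism_closed: "canonical_morphism M circ e U s \<in> carrier (tangent M U)"
    and canonical_morphism_represents:
      "N \<subseteq> U \<Longrightarrow> represents N t s \<Longrightarrow> mk_vf M N (canonical_morphism M circ e U s) = eval N t"
proof -
  obtain X where X: "X \<in> carrier (tangent M U)"
    and XN: "\<And>N t. N \<subseteq> U \<Longrightarrow> represents N t s \<Longrightarrow> mk_vf M N X = eval N t"
    using canonical_morphism_exists[OF assms] by blast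
  have "canonical_morphism M circ e U s = X"
    unfolding canonical_morphism_def
  proof (rule the_equality, intro conjI ballI)
    fix p Vt assume p: "p \<in> U" and "Vt \<in> s p"
    moreover obtain V t where "Vt = (V, t)" by (cases Vt)
    ultimately have Vt: "Vt = (V, t)" "(V, t) \<in> s p" by auto
    obtain W u where W: "p \<in> W" "W \<subseteq> U" "represents W u s" using symm_carrierD[OF s p] .
    note D = representsD[OF W(3)]
    \<comment> \<open>The description ranges over every representative \<open>(V, t)\<close> of the
      germ, where \<open>V\<close> need not lie in \<open>U\<close>; it is compared with the
      representing term \<open>u\<close> on a common neighbourhood.\<close>
    obtain N where N: "opn N" "p \<in> N" "N \<subseteq> W" "N \<subseteq> V" "symm_eq M N (symm_restr M W N u) (symm_restr M V N t)"
      and V: "opn V" "symm_wf M V t"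
      using Vt(2) unfolding D(3)[OF W(1)] germ_iff by blast
    have "mk_vf M N X = mk_vf M N (mk_vf M W X)" using N by simp
    also have "\<dots> = eval N (symm_restr M W N u)" using XN[OF W(2,3)] eval_restr[OF D(1) N(1,3) D(2)] by simp
    also have "\<dots> = eval N (symm_restr M V N t)" by (rule eval_eq[OF N(1,5)])
    also have "\<dots> = mk_vf M N (eval V t)" using eval_restr[OF V(1) N(1,4) V(2)] by simp
    finally have "mk_vf M N X = mk_vf M N (eval V t)" .
    moreover have "N \<subseteq> U \<inter> V" using N W by blast
    ultimately show "case Vt of (V, t) \<Rightarrow> \<exists>N. opn N \<and> p \<in> N \<and> N \<subseteq> U \<inter> V \<and> mk_vf M N X = mk_vf M N (eval V t)"
      using N(1,2) Vt(1) by auto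
  next
    fix Y assume Y: "Y \<in> carrier (tangent M U) \<and> (\<forall>p\<in>U. \<forall>(V, t)\<in>s p. \<exists>N. opn N \<and> p \<in> N \<and> N \<subseteq> U \<inter> V \<and>
        mk_vf M N Y = mk_vf M N (eval V t))"
    let ?B = "{N. opn N \<and> N \<subseteq> U \<and> mk_vf M N Y = mk_vf M N X}"
    show "Y = X"
    proof (rule vf_separated)
      show "\<Union>?B = U"
      proof
        show "U \<subseteq> \<Union>?B"
        proof
          fix p assume p: "p \<in> U"
          obtain W u where W: "p \<in> W" "W \<subseteq> U" "represents W u s" using symm_carrierD[OF s p] .
          note D = representsD[OF W(3)]
          \<comment> \<open>The term representing \<open>s\<close> around \<open>p\<close> belongs
            to the germ at \<open>p\<close>, so the description determines the competitor
            \<open>Y\<close> near \<open>p\<close>.\<close>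
          have "(W, u) \<in> s p" using germ_refl[OF D(1) W(1) D(2)] D(3)[OF W(1)] by simp
          then obtain N where N: "opn N" "p \<in> N" "N \<subseteq> U \<inter> W" "mk_vf M N Y = mk_vf M N (eval W u)"
            using Y p by blast
          have "mk_vf M N Y = mk_vf M N X" using N XN[OF W(2,3), symmetric] by simp
          then show "p \<in> \<Union>?B" using N by blast
        qed
      qed blast
    qed (use Y X in auto)
  qed (use X in blast)
  then show "canonical_morphism M circ e U s \<in> carrier (tangent M U)"
    and "N \<subseteq> U \<Longrightarrow> represents N t s \<Longrightarrow> mk_vf M N (canonical_morphism M circ e U s) = eval N t"
    using X XN by auto
qed

text \<open>The local test by which the canonical morphism is shown to respect sums, products and
  restrictions.\<close>

lemma canonical_morphism_eqI:
  assumes U: "opn U" and s: "s \<in> carrier (symm M U)" and X: "X \<in> carrier (tangent M U)"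
    and eq: "\<And>p. p \<in> U \<Longrightarrow> \<exists>N t. p \<in> N \<and> N \<subseteq> U \<and> represents N t s \<and> mk_vf M N X = eval N t"
  shows "canonical_morphism M circ e U s = X"
proof (rule vf_separated)
  let ?B = "{N. opn N \<and> N \<subseteq> U \<and> mk_vf M N (canonical_morphism M circ e U s) = mk_vf M N X}"
  show "\<Union>?B = U"
  proof
    show "U \<subseteq> \<Union>?B"
    proof
      fix p assume "p \<in> U"
      then obtain N t where N: "p \<in> N" "N \<subseteq> U" "represents N t s" "mk_vf M N X = eval N t" using eq by blast
      then show "p \<in> \<Union>?B"
        using canonical_morphism_represents[OF U s N(2,3)] representsD(1)[OF N(3)] by auto
    qed
  qed blast
qed (use X canonical_morphism_closed[OF U s] in auto)

lemma canonical_morphism_section: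
  assumes "opn U" "symm_wf M U t"
  shows "canonical_morphism M circ e U (symm_section M U t) = eval U t"
  by (rule canonical_morphism_eqI[OF assms(1) section_closed[OF assms] eval_closed[OF assms]])
    (use represents_section[OF assms] vf_mk[OF eval_closed[OF assms]] in blast)

lemma canonical_morphism_restrict:
  assumes U: "opn U" and V: "opn V" "V \<subseteq> U" and s: "s \<in> carrier (symm M U)"
  shows "canonical_morphism M circ e V (restrict s V) = mk_vf M V (canonical_morphism M circ e U s)"
proof (rule canonical_morphism_eqI)
  fix p assume p: "p \<in> V"
  obtain N t where N: "p \<in> N" "N \<subseteq> V" "represents N t (restrict s V)"
    using symm_carrierD[OF restrict_symm_closed[OF V s] p] .
  then have "represents N t s" "N \<subseteq> U" using represents_restrict[of N V] V(2) by auto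
  then show "\<exists>N t. p \<in> N \<and> N \<subseteq> V \<and> represents N t (restrict s V)
      \<and> mk_vf M N (mk_vf M V (canonical_morphism M circ e U s)) = eval N t"
    using N canonical_morphism_represents[OF U s] by (intro exI[of _ N] exI[of _ t]) simp
qed (use V restrict_symm_closed[OF V s] restrict_closed[OF U V canonical_morphism_closed[OF U s]] in auto)

lemma canonical_morphism_add:
  assumes U: "opn U" and s: "s \<in> carrier (symm M U)" "s' \<in> carrier (symm M U)"
  shows "canonical_morphism M circ e U (s \<oplus>\<^bsub>symm M U\<^esub> s')
    = canonical_morphism M circ e U s \<oplus>\<^bsub>tangent M U\<^esub> canonical_morphism M circ e U s'"
proof (rule canonical_morphism_eqI[OF U symm_add_closed[OF s]])
  fix p assume p: "p \<in> U"
  obtain N t t' where N: "p \<in> N" "N \<subseteq> U" and r: "represents N t s" "represents N t' s'"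
    using symm_carrierD2[OF s p] .
  have "mk_vf M N (canonical_morphism M circ e U s \<oplus>\<^bsub>tangent M U\<^esub> canonical_morphism M circ e U s') = eval N (Plus t t')"
    by (simp add: restrict_add[OF representsD(1)[OF r(1)] N(2)]
        canonical_morphism_represents[OF U s(1) N(2) r(1)] canonical_morphism_represents[OF U s(2) N(2) r(2)])
  then show "\<exists>N t. p \<in> N \<and> N \<subseteq> U \<and> represents N t (s \<oplus>\<^bsub>symm M U\<^esub> s') \<and>
      mk_vf M N (canonical_morphism M circ e U s \<oplus>\<^bsub>tangent M U\<^esub> canonical_morphism M circ e U s') = eval N t"
    using N represents_add[OF r N(2)] by blast
qed (simp add: tangent_add_closed U canonical_morphism_closed s)

lemma canonical_morphism_mult:
  assumes U: "opn U" and s: "s \<in> carrier (symm M U)" "s' \<in> carrier (symm M U)"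
  shows "canonical_morphism M circ e U (s \<otimes>\<^bsub>symm M U\<^esub> s')
    = circ U (canonical_morphism M circ e U s) (canonical_morphism M circ e U s')"
proof (rule canonical_morphism_eqI[OF U symm_mult_closed[OF s]])
  fix p assume p: "p \<in> U"
  obtain N t t' where N: "p \<in> N" "N \<subseteq> U" and r: "represents N t s" "represents N t' s'"
    using symm_carrierD2[OF s p] .
  have "mk_vf M N (circ U (canonical_morphism M circ e U s) (canonical_morphism M circ e U s')) = eval N (Times t t')"
    by (simp add: circ_restrict[OF U representsD(1)[OF r(1)] N(2)] canonical_morphism_closed U
        canonical_morphism_represents[OF U s(1) N(2) r(1)] canonical_morphism_represents[OF U s(2) N(2) r(2)] s)
  then show "\<exists>N t. p \<in> N \<and> N \<subseteq> U \<and> represents N t (s \<otimes>\<^bsub>symm M U\<^esub> s') \<and>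
      mk_vf M N (circ U (canonical_morphism M circ e U s) (canonical_morphism M circ e U s')) = eval N t"
    using N represents_mult[OF r N(2)] by blast
qed (simp add: circ_closed U canonical_morphism_closed s)

end

section \<open>The bracket of the generators of the spectral ideal\<close>

text \<open>The last step of the double Leibniz expansion: the two product terms carry a minus sign,
  and the Poisson tensor of \<open>X \<circ> Y\<close> arises as the negative of a negative.\<close>

lemma (in abelian_group) minus_rearrange:
  "x \<in> carrier G \<Longrightarrow> y \<in> carrier G \<Longrightarrow> z \<in> carrier G \<Longrightarrow> (\<ominus> x \<oplus> \<ominus> y) \<ominus> \<ominus> z = z \<ominus> x \<ominus> y"
  by (simp add: minus_eq a_ac)

locale poisson_multiplication = tangent_multiplication M circ e
  for M :: "('x, 'k::field, 'a) superspace" and circ e +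
  fixes br :: "'x set \<Rightarrow> ('x \<Rightarrow> ('x, 'a) symm_germ) \<Rightarrow> ('x \<Rightarrow> ('x, 'a) symm_germ)
    \<Rightarrow> ('x \<Rightarrow> ('x, 'a) symm_germ)"
  assumes bracket: "canonical_poisson_bracket M br"
begin

abbreviation phi where "phi \<equiv> canonical_morphism M circ e"

text \<open>Taking the image of the bracket at once turns products of the symmetric algebra into
  \<open>circ\<close>, so that all further computations take place in the module of vector
  fields.\<close>

definition phi_br where
  "phi_br U t u = phi U (br U (symm_section M U t) (symm_section M U u))"

text \<open>Terms have no negation, so the difference \<open>X Y - X \<circ> Y\<close> is formed
  with the negative inside the vector field.\<close>

definition generator where
  "generator U X Y = Plus (Times (Vec X) (Vec Y)) (Vec (\<ominus>\<^bsub>tangent M U\<^esub> circ U X Y))"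

lemma br_restrict:
  assumes "opn U" "opn V" "V \<subseteq> U" "s \<in> carrier (symm M U)" "t \<in> carrier (symm M U)"
  shows "restrict (br U s t) V = br V (restrict s V) (restrict t V)"
  using bracket[unfolded canonical_poisson_bracket_def Let_def, THEN spec, THEN mp, OF assms(1),
      THEN conjunct2, THEN conjunct2, THEN conjunct1] assms(2-) by blast

context
  fixes U assumes U: "opn U"
begin

lemmas bracket_conjs = bracket[unfolded canonical_poisson_bracket_def Let_def, THEN spec, THEN mp, OF U]

lemma br_closed: "s \<in> carrier (symm M U) \<Longrightarrow> t \<in> carrier (symm M U) \<Longrightarrow> br U s t \<in> carrier (symm M U)"
  using bracket_conjs[THEN conjunct1] by blast

interpretation T: abelian_group "tangent M U" by (rule tangent_group[OF U])
interpretation S: abelian_group "symm M U" by (rule symm_group[OF U])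

lemma phi_closed [simp]: "s \<in> carrier (symm M U) \<Longrightarrow> phi U s \<in> carrier (tangent M U)"
  by (rule canonical_morphism_closed[OF U])

lemma
  assumes "s \<in> carrier (symm M U)"
  shows phi_minus: "phi U (\<ominus>\<^bsub>symm M U\<^esub> s) = \<ominus>\<^bsub>tangent M U\<^esub> phi U s"
    and phi_signed: "phi U (signed (symm M U) x s) = signed (tangent M U) x (phi U s)"
  using additive_minus[where h = "phi U", OF symm_group[OF U] tangent_group[OF U] _ _ assms]
    additive_signed[where h = "phi U", OF symm_group[OF U] tangent_group[OF U] _ _ assms]
  by (simp_all add: canonical_morphism_add[OF U])

lemma phi_br_closed [simp]: "symm_wf M U t \<Longrightarrow> symm_wf M U u \<Longrightarrow> phi_br U t u \<in> carrier (tangent M U)"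
  by (simp add: phi_br_def br_closed section_closed[OF U])

lemma phi_br_add_left:
  assumes "symm_wf M U t" "symm_wf M U u" "symm_wf M U v"
  shows "phi_br U (Plus t u) v = phi_br U t v \<oplus>\<^bsub>tangent M U\<^esub> phi_br U u v"
proof -
  note c = assms[THEN section_closed[OF U]]
  show ?thesis
    using bracket_conjs[THEN conjunct2, THEN conjunct2, THEN conjunct2, THEN conjunct1, rule_format, OF c, THEN conjunct1]
    by (simp add: phi_br_def section_add[OF U] assms canonical_morphism_add[OF U] br_closed c)
qed

lemma phi_br_add_right:
  assumes "symm_wf M U t" "symm_wf M U u" "symm_wf M U v"
  shows "phi_br U t (Plus u v) = phi_br U t u \<oplus>\<^bsub>tangent M U\<^esub> phi_br U t v"
proof -
  note c = assms[THEN section_closed[OF U]]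
  show ?thesis
    using bracket_conjs[THEN conjunct2, THEN conjunct2, THEN conjunct2, THEN conjunct1, rule_format, OF c, THEN conjunct2]
    by (simp add: phi_br_def section_add[OF U] assms canonical_morphism_add[OF U] br_closed c)
qed

lemma phi_br_antisym:
  assumes "symm_homog M U a t" "symm_homog M U b u"
  shows "phi_br U t u = \<ominus>\<^bsub>tangent M U\<^esub> signed (tangent M U) (a * b) (phi_br U u t)"
proof -
  note h = assms[THEN section_homog[OF U]]
  note c = assms[THEN symm_homog_wf[OF U], THEN section_closed[OF U]]
  show ?thesis
    unfolding phi_br_def
      bracket_conjs[THEN conjunct2, THEN conjunct2, THEN conjunct2, THEN conjunct2, THEN conjunct2, THEN conjunct1, rule_format, OF h]
    by (simp add: phi_minus phi_signed br_closed c)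
qed

text \<open>The Leibniz rules of the bracket, transported by the multiplicative canonical morphism:
  the factor that is not differentiated enters only through its evaluation.\<close>

lemma
  assumes "symm_homog M U a t" "symm_homog M U b u" "symm_homog M U c v"
  shows phi_br_mult_right: "phi_br U t (Times u v) = circ U (phi_br U t u) (eval U v)
      \<oplus>\<^bsub>tangent M U\<^esub> signed (tangent M U) (a * b) (circ U (eval U u) (phi_br U t v))"
    and phi_br_mult_left: "phi_br U (Times t u) v = circ U (eval U t) (phi_br U u v)
      \<oplus>\<^bsub>tangent M U\<^esub> signed (tangent M U) (b * c) (circ U (phi_br U t v) (eval U u))"
proof -
  note h = assms[THEN section_homog[OF U]]
  note wf = assms[THEN symm_homog_wf[OF U]]
  note c = wf[THEN section_closed[OF U]]
  note leibniz = bracket_conjs[THEN conjunct2, THEN conjunct2, THEN conjunct2, THEN conjunct2, THEN conjunct2,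
      THEN conjunct2, THEN conjunct2, THEN conjunct1, rule_format, OF h]
  note phi = canonical_morphism_add[OF U] canonical_morphism_mult[OF U] phi_signed br_closed c
    symm_mult_closed canonical_morphism_section[OF U] wf
  show "phi_br U t (Times u v) = circ U (phi_br U t u) (eval U v)
      \<oplus>\<^bsub>tangent M U\<^esub> signed (tangent M U) (a * b) (circ U (eval U u) (phi_br U t v))"
    unfolding phi_br_def section_mult[OF U wf(2,3)] leibniz[THEN conjunct1] by (simp add: phi)
  show "phi_br U (Times t u) v = circ U (eval U t) (phi_br U u v)
      \<oplus>\<^bsub>tangent M U\<^esub> signed (tangent M U) (b * c) (circ U (phi_br U t v) (eval U u))"
    unfolding phi_br_def section_mult[OF U wf(1,2)] leibniz[THEN conjunct2] by (simp add: phi)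
qed

lemma phi_br_Vec_Vec:
  assumes "X \<in> homog (tangent M U) a" "Y \<in> homog (tangent M U) b"
  shows "phi_br U (Vec X) (Vec Y) = lie_bracket M U a b X Y"
proof -
  have "br U (symm_vec M U X) (symm_vec M U Y) = symm_vec M U (lie_bracket M U a b X Y)"
    using bracket_conjs assms by blast
  moreover have "symm_wf M U (Vec (lie_bracket M U a b X Y))"
    using homog_tangent_closed[OF U bracket_homog[OF U assms]] by simp
  ultimately show ?thesis by (simp add: phi_br_def canonical_morphism_section[OF U])
qed

lemma phi_br_cong: "symm_eq M U u u' \<Longrightarrow> phi_br U t u = phi_br U t u'"
  unfolding phi_br_def using section_cong[OF U] by metis

lemma phi_br_cong_left: "symm_eq M U u u' \<Longrightarrow> phi_br U u t = phi_br U u' t"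
  unfolding phi_br_def using section_cong[OF U] by metis

lemma phi_br_Vec_add:
  assumes "symm_wf M U t" "X \<in> carrier (tangent M U)" "Y \<in> carrier (tangent M U)"
  shows "phi_br U t (Vec (X \<oplus>\<^bsub>tangent M U\<^esub> Y)) = phi_br U t (Vec X) \<oplus>\<^bsub>tangent M U\<^esub> phi_br U t (Vec Y)"
  using phi_br_add_right[of t "Vec X" "Vec Y"] phi_br_cong[OF symm_eq.Vec_plus] assms by simp

lemma phi_br_Vec_minus:
  assumes "symm_wf M U t" "X \<in> carrier (tangent M U)"
  shows "phi_br U t (Vec (\<ominus>\<^bsub>tangent M U\<^esub> X)) = \<ominus>\<^bsub>tangent M U\<^esub> phi_br U t (Vec X)"
    "phi_br U t (Vec \<zero>\<^bsub>tangent M U\<^esub>) = \<zero>\<^bsub>tangent M U\<^esub>"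
  using additive_minus[where h = "\<lambda>X. phi_br U t (Vec X)", OF tangent_group[OF U] tangent_group[OF U]]
    additive_zero[where h = "\<lambda>X. phi_br U t (Vec X)", OF tangent_group[OF U] tangent_group[OF U]] assms
  by (simp_all add: phi_br_Vec_add)

lemma phi_br_Vec_minus_left:
  assumes "symm_wf M U t" "X \<in> carrier (tangent M U)"
  shows "phi_br U (Vec (\<ominus>\<^bsub>tangent M U\<^esub> X)) t = \<ominus>\<^bsub>tangent M U\<^esub> phi_br U (Vec X) t"
proof -
  have "phi_br U (Vec (X \<oplus>\<^bsub>tangent M U\<^esub> Y)) t = phi_br U (Vec X) t \<oplus>\<^bsub>tangent M U\<^esub> phi_br U (Vec Y) t"
    if "X \<in> carrier (tangent M U)" "Y \<in> carrier (tangent M U)" for X Y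
    using phi_br_add_left[of "Vec X" "Vec Y" t] phi_br_cong_left[OF symm_eq.Vec_plus] assms that by simp
  then show ?thesis
    using additive_minus[where h = "\<lambda>X. phi_br U (Vec X) t", OF tangent_group[OF U] tangent_group[OF U]] assms
    by simp
qed

section \<open>The generators of the kernel and their brackets\<close>

context
  fixes X Y a b assumes X: "X \<in> homog (tangent M U) a" and Y: "Y \<in> homog (tangent M U) b"
begin

lemma generator_homog: "symm_homog M U (a + b) (generator U X Y)"
  unfolding generator_def
  by (intro symm_homog.intros minus_homog circ_homog X Y U)

lemma eval_generator: "eval U (generator U X Y) = \<zero>\<^bsub>tangent M U\<^esub>"
  using homog_tangent_closed[OF U X] homog_tangent_closed[OF U Y]
  by (simp add: generator_def T.r_neg circ_closed[OF U])

lemma phi_br_generator_right: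
  assumes "symm_wf M U t"
  shows "phi_br U t (generator U X Y) = phi_br U t (Times (Vec X) (Vec Y)) \<ominus>\<^bsub>tangent M U\<^esub> phi_br U t (Vec (circ U X Y))"
  using assms homog_tangent_closed[OF U X] homog_tangent_closed[OF U Y]
  by (simp add: generator_def phi_br_add_right phi_br_Vec_minus circ_closed[OF U] T.minus_eq)

lemma phi_br_generator_left:
  assumes "symm_wf M U t"
  shows "phi_br U (generator U X Y) t = phi_br U (Times (Vec X) (Vec Y)) t \<ominus>\<^bsub>tangent M U\<^esub> phi_br U (Vec (circ U X Y)) t"
  using assms homog_tangent_closed[OF U X] homog_tangent_closed[OF U Y]
  by (simp add: generator_def phi_br_add_left phi_br_Vec_minus_left circ_closed[OF U] T.minus_eq)

end

lemma poisson_tensor_homog: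
  assumes "X \<in> homog (tangent M U) a" "Z \<in> homog (tangent M U) c" "W \<in> homog (tangent M U) d"
  shows "poisson_tensor M circ U a c d X Z W \<in> homog (tangent M U) (a + c + d)"
proof -
  have "lie_bracket M U a (c + d) X (circ U Z W) \<in> homog (tangent M U) (a + c + d)"
    using bracket_homog[OF U assms(1) circ_homog[OF U assms(2,3)]] by (simp add: add.assoc)
  moreover have "circ U (lie_bracket M U a c X Z) W \<in> homog (tangent M U) (a + c + d)"
    using circ_homog[OF U bracket_homog[OF U assms(1,2)] assms(3)] .
  moreover have "circ U Z (lie_bracket M U a d X W) \<in> homog (tangent M U) (a + c + d)"
    using circ_homog[OF U assms(2) bracket_homog[OF U assms(1,3)]] by (simp add: ac_simps)
  ultimately show ?thesis
    unfolding poisson_tensor_def T.minus_eq by (intro add_homog minus_homog signed_homog U)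
qed

lemma phi_br_Vec_generator:
  assumes X: "X \<in> homog (tangent M U) a" and Z: "Z \<in> homog (tangent M U) c" and W: "W \<in> homog (tangent M U) d"
  shows "phi_br U (Vec X) (generator U Z W) = \<ominus>\<^bsub>tangent M U\<^esub> poisson_tensor M circ U a c d X Z W"
proof -
  note c = homog_tangent_closed[OF U X] homog_tangent_closed[OF U Z] homog_tangent_closed[OF U W]
  note v = X[THEN symm_homog.intros(2)] Z[THEN symm_homog.intros(2)] W[THEN symm_homog.intros(2)]
  have l: "lie_bracket M U a c X Z \<in> carrier (tangent M U)" "lie_bracket M U a d X W \<in> carrier (tangent M U)"
    "lie_bracket M U a (c + d) X (circ U Z W) \<in> carrier (tangent M U)"
    using homog_tangent_closed[OF U] bracket_homog[OF U] circ_homog[OF U] assms by blast+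
  have "phi_br U (Vec X) (Times (Vec Z) (Vec W)) = circ U (lie_bracket M U a c X Z) W
      \<oplus>\<^bsub>tangent M U\<^esub> signed (tangent M U) (a * c) (circ U Z (lie_bracket M U a d X W))"
    by (simp add: phi_br_mult_right[OF v] phi_br_Vec_Vec[OF X Z] phi_br_Vec_Vec[OF X W])
  moreover have "phi_br U (Vec X) (Vec (circ U Z W)) = lie_bracket M U a (c + d) X (circ U Z W)"
    by (rule phi_br_Vec_Vec[OF X circ_homog[OF U Z W]])
  ultimately show ?thesis
    using c l by (simp add: phi_br_generator_right[OF Z W] poisson_tensor_def circ_closed[OF U] T.minus_eq
        T.minus_add T.a_ac)
qed

lemma phi_br_generator_generator:
  assumes X: "X \<in> homog (tangent M U) a" and Y: "Y \<in> homog (tangent M U) b"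
    and Z: "Z \<in> homog (tangent M U) c" and W: "W \<in> homog (tangent M U) d"
  shows "phi_br U (generator U X Y) (generator U Z W) =
    poisson_tensor M circ U (a + b) c d (circ U X Y) Z W
    \<ominus>\<^bsub>tangent M U\<^esub> circ U X (poisson_tensor M circ U b c d Y Z W)
    \<ominus>\<^bsub>tangent M U\<^esub> signed (tangent M U) (a * b) (circ U Y (poisson_tensor M circ U a c d X Z W))"
proof -
  note P = poisson_tensor_homog[OF X Z W] poisson_tensor_homog[OF Y Z W]
    poisson_tensor_homog[OF circ_homog[OF U X Y] Z W]
  note c = P[THEN homog_tangent_closed[OF U]] homog_tangent_closed[OF U X] homog_tangent_closed[OF U Y]
  let ?g = "generator U Z W"
  note g = generator_homog[OF Z W]
  \<comment> \<open>The sign \<open>b * (c + d)\<close> comes from the Leibniz rule in the first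
    argument, where the generator of parity \<open>c + d\<close> passes \<open>Y\<close>;
    \<open>(a + c + d) * b\<close> comes from moving the Poisson tensor of \<open>X\<close> past
    \<open>Y\<close>. Together they leave \<open>a * b\<close>.\<close>
  have bits: "b * (c + d) + (a + c + d) * b = a * b"
    by (cases a; cases b; cases c; cases d; simp)
  have "phi_br U (Times (Vec X) (Vec Y)) ?g = circ U X (\<ominus>\<^bsub>tangent M U\<^esub> poisson_tensor M circ U b c d Y Z W)
      \<oplus>\<^bsub>tangent M U\<^esub> signed (tangent M U) (b * (c + d))
        (circ U (\<ominus>\<^bsub>tangent M U\<^esub> poisson_tensor M circ U a c d X Z W) Y)"
    by (simp add: phi_br_mult_left[OF X[THEN symm_homog.intros(2)] Y[THEN symm_homog.intros(2)] g]
        phi_br_Vec_generator[OF X Z W] phi_br_Vec_generator[OF Y Z W])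
  also have "\<dots> = \<ominus>\<^bsub>tangent M U\<^esub> circ U X (poisson_tensor M circ U b c d Y Z W)
      \<oplus>\<^bsub>tangent M U\<^esub> \<ominus>\<^bsub>tangent M U\<^esub> signed (tangent M U) (a * b) (circ U Y (poisson_tensor M circ U a c d X Z W))"
    using c by (simp add: circ_minus_left[OF U] circ_minus_right[OF U] circ_commute[OF U P(1) Y] T.signed_minus
        T.signed_signed circ_closed[OF U] bits)
  finally have XY: "phi_br U (Times (Vec X) (Vec Y)) ?g = \<dots>" .
  show ?thesis
    unfolding phi_br_generator_left[OF X Y symm_homog_wf[OF U g]] XY
      phi_br_Vec_generator[OF circ_homog[OF U X Y] Z W]
    by (rule T.minus_rearrange) (use c circ_closed[OF U] in simp_all)
qed

section \<open>Brackets with elements of the kernel\<close>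

lemma phi_br_eval:
  assumes t: "symm_homog M U a t"
    and e: "phi_br U t (Vec (mk_vf M U e)) = \<zero>\<^bsub>tangent M U\<^esub>"
    and gen: "\<And>b c X Y. X \<in> homog (tangent M U) b \<Longrightarrow> Y \<in> homog (tangent M U) c \<Longrightarrow>
      phi_br U t (generator U X Y) = \<zero>\<^bsub>tangent M U\<^esub>"
    and u: "symm_homog M U d u"
  shows "phi_br U t u = phi_br U t (Vec (eval U u))"
  using u
proof (induction rule: symm_homog.induct)
  case (1 f b)
  note wf = symm_homog_wf[OF U t]
  note h = symm_homog.intros(1)[OF 1] symm_homog.intros(2)[OF e_homog[OF U]]
  have c: "f \<in> carrier (sheaf M U)" "mk_vf M U e \<in> carrier (tangent M U)"
    using homog_sheaf_closed[OF U 1] e_closed[OF U] by auto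
  \<comment> \<open>The field \<open>f e\<close> is read as the product of \<open>f\<close> and
    \<open>e\<close> in the symmetric algebra. In the Leibniz rule the term with the bracket of
    \<open>t\<close> and \<open>e\<close> vanishes, and the remaining factor \<open>e\<close> is the
    identity.\<close>
  have "phi_br U t (Vec (f \<odot>\<^bsub>tangent M U\<^esub> mk_vf M U e)) = phi_br U t (Times (Fn f) (Vec (mk_vf M U e)))"
    by (rule phi_br_cong[OF symm_eq.sym[OF symm_eq.Vec_smult[OF c]]])
  also have "\<dots> = phi_br U t (Fn f)"
    using c wf by (simp add: phi_br_mult_right[OF t h] e circ_e_right[OF U] circ_zero_right[OF U] tangent_smult_closed[OF U])
  finally show ?case by simp
next
  case (3 b u v)
  note wf = symm_homog_wf[OF U t] symm_homog_wf[OF U 3(1)] symm_homog_wf[OF U 3(2)]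
  show ?case
    using 3(3,4) by (simp add: phi_br_add_right wf phi_br_Vec_add eval_closed[OF U])
next
  case (4 b u c v)
  note wf = symm_homog_wf[OF U t] symm_homog_wf[OF U 4(1)] symm_homog_wf[OF U 4(2)]
  note h = eval_homog[OF U 4(1)] eval_homog[OF U 4(2)]
  note hc = homog_tangent_closed[OF U h(1)] homog_tangent_closed[OF U h(2)]
  \<comment> \<open>After the Leibniz rule a factor occurs only through its evaluation and through
    its bracket with \<open>t\<close>; by the induction hypothesis neither changes when the factor
    is replaced by its evaluation.\<close>
  have "phi_br U t (Times u v) = phi_br U t (Times (Vec (eval U u)) (Vec (eval U v)))"
    by (simp add: phi_br_mult_right[OF t 4(1,2)] phi_br_mult_right[OF t h[THEN symm_homog.intros(2)]] flip: 4(3,4))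
  \<comment> \<open>The two arguments differ by a generator, on which the bracket with
    \<open>t\<close> vanishes by assumption.\<close>
  also have "\<dots> = phi_br U t (Vec (circ U (eval U u) (eval U v)))"
  proof (rule T.diff_zero_imp_eq)
    show "phi_br U t (Times (Vec (eval U u)) (Vec (eval U v))) \<ominus>\<^bsub>tangent M U\<^esub>
        phi_br U t (Vec (circ U (eval U u) (eval U v))) = \<zero>\<^bsub>tangent M U\<^esub>"
      using gen[OF h] unfolding phi_br_generator_right[OF h wf(1)] .
  qed (use hc wf(1) circ_closed[OF U] in simp_all)
  finally show ?case by simp
qed simp

text \<open>For an even field the superbracket is the ordinary commutator. Applied to
  \<open>e\<close>, this is one of the two vanishing conditions from which the argument for the
  kernel starts.\<close>

lemma lie_bracket_self:
  assumes "X \<in> homog (tangent M U) 0"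
  shows "lie_bracket M U 0 0 X X = \<zero>\<^bsub>tangent M U\<^esub>"
  unfolding lie_bracket_def tangent_sel
proof (rule mk_vf_eqI)
  fix V f assume V: "opn V" "V \<subseteq> U" "f \<in> carrier (sheaf M V)"
  interpret A: abelian_group "sheaf M V" using sheaf_group V by simp
  have "X V (X V f) \<in> carrier (sheaf M V)" using homog_vf_closed[OF assms V(1,2)] V by blast
  then show "X V (X V f) \<ominus>\<^bsub>sheaf M V\<^esub> signed (sheaf M V) (0 * 0) (X V (X V f)) = \<zero>\<^bsub>sheaf M V\<^esub>"
    by (simp add: A.minus_eq A.r_neg)
qed

lemma phi_br_kernel:
  assumes identity: "\<And>a b c d X Y Z W. X \<in> homog (tangent M U) a \<Longrightarrow> Y \<in> homog (tangent M U) b \<Longrightarrow>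
      Z \<in> homog (tangent M U) c \<Longrightarrow> W \<in> homog (tangent M U) d \<Longrightarrow>
      poisson_tensor M circ U (a + b) c d (circ U X Y) Z W
      \<ominus>\<^bsub>tangent M U\<^esub> circ U X (poisson_tensor M circ U b c d Y Z W)
      \<ominus>\<^bsub>tangent M U\<^esub> signed (tangent M U) (a * b) (circ U Y (poisson_tensor M circ U a c d X Z W))
      = \<zero>\<^bsub>tangent M U\<^esub>"
    and t: "symm_homog M U i t" "eval U t = \<zero>\<^bsub>tangent M U\<^esub>"
    and u: "symm_homog M U j u" "eval U u = \<zero>\<^bsub>tangent M U\<^esub>"
  shows "phi_br U t u = \<zero>\<^bsub>tangent M U\<^esub>"
proof -
  let ?e = "mk_vf M U e"
  note e = e_homog[OF U] and ec = e_closed[OF U]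
  note eh = symm_homog.intros(2)[OF e]
  have gen_gen: "phi_br U (generator U X Y) (generator U Z W) = \<zero>\<^bsub>tangent M U\<^esub>"
    if "X \<in> homog (tangent M U) a" "Y \<in> homog (tangent M U) b"
      "Z \<in> homog (tangent M U) c" "W \<in> homog (tangent M U) d" for X Y Z W a b c d
    using phi_br_generator_generator[OF that] identity[OF that] by simp
  \<comment> \<open>The identity for \<open>X = Y = e\<close> reads \<open>P_e = 2 P_e\<close>.\<close>
  have e_gen: "phi_br U (Vec ?e) (generator U Z W) = \<zero>\<^bsub>tangent M U\<^esub>"
    if Z: "Z \<in> homog (tangent M U) c" and W: "W \<in> homog (tangent M U) d" for Z W c d
  proof -
    let ?P = "poisson_tensor M circ U 0 c d ?e Z W"
    have P: "?P \<in> carrier (tangent M U)"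
      by (rule homog_tangent_closed[OF U poisson_tensor_homog[OF e Z W]])
    have "?P \<ominus>\<^bsub>tangent M U\<^esub> ?P \<ominus>\<^bsub>tangent M U\<^esub> ?P = \<zero>\<^bsub>tangent M U\<^esub>"
      using identity[OF e e Z W] by (simp add: circ_e_left[OF U] ec P)
    then have "\<ominus>\<^bsub>tangent M U\<^esub> ?P = \<zero>\<^bsub>tangent M U\<^esub>"
      using P by (simp add: T.minus_eq T.r_neg)
    then show ?thesis using phi_br_Vec_generator[OF e Z W] by simp
  qed
  have e_e: "phi_br U (Vec ?e) (Vec ?e) = \<zero>\<^bsub>tangent M U\<^esub>"
    using phi_br_Vec_Vec[OF e e] lie_bracket_self[OF e] by simp
  \<comment> \<open>Signs are immaterial for vanishing, so a bracket may be treated with its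
    arguments in either order.\<close>
  have antisym: "phi_br U v w = \<zero>\<^bsub>tangent M U\<^esub>"
    if "symm_homog M U a v" "symm_homog M U b w" "phi_br U w v = \<zero>\<^bsub>tangent M U\<^esub>" for a b v w
    using phi_br_antisym[OF that(1,2)] that(3) by simp
  \<comment> \<open>The bracket with \<open>v\<close> depends only on the evaluation of
    \<open>w\<close>, and by additivity the bracket with the zero vector field is zero.\<close>
  have kernel: "phi_br U v w = \<zero>\<^bsub>tangent M U\<^esub>"
    if v: "symm_homog M U a v" and "phi_br U v (Vec ?e) = \<zero>\<^bsub>tangent M U\<^esub>"
      and "\<And>b c X Y. X \<in> homog (tangent M U) b \<Longrightarrow> Y \<in> homog (tangent M U) c \<Longrightarrow>
        phi_br U v (generator U X Y) = \<zero>\<^bsub>tangent M U\<^esub>"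
      and w: "symm_homog M U b w" "eval U w = \<zero>\<^bsub>tangent M U\<^esub>" for a b v w
    using phi_br_eval[OF that(1-4)] phi_br_Vec_minus(2)[OF symm_homog_wf[OF U v] ec] w(2) by simp
  have e_t: "phi_br U (Vec ?e) t = \<zero>\<^bsub>tangent M U\<^esub>"
    using kernel[OF eh e_e e_gen t] .
  have gen_t: "phi_br U (generator U X Y) t = \<zero>\<^bsub>tangent M U\<^esub>"
    if X: "X \<in> homog (tangent M U) a" and Y: "Y \<in> homog (tangent M U) b" for X Y a b
  proof -
    note g = generator_homog[OF X Y]
    have "phi_br U (generator U X Y) (Vec ?e) = \<zero>\<^bsub>tangent M U\<^esub>"
      by (rule antisym[OF g eh e_gen[OF X Y]])
    then show ?thesis using kernel[OF g _ gen_gen[OF X Y] t] by simp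
  qed
  show ?thesis
    using kernel[OF t(1) antisym[OF t(1) eh e_t] antisym[OF t(1) generator_homog gen_t] u] by simp
qed

end

section \<open>From terms back to sections: stability of the ideal\<close>

lemma spectral_ideal_iff:
  "s \<in> spectral_ideal M circ e U \<longleftrightarrow> s \<in> carrier (symm M U) \<and> phi U s = \<zero>\<^bsub>tangent M U\<^esub>"
  by (simp add: spectral_ideal_def)

lemma generator_spectral_ideal:
  assumes U: "opn U" and X: "X \<in> homog (tangent M U) a" and Y: "Y \<in> homog (tangent M U) b"
  shows "symm_section M U (generator U X Y) \<in> spectral_ideal M circ e U"
proof -
  have wf: "symm_wf M U (generator U X Y)" by (rule symm_homog_wf[OF U generator_homog[OF U X Y]])
  show ?thesis
    unfolding spectral_ideal_iff
    using section_closed[OF U wf] canonical_morphism_section[OF U wf] eval_generator[OF U X Y] by simp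
qed

lemma identity_iff_stable:
  "(\<forall>U a b c d X Y Z W. opn U
      \<and> X \<in> homog (tangent M U) a \<and> Y \<in> homog (tangent M U) b
      \<and> Z \<in> homog (tangent M U) c \<and> W \<in> homog (tangent M U) d \<longrightarrow>
      poisson_tensor M circ U (a + b) c d (circ U X Y) Z W
      \<ominus>\<^bsub>tangent M U\<^esub> circ U X (poisson_tensor M circ U b c d Y Z W)
      \<ominus>\<^bsub>tangent M U\<^esub> signed (tangent M U) (a * b) (circ U Y (poisson_tensor M circ U a c d X Z W))
      = \<zero>\<^bsub>tangent M U\<^esub>)
   \<longleftrightarrow>
   (\<forall>U. opn U \<longrightarrow>
      (\<forall>s \<in> spectral_ideal M circ e U. \<forall>t \<in> spectral_ideal M circ e U.
         br U s t \<in> spectral_ideal M circ e U))" (is "?identity \<longleftrightarrow> ?stable")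
proof
  assume stable: ?stable
  show ?identity
  proof (intro allI impI, elim conjE)
    fix U a b c d X Y Z W
    assume U: "opn U" and h: "X \<in> homog (tangent M U) a" "Y \<in> homog (tangent M U) b"
      "Z \<in> homog (tangent M U) c" "W \<in> homog (tangent M U) d"
    have "phi_br U (generator U X Y) (generator U Z W) = \<zero>\<^bsub>tangent M U\<^esub>"
      using stable[rule_format, OF U generator_spectral_ideal[OF U h(1,2)] generator_spectral_ideal[OF U h(3,4)]]
      by (simp add: phi_br_def spectral_ideal_iff)
    then show "poisson_tensor M circ U (a + b) c d (circ U X Y) Z W
      \<ominus>\<^bsub>tangent M U\<^esub> circ U X (poisson_tensor M circ U b c d Y Z W)
      \<ominus>\<^bsub>tangent M U\<^esub> signed (tangent M U) (a * b) (circ U Y (poisson_tensor M circ U a c d X Z W))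
      = \<zero>\<^bsub>tangent M U\<^esub>"
      unfolding phi_br_generator_generator[OF U h] .
  qed
next
  assume identity: ?identity
  show ?stable
  proof (intro allI impI ballI)
    fix U s t assume U: "opn U" and "s \<in> spectral_ideal M circ e U" "t \<in> spectral_ideal M circ e U"
    then have s: "s \<in> carrier (symm M U)" "phi U s = \<zero>\<^bsub>tangent M U\<^esub>"
      and t: "t \<in> carrier (symm M U)" "phi U t = \<zero>\<^bsub>tangent M U\<^esub>" by (auto simp: spectral_ideal_iff)
    have local_zero: "\<exists>N. opn N \<and> p \<in> N \<and> N \<subseteq> U \<and> mk_vf M N (phi U (br U s t)) = \<zero>\<^bsub>tangent M N\<^esub>"
      if p: "p \<in> U" for p
    proof -
      obtain N t1 t2 where N: "p \<in> N" "N \<subseteq> U" and r: "represents N t1 s" "represents N t2 t"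
        by (rule symm_carrierD2[OF s(1) t(1) p])
      note o = representsD(1)[OF r(1)]
      note wf = representsD(2)[OF r(1)] representsD(2)[OF r(2)]
      obtain u0 u1 where u: "symm_homog M N 0 u0" "symm_homog M N 1 u1" "symm_eq M N t1 (Plus u0 u1)"
        using symm_term_homog_split[OF o wf(1)] by blast
      obtain v0 v1 where v: "symm_homog M N 0 v0" "symm_homog M N 1 v1" "symm_eq M N t2 (Plus v0 v1)"
        using symm_term_homog_split[OF o wf(2)] by blast
      interpret T: abelian_group "tangent M N" by (rule tangent_group[OF o])
      have "eval N t1 = \<zero>\<^bsub>tangent M N\<^esub>" "eval N t2 = \<zero>\<^bsub>tangent M N\<^esub>"
        using canonical_morphism_represents[OF U s(1) N(2) r(1)] canonical_morphism_represents[OF U t(1) N(2) r(2)]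
          s(2) t(2) restrict_zero[OF U o N(2)] by simp_all
      then have "eval N u0 \<oplus>\<^bsub>tangent M N\<^esub> eval N u1 = \<zero>\<^bsub>tangent M N\<^esub>"
        "eval N v0 \<oplus>\<^bsub>tangent M N\<^esub> eval N v1 = \<zero>\<^bsub>tangent M N\<^esub>"
        using eval_eq[OF o u(3)] eval_eq[OF o v(3)] by simp_all
      \<comment> \<open>Evaluation preserves parity, so each sum decomposes zero into an even and an
        odd field. All four homogeneous parts thus lie in the kernel.\<close>
      then have z: "eval N u0 = \<zero>\<^bsub>tangent M N\<^esub>" "eval N u1 = \<zero>\<^bsub>tangent M N\<^esub>"
        "eval N v0 = \<zero>\<^bsub>tangent M N\<^esub>" "eval N v1 = \<zero>\<^bsub>tangent M N\<^esub>"
        using homog_sum_zero[OF o, of "eval N u0" 0 "eval N u1"] homog_sum_zero[OF o, of "eval N v0" 0 "eval N v1"]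
          eval_homog[OF o u(1)] eval_homog[OF o u(2)] eval_homog[OF o v(1)] eval_homog[OF o v(2)] by simp_all
      \<comment> \<open>The identity is assumed over every open set, hence also for vector fields on
        \<open>N\<close> that do not extend to \<open>U\<close>.\<close>
      have identity_N: "poisson_tensor M circ N (a + b) c d (circ N X Y) Z W
          \<ominus>\<^bsub>tangent M N\<^esub> circ N X (poisson_tensor M circ N b c d Y Z W)
          \<ominus>\<^bsub>tangent M N\<^esub> signed (tangent M N) (a * b) (circ N Y (poisson_tensor M circ N a c d X Z W))
          = \<zero>\<^bsub>tangent M N\<^esub>"
        if "X \<in> homog (tangent M N) a" "Y \<in> homog (tangent M N) b"
          "Z \<in> homog (tangent M N) c" "W \<in> homog (tangent M N) d" for a b c d X Y Z W
        using identity o that by blast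
      have kernel: "phi_br N v w = \<zero>\<^bsub>tangent M N\<^esub>"
        if "symm_homog M N i v" "eval N v = \<zero>\<^bsub>tangent M N\<^esub>"
          "symm_homog M N j w" "eval N w = \<zero>\<^bsub>tangent M N\<^esub>" for i j v w
        by (rule phi_br_kernel[OF o _ that]) (rule identity_N; assumption)
      note w = u(1,2)[THEN symm_homog_wf[OF o]] v(1,2)[THEN symm_homog_wf[OF o]]
      have "phi_br N t1 t2 = phi_br N (Plus u0 u1) (Plus v0 v1)"
        using phi_br_cong[OF o v(3)] phi_br_cong_left[OF o u(3)] by simp
      \<comment> \<open>By additivity the bracket is a sum of four brackets of homogeneous terms in
        the kernel.\<close>
      also have "\<dots> = \<zero>\<^bsub>tangent M N\<^esub>"
        using kernel[OF u(1) z(1) v(1) z(3)] kernel[OF u(1) z(1) v(2) z(4)]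
          kernel[OF u(2) z(2) v(1) z(3)] kernel[OF u(2) z(2) v(2) z(4)]
        by (simp add: phi_br_add_left[OF o] phi_br_add_right[OF o] w)
      finally have D0: "phi_br N t1 t2 = \<zero>\<^bsub>tangent M N\<^esub>" .
      \<comment> \<open>Both the bracket and the canonical morphism commute with restriction, and
        over \<open>N\<close> the two sections are induced by \<open>t1\<close> and
        \<open>t2\<close>.\<close>
      have "mk_vf M N (phi U (br U s t)) = phi N (restrict (br U s t) N)"
        using canonical_morphism_restrict[OF U o N(2) br_closed[OF U s(1) t(1)]] by simp
      also have "\<dots> = phi_br N t1 t2"
        using r unfolding br_restrict[OF U o N(2) s(1) t(1)] phi_br_def represents_def by simp
      finally show ?thesis using D0 o N by auto
    qed
    have "phi U (br U s t) = \<zero>\<^bsub>tangent M U\<^esub>"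
    proof (rule vf_separated)
      let ?B = "{N. opn N \<and> N \<subseteq> U \<and> mk_vf M N (phi U (br U s t)) = mk_vf M N \<zero>\<^bsub>tangent M U\<^esub>}"
      show "\<Union>?B = U"
      proof
        show "U \<subseteq> \<Union>?B"
        proof
          fix p assume "p \<in> U"
          then obtain N where "opn N" "p \<in> N" "N \<subseteq> U" "mk_vf M N (phi U (br U s t)) = \<zero>\<^bsub>tangent M N\<^esub>"
            using local_zero by blast
          then show "p \<in> \<Union>?B" using restrict_zero[OF U] by auto
        qed
      qed blast
    qed (use phi_closed[OF U br_closed[OF U s(1) t(1)]]
        abelian_monoid.zero_closed[OF abelian_group.axioms(1)[OF tangent_group[OF U]]] in auto)
    then show "br U s t \<in> spectral_ideal M circ e U"
      using br_closed[OF U s(1) t(1)] by (simp add: spectral_ideal_iff)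
  qed
qed

end

theorem theorem2p5:
  fixes M :: "('x, 'k::field_char_0, 'a) superspace"
    and circ :: "('x, 'a) vf_mult"
    and e :: "('x, 'a) vfield"
    and br :: "'x set \<Rightarrow> ('x \<Rightarrow> ('x, 'a) symm_germ) \<Rightarrow> ('x \<Rightarrow> ('x, 'a) symm_germ)
                 \<Rightarrow> ('x \<Rightarrow> ('x, 'a) symm_germ)"
    and m n :: nat
  assumes "supermanifold m n M"
    and "tangent_mult M circ e"
    and "canonical_poisson_bracket M br"
  shows "(\<forall>U a b c d X Y Z W. openin (base M) U
            \<and> X \<in> homog (tangent M U) a \<and> Y \<in> homog (tangent M U) b
            \<and> Z \<in> homog (tangent M U) c \<and> W \<in> homog (tangent M U) d \<longrightarrow>
            poisson_tensor M circ U (a + b) c d (circ U X Y) Z W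
            \<ominus>\<^bsub>tangent M U\<^esub> circ U X (poisson_tensor M circ U b c d Y Z W)
            \<ominus>\<^bsub>tangent M U\<^esub> signed (tangent M U) (a * b) (circ U Y (poisson_tensor M circ U a c d X Z W))
            = \<zero>\<^bsub>tangent M U\<^esub>)
         \<longleftrightarrow>
         (\<forall>U. openin (base M) U \<longrightarrow>
            (\<forall>s \<in> spectral_ideal M circ e U. \<forall>t \<in> spectral_ideal M circ e U.
               br U s t \<in> spectral_ideal M circ e U))"
proof -
  interpret superringed_space M
    using assms(1) by (simp add: supermanifold_def)
  interpret poisson_multiplication M circ e br
    by unfold_locales (fact assms)+
  show ?thesis by (rule identity_iff_stable)
qed

end
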